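(* Let $\Gamma\subset\mathbb{Q}^*$ be a finitely generated subgroup of rank $r\ge 0$. Put $\Gamma_\infty=\{x\in\mathbb{C}^*: x^n\in\Gamma \text{ for some integer } n\ge1\}$, $\Gamma_0=\Gamma_\infty\cap\mathbb{Q}^*$ and $\Gamma_0^+=\Gamma_0\cap\mathbb{Q}_{>0}$. Let $A=\mathrm{Aut}_{\Gamma_0}(\Gamma_\infty)$ be the group of group automorphisms of $\Gamma_\infty$ fixing $\Gamma_0$ pointwise, and let $G=\mathrm{Gal}(\mathbb{Q}(\Gamma_\infty)/\mathbb{Q})$, viewed as a subgroup of $A$ via the injective map sending a field automorphism to its restriction to $\Gamma_\infty$. Then $G$ is a normal subgroup of $A$ of index $2^r$, and the map $$A/G\times \Gamma_0^+/(\Gamma_0^+)^2\longrightarrow\mu_2,\qquad (\alpha,b)\longmapsto \chi_{[b]}(\alpha)$$ is a well-defined perfect pairing of elementary abelian $2$-groups.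
   Context: $\mu_\infty$ denotes the group of all roots of unity in $\mathbb{C}^*$ and $\mu_2=\{\pm1\}$. Every $\alpha\in A$ restricts to an automorphism of $\mu_\infty$, and via the isomorphism $\mathrm{Gal}(\mathbb{Q}(\mu_\infty)/\mathbb{Q})\cong\mathrm{Aut}(\mu_\infty)$ this gives a field automorphism $\sigma_\alpha$ of $\mathbb{Q}(\mu_\infty)$. For $b\in\Gamma_0^+$ let $\sqrt b$ denote its positive real square root (which lies in $\Gamma_\infty$ and, by Kronecker–Weber, in $\mathbb{Q}(\mu_\infty)$). The quadratic character $\chi_{[b]}:A\to\mu_2$ is defined by $$\chi_{[b]}(\alpha)=\frac{\alpha(\sqrt b)}{\sqrt b}\cdot\frac{\sigma_\alpha(\sqrt b)}{\sqrt b},$$ where $\alpha(\sqrt b)$ is the image under the group automorphism $\alpha$ of $\Gamma_\infty$ and $\sigma_\alpha(\sqrt b)$ the image under the field automorphism $\sigma_\alpha$. *)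

theory Defs
  imports "HOL-Algebra.Algebra" "HOL-Algebra.Algebraic_Closure_Type"
begin

abbreviation C_ring :: "complex ring"
  where "C_ring \<equiv> ring_of_type_algebra"

abbreviation C_units :: "complex monoid"
  where "C_units \<equiv> Multiplicative_Group.mult_of C_ring"

abbreviation mult_grp :: "complex set \<Rightarrow> complex monoid"
  where "mult_grp S \<equiv> C_units\<lparr>carrier := S\<rparr>"

definition fin_gen_subgroup :: "complex set \<Rightarrow> bool"
  where "fin_gen_subgroup \<Gamma> \<longleftrightarrow>
    (\<exists>S. finite S \<and> S \<subseteq> carrier C_units \<and> \<Gamma> = generate C_units S)"

definition mult_independent :: "complex set \<Rightarrow> bool"
  where "mult_independent B \<longleftrightarrow>
    (\<forall>c :: complex \<Rightarrow> int. (\<Prod>x\<in>B. x powi c x) = 1 \<longrightarrow> (\<forall>x\<in>B. c x = 0))"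

text \<open>The rank of an abelian group is the maximal size of a \<open>\<int>\<close>-linearly independent
  subset; here the groups are written multiplicatively.\<close>

definition has_rank :: "complex set \<Rightarrow> nat \<Rightarrow> bool"
  where "has_rank \<Gamma> r \<longleftrightarrow>
    (\<exists>B\<subseteq>\<Gamma>. finite B \<and> mult_independent B \<and> card B = r) \<and>
    (\<forall>B\<subseteq>\<Gamma>. finite B \<and> mult_independent B \<longrightarrow> card B \<le> r)"

definition Gamma_inf :: "complex set \<Rightarrow> complex set"
  where "Gamma_inf \<Gamma> = {x. x \<noteq> 0 \<and> (\<exists>n::nat. n \<ge> 1 \<and> x ^ n \<in> \<Gamma>)}"

definition Gamma_0 :: "complex set \<Rightarrow> complex set"
  where "Gamma_0 \<Gamma> = Gamma_inf \<Gamma> \<inter> (\<rat> - {0})"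

definition Gamma_0_pos :: "complex set \<Rightarrow> complex set"
  where "Gamma_0_pos \<Gamma> = Gamma_0 \<Gamma> \<inter> of_rat ` {q. q > 0}"

definition mu_inf :: "complex set"
  where "mu_inf = {z. \<exists>n::nat. n \<ge> 1 \<and> z ^ n = 1}"

definition mu_2 :: "complex monoid"
  where "mu_2 = mult_grp {1, -1}"

definition squares :: "complex set \<Rightarrow> complex set"
  where "squares S = (\<lambda>x. x ^ 2) ` S"

text \<open>As in \<^const>\<open>AutoGroup\<close>, automorphisms are represented by functions that are
  extensional on their domain, so that each is given by a unique HOL function.\<close>

definition Aut_fixing :: "complex set \<Rightarrow> complex set \<Rightarrow> (complex \<Rightarrow> complex) monoid"
  where "Aut_fixing F M =
    (AutoGroup (mult_grp M))\<lparr>carrier := {\<alpha> \<in> auto (mult_grp M). \<forall>x\<in>F. \<alpha> x = x}\<rparr>"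

definition Q_adjoin :: "complex set \<Rightarrow> complex set"
  where "Q_adjoin S = generate_field C_ring (\<rat> \<union> S)"

definition Gal_Q :: "complex set \<Rightarrow> (complex \<Rightarrow> complex) monoid"
  where "Gal_Q K = (BijGroup K)\<lparr>carrier :=
    {\<sigma> \<in> Bij K. \<sigma> \<in> ring_iso (C_ring\<lparr>carrier := K\<rparr>) (C_ring\<lparr>carrier := K\<rparr>) \<and>
                 (\<forall>x\<in>\<rat>. \<sigma> x = x)}\<rparr>"

definition grp_A :: "complex set \<Rightarrow> (complex \<Rightarrow> complex) monoid"
  where "grp_A \<Gamma> = Aut_fixing (Gamma_0 \<Gamma>) (Gamma_inf \<Gamma>)"

definition Gal_Gamma :: "complex set \<Rightarrow> (complex \<Rightarrow> complex) monoid"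
  where "Gal_Gamma \<Gamma> = Gal_Q (Q_adjoin (Gamma_inf \<Gamma>))"

definition grp_G :: "complex set \<Rightarrow> (complex \<Rightarrow> complex) set"
  where "grp_G \<Gamma> = (\<lambda>\<sigma>. restrict \<sigma> (Gamma_inf \<Gamma>)) ` carrier (Gal_Gamma \<Gamma>)"

text \<open>The preimage of \<open>\<alpha>|\<^bsub>\<mu>\<^esub>\<close> under the restriction isomorphism
  from \<open>Gal(\<rat>(\<mu>)/\<rat>)\<close> to \<open>Aut(\<mu>)\<close>, where \<open>\<mu>\<close> is the group of all roots of unity.\<close>

definition sigma_of :: "(complex \<Rightarrow> complex) \<Rightarrow> (complex \<Rightarrow> complex)"
  where "sigma_of \<alpha> =
    the_inv_into (carrier (Gal_Q (Q_adjoin mu_inf))) (\<lambda>\<sigma>. restrict \<sigma> mu_inf) (restrict \<alpha> mu_inf)"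

text \<open>Only used for positive rational \<open>b\<close>, as the positive real square root.\<close>

definition pos_sqrt :: "complex \<Rightarrow> complex"
  where "pos_sqrt b = complex_of_real (sqrt (Re b))"

definition chi :: "complex \<Rightarrow> (complex \<Rightarrow> complex) \<Rightarrow> complex"
  where "chi b \<alpha> =
    (\<alpha> (pos_sqrt b) / pos_sqrt b) * (sigma_of \<alpha> (pos_sqrt b) / pos_sqrt b)"

definition elementary_abelian_2 :: "('a, 'b) monoid_scheme \<Rightarrow> bool"
  where "elementary_abelian_2 A \<longleftrightarrow>
    comm_group A \<and> (\<forall>x\<in>carrier A. x \<otimes>\<^bsub>A\<^esub> x = \<one>\<^bsub>A\<^esub>)"

definition Hom_group ::
    "('a, 'm) monoid_scheme \<Rightarrow> ('b, 'n) monoid_scheme \<Rightarrow> ('a \<Rightarrow> 'b) monoid"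
  where "Hom_group A M =
    \<lparr>carrier = hom A M \<inter> extensional (carrier A),
     monoid.mult = \<lambda>f g. \<lambda>x\<in>carrier A. f x \<otimes>\<^bsub>M\<^esub> g x,
     one = \<lambda>x\<in>carrier A. \<one>\<^bsub>M\<^esub>\<rparr>"

text \<open>Both induced maps \<open>A \<rightarrow> Hom(B, M)\<close> and \<open>B \<rightarrow> Hom(A, M)\<close> are isomorphisms;
  that they are well-defined homomorphisms says that \<open>p\<close> is bimultiplicative with values in \<open>M\<close>.\<close>

definition perfect_pairing ::
    "('a, 'm) monoid_scheme \<Rightarrow> ('b, 'n) monoid_scheme \<Rightarrow> ('c, 'k) monoid_scheme \<Rightarrow>
     ('a \<Rightarrow> 'b \<Rightarrow> 'c) \<Rightarrow> bool"
  where "perfect_pairing A B M p \<longleftrightarrow>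
    (\<lambda>x. \<lambda>y\<in>carrier B. p x y) \<in> iso A (Hom_group B M) \<and>
    (\<lambda>y. \<lambda>x\<in>carrier A. p x y) \<in> iso B (Hom_group A M)"

end

theory Submission
  imports Defs "HOL-Computational_Algebra.Fundamental_Theorem_Algebra"
begin

text \<open>
  The values \<open>\<chi>\<^bsub>[b]\<^esub>(\<alpha>)\<close> are signs, and \<open>\<chi>\<close> is multiplicative in both variables.
  An automorphism coming from \<open>G\<close> agrees with \<open>\<sigma>\<^sub>\<alpha>\<close> on every \<open>\<surd>b\<close>, so it lies in the left kernel.
  Conversely, the radicals in \<open>\<rat>(\<mu>\<^sub>\<infinity>)\<close> are exactly the products of a root of unity and a
  \<open>\<surd>b\<close> (the extension is abelian, so a real radical in it has only the conjugates \<open>\<plusminus>\<close> itself),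
  and radicals in different classes modulo \<open>\<rat>(\<mu>\<^sub>\<infinity>)\<^sup>*\<close> are linearly independent over this field;
  hence an \<open>\<alpha>\<close> in the left kernel preserves all rational linear relations between elements
  of \<open>\<Gamma>\<^sub>\<infinity>\<close> and extends to a field automorphism.  Finally \<open>\<Gamma>\<^sub>0\<^sup>+\<close> is free of rank \<open>r\<close>, and
  for every homomorphism \<open>v : \<Gamma>\<^sub>0\<^sup>+ \<rightarrow> \<int>\<close>, extended to \<open>v : \<Gamma>\<^sub>\<infinity> \<rightarrow> \<rat>\<close>, the twist
  \<open>x \<mapsto> x \<cdot> exp (2\<pi>i v(x))\<close> is an element \<open>\<alpha>\<close> of \<open>A\<close> with \<open>\<chi>\<^bsub>[b]\<^esub>(\<alpha>) = (-1)\<^bsup>v(b)\<^esup>\<close>,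
  which gives a dual basis.
\<close>

section \<open>Conjugates of roots of unity\<close>

hide_const (open) Divisibility.prime Polynomials.degree up_ring.monom up_ring.coeff module.smult

text \<open>Up to roots of unity, the numbers \<surd>b are the only radicals lying in the cyclotomic
  field. An \<alpha> prescribes their images twice: as elements of the group, and through the field
  automorphism determined by its action on roots of unity. The character \<open>chi\<close> measures
  whether the two prescriptions agree, and linear independence of radicals shows that this is the
  only obstruction to extending \<alpha> to a field automorphism. Normality and index of the Galois
  group are not attacked directly: it is the common kernel of the characters, so both come out of
  finite duality of sign-valued maps. No Galois correspondence and no degrees of field extensions
  are used. Irreducibility of cyclotomic polynomials enters as the transport of integer polynomial
  relations from z to z^a, invariance under conjugation is turned into rationality by counting
  roots, and the containment of square roots in the cyclotomic field comes from an explicit product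
  of sines.\<close>

definition ipoly :: "int poly \<Rightarrow> complex \<Rightarrow> complex"
  where "ipoly f z = poly (map_poly of_int f) z"

lemma ipoly_simps [simp]:
  "ipoly 0 z = 0" "ipoly 1 z = 1" "ipoly (pCons a f) z = of_int a + z * ipoly f z"
  by (simp_all add: ipoly_def map_poly_pCons map_poly_1)

lemma ipoly_add [simp]: "ipoly (f + g) z = ipoly f z + ipoly g z"
  by (induction f g rule: poly_induct2) (simp_all add: algebra_simps)

lemma ipoly_smult [simp]: "ipoly (smult c f) z = of_int c * ipoly f z"
  by (induction f) (simp_all add: algebra_simps)

lemma ipoly_minus [simp]: "ipoly (- f) z = - ipoly f z"
  by (induction f) (simp_all add: algebra_simps)

lemma ipoly_diff [simp]: "ipoly (f - g) z = ipoly f z - ipoly g z"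
  using ipoly_add [of f "- g" z] by simp

lemma ipoly_mult [simp]: "ipoly (f * g) z = ipoly f z * ipoly g z"
  by (induction f) (simp_all add: algebra_simps)

lemma ipoly_power [simp]: "ipoly (f ^ n) z = ipoly f z ^ n"
  by (induction n) simp_all

lemma ipoly_monom [simp]: "ipoly (monom a n) z = of_int a * z ^ n"
  by (simp add: ipoly_def map_poly_monom poly_monom)

lemma ipoly_pcompose [simp]: "ipoly (f \<circ>\<^sub>p g) z = ipoly f (ipoly g z)"
  by (induction f) (simp_all add: pcompose_pCons)

lemma ipoly_sum [simp]: "ipoly (\<Sum>i\<in>I. f i) z = (\<Sum>i\<in>I. ipoly (f i) z)"
  by (induction I rule: infinite_finite_induct) simp_all

text \<open>The inner binomial coefficients are divisible by \<open>q\<close>. The ring is left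
  general because the congruence is used for integers and for integer polynomials.\<close>

lemma power_prime_add:
  fixes x y :: "'a::comm_ring_1"
  assumes "prime q"
  shows "\<exists>w. (x + y) ^ q = x ^ q + y ^ q + of_nat q * w"
proof -
  have q: "q \<ge> 2" using assms by (rule prime_ge_2_nat)
  have dv: "\<exists>m. q choose k = q * m" if "k \<in> {1..<q}" for k
    using dvd_choose_prime [OF _ _ _ assms, of k] that by auto
  then obtain m where m: "\<And>k. k \<in> {1..<q} \<Longrightarrow> q choose k = q * m k" by metis
  have "(x + y) ^ q = (\<Sum>k\<le>q. of_nat (q choose k) * x ^ k * y ^ (q - k))"
    by (rule binomial_ring)
  also have "{..q} = insert 0 (insert q {1..<q})" using q by auto
  also have "(\<Sum>k\<in>insert 0 (insert q {1..<q}). of_nat (q choose k) * x ^ k * y ^ (q - k)) =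
      y ^ q + x ^ q + (\<Sum>k\<in>{1..<q}. of_nat (q choose k) * x ^ k * y ^ (q - k))"
    using q by simp
  also have "(\<Sum>k\<in>{1..<q}. of_nat (q choose k) * x ^ k * y ^ (q - k)) =
      of_nat q * (\<Sum>k\<in>{1..<q}. of_nat (m k) * x ^ k * y ^ (q - k))"
    unfolding sum_distrib_left by (intro sum.cong) (auto simp: m mult.assoc)
  finally show ?thesis by (metis add.commute)
qed

text \<open>By \<open>power_prime_add\<close>, adding or subtracting 1 changes both sides by the
  same amount modulo \<open>q\<close>; going in both directions from 0 covers negative
  coefficients.\<close>

lemma fermat_int:
  fixes a :: int
  assumes "prime q"
  shows "\<exists>w. a ^ q = a + int q * w"
proof (induction a rule: int_induct [where k = 0])
  case base
  show ?case using assms by (intro exI [of _ 0]) (auto simp: prime_gt_0_nat)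
next
  case (step1 i)
  then obtain w where w: "i ^ q = i + int q * w" by blast
  obtain v where "(i + 1) ^ q = i ^ q + 1 ^ q + int q * v"
    using power_prime_add [OF assms, of i 1] by auto
  then show ?case using w by (intro exI [of _ "w + v"]) (simp add: algebra_simps)
next
  case (step2 i)
  then obtain w where w: "i ^ q = i + int q * w" by blast
  obtain v where "(i - 1 + 1) ^ q = (i - 1) ^ q + 1 ^ q + int q * v"
    using power_prime_add [OF assms, of "i - 1" 1] by auto
  then show ?case using w by (intro exI [of _ "w - v"]) (simp add: algebra_simps)
qed

text \<open>Modulo \<open>q\<close>, raising to the \<open>q\<close>-th power is additive and fixes
  integer constants, so it acts on a polynomial by replacing X with X^q. The induction peels off the
  constant coefficient.\<close>

lemma pcompose_monom_prime:
  fixes f :: "int poly"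
  assumes "prime q"
  shows "\<exists>w. f \<circ>\<^sub>p monom 1 q = f ^ q + of_nat q * w"
proof (induction f)
  case 0
  show ?case using assms by (intro exI [of _ 0]) (auto simp: prime_gt_0_nat)
next
  case (pCons a f)
  then obtain w where w: "f \<circ>\<^sub>p monom 1 q = f ^ q + of_nat q * w" by blast
  define Y :: "int poly" where "Y = monom 1 1"
  obtain u where u: "a ^ q = a + int q * u" using fermat_int [OF assms] by blast
  have pC: "pCons a f = [:a:] + Y * f" by (simp add: Y_def monom_Suc)
  obtain v where v: "([:a:] + Y * f) ^ q = [:a:] ^ q + (Y * f) ^ q + of_nat q * v"
    using power_prime_add [OF assms] by blast
  have Xq: "Y ^ q = monom 1 q" by (simp add: Y_def monom_power)
  have aq: "[:a:] ^ q = [:a:] + of_nat q * [:u:]"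
    by (simp add: poly_const_pow u of_nat_poly)
  have "pCons a f \<circ>\<^sub>p monom 1 q = [:a:] + Y ^ q * (f ^ q + of_nat q * w)"
    by (simp add: pcompose_pCons w Xq)
  also have "\<dots> = (pCons a f) ^ q + of_nat q * (Y ^ q * w - v - [:u:])"
    unfolding pC v aq by (simp add: algebra_simps power_mult_distrib)
  finally show ?case by blast
qed

section \<open>Integral minimal polynomials of roots of unity\<close>

definition min_ipoly :: "complex \<Rightarrow> int poly \<Rightarrow> bool"
  where "min_ipoly z f \<longleftrightarrow> lead_coeff f = 1 \<and> ipoly f z = 0 \<and>
    (\<forall>g. ipoly g z = 0 \<longrightarrow> g \<noteq> 0 \<longrightarrow> degree f \<le> degree g)"

text \<open>Pseudo-division multiplies the dividend by a power of the leading coefficient, here 1.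
  Monic minimal polynomials thus permit division with remainder without leaving the
  integers.\<close>

lemma monic_division:
  fixes f h :: "int poly"
  assumes "lead_coeff f = 1"
  shows "\<exists>s r. h = f * s + r \<and> (r = 0 \<or> degree r < degree f)"
proof -
  have f0: "f \<noteq> 0" using assms by auto
  obtain s r where sr: "pseudo_divmod h f = (s, r)" by fastforce
  show ?thesis using pseudo_divmod [OF f0 sr] assms by auto
qed

lemma min_ipoly_low_degree:
  assumes "min_ipoly z f" "ipoly g z = 0" "g = 0 \<or> degree g < degree f"
  shows "g = 0"
proof (rule ccontr)
  assume "g \<noteq> 0"
  then have "degree f \<le> degree g" using assms by (simp add: min_ipoly_def)
  then show False using assms(3) \<open>g \<noteq> 0\<close> by simp
qed

lemma min_ipoly_degree:
  assumes "min_ipoly z f"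
  shows "degree f > 0"
proof (rule ccontr)
  assume "\<not> degree f > 0"
  then obtain a where "f = [:a:]" by (metis degree_eq_zeroE gr0I)
  then show False using assms by (auto simp: min_ipoly_def)
qed

lemma min_ipoly_dvd:
  assumes f: "min_ipoly z f" and h: "ipoly h z = 0"
  shows "f dvd h"
proof -
  obtain s r where h': "h = f * s + r" and r: "r = 0 \<or> degree r < degree f"
    using monic_division [of f h] f by (auto simp: min_ipoly_def)
  have "ipoly r z = 0" using h h' f by (simp add: min_ipoly_def)
  then have "r = 0" using min_ipoly_low_degree [OF f _ r] by blast
  then show ?thesis using h' by simp
qed

text \<open>By Gauss's lemma on contents, a primitive integer polynomial of least degree vanishing
  at a root of unity divides \<open>X^N - 1\<close> over the integers, so it is monic up to sign.\<close>

lemma min_ipoly_exists: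
  assumes N: "N \<ge> 1" and z: "z ^ N = 1"
  shows "\<exists>f. min_ipoly z f"
proof -
  define P where "P = (\<lambda>n. \<exists>g. ipoly g z = 0 \<and> g \<noteq> 0 \<and> degree g = n)"
  define XN :: "int poly" where "XN = monom 1 N - 1"
  have XN0: "ipoly XN z = 0" by (simp add: XN_def z)
  have "coeff XN N = 1" using N by (simp add: XN_def)
  then have XNnz: "XN \<noteq> 0" by auto
  then have "P (degree XN)" unfolding P_def using XN0 by blast
  then have "P (LEAST n. P n)" by (rule LeastI)
  then obtain g where g: "ipoly g z = 0" "g \<noteq> 0" and dg: "degree g = (LEAST n. P n)"
    unfolding P_def by blast
  have min_g: "degree g \<le> degree h" if "ipoly h z = 0" "h \<noteq> 0" for h
    unfolding dg by (rule Least_le) (use that in \<open>auto simp: P_def\<close>)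
  define f where "f = primitive_part g"
  have gf: "g = smult (content g) f" by (simp add: f_def)
  have cg: "content g \<noteq> 0" using g by simp
  have f0: "f \<noteq> 0" using g gf by auto
  have fz: "ipoly f z = 0" using g(1) cg by (subst (asm) gf) simp
  have df: "degree f = degree g" by (simp add: f_def)
  have cf: "content f = 1" using g by (simp add: f_def)
  \<comment> \<open>\<open>f\<close> is not yet known to be monic, so division is available only for
    a multiple \<open>c\<close> of \<open>XN\<close>.\<close>
  obtain s r where sr: "pseudo_divmod XN f = (s, r)" by fastforce
  define c where "c = lead_coeff f ^ (Suc (degree XN) - degree f)"
  have c0: "c \<noteq> 0" using f0 by (simp add: c_def)
  have eq: "smult c XN = f * s + r"
    and rd: "r = 0 \<or> degree r < degree f"
    using pseudo_divmod [OF f0 sr] by (auto simp: c_def)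
  have "ipoly r z = ipoly (smult c XN) z - ipoly (f * s) z" unfolding eq by simp
  also have "\<dots> = 0" by (simp add: XN0 fz)
  finally have rz: "ipoly r z = 0" .
  have "r = 0"
  proof (rule ccontr)
    assume "r \<noteq> 0"
    then show False using rd min_g [OF rz] df by simp
  qed
  with eq have eq: "smult c XN = f * s" by simp
  have cX: "content XN = 1"
  proof -
    have "content XN dvd 1" using content_dvd_coeff [of XN N] \<open>coeff XN N = 1\<close> by simp
    then have "normalize (content XN) = 1" by (rule is_unit_normalize)
    then show ?thesis unfolding normalize_content .
  qed
  \<comment> \<open>\<open>f\<close> and \<open>XN\<close> are primitive, so all of \<open>c\<close>
    is absorbed by the content of \<open>s\<close> and can be cancelled.\<close>
  have "content s = normalize c"
    using arg_cong [OF eq, of content] by (simp add: content_mult cf cX)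
  then have "[:c:] dvd s" by (simp add: const_poly_dvd_iff_dvd_content)
  then obtain s' where "s = [:c:] * s'" by (elim dvdE)
  then have "smult c XN = smult c (f * s')" using eq by simp
  then have "XN = f * s'" using c0 by (simp add: poly_eq_iff)
  then have "lead_coeff f * lead_coeff s' = lead_coeff XN" by (simp add: lead_coeff_mult)
  moreover have "lead_coeff XN = 1"
  proof -
    have "degree XN \<le> N" by (auto simp: XN_def intro!: degree_diff_le degree_monom_le)
    then have "degree XN = N"
      using le_degree [of XN N] \<open>coeff XN N = 1\<close> by auto
    then show ?thesis using \<open>coeff XN N = 1\<close> by simp
  qed
  ultimately have "lead_coeff f dvd 1" by (metis dvd_triv_left)
  then have lc: "lead_coeff f = 1 \<or> lead_coeff f = -1" by auto
  \<comment> \<open>The leading coefficient is a sign, so multiplying by it gives leading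
    coefficient 1.\<close>
  define f' where "f' = smult (lead_coeff f) f"
  have "lead_coeff f' = 1" using lc by (auto simp: f'_def)
  moreover have "ipoly f' z = 0" by (simp add: f'_def fz)
  moreover have "degree f' = degree g" using lc df unfolding f'_def degree_smult_eq by auto
  ultimately have "min_ipoly z f'" using min_g by (auto simp: min_ipoly_def)
  then show ?thesis by blast
qed

text \<open>In the product rule for f g, the term containing \<open>g\<close> itself vanishes at a
  root of \<open>g\<close>.\<close>

lemma ipoly_pderiv_unity:
  assumes fg: "f * g = monom 1 N - 1" and g: "ipoly g y = 0"
  shows "ipoly f y * ipoly (pderiv g) y = of_nat N * y ^ (N - 1)"
proof -
  have "pderiv (f * g) = monom (int N) (N - 1)"
    unfolding fg by (simp add: pderiv_diff pderiv_monom)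
  then have "ipoly (f * pderiv g + g * pderiv f) y = of_nat N * y ^ (N - 1)"
    by (simp add: pderiv_mult del: ipoly_add ipoly_mult)
  then show ?thesis using g by simp
qed

text \<open>If \<open>f\<close> does not vanish at \<open>y = z\<^sup>q\<close>, differentiating \<open>X\<^sup>N - 1 = f g\<close> at \<open>y\<close> shows that \<open>f(y)\<close>
  divides \<open>N\<close> in \<open>\<int>[z]\<close>; but \<open>f(y) \<equiv> f(z)\<^sup>q = 0\<close> modulo \<open>q\<close>.\<close>

lemma cyclotomic_prime:
  assumes N: "N \<ge> 1" and z: "z ^ N = 1" and q: "prime q" "\<not> q dvd N"
    and h: "ipoly h z = 0"
  shows "ipoly h (z ^ q) = 0"
proof -
  obtain f where f: "min_ipoly z f" using min_ipoly_exists [OF N z] by blast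
  have fz: "ipoly f z = 0" using f by (simp add: min_ipoly_def)
  obtain s where s: "h = f * s" using min_ipoly_dvd [OF f h] by (elim dvdE)
  have "f dvd monom 1 N - 1"
    by (rule min_ipoly_dvd [OF f]) (simp add: z)
  then obtain g where g: "monom 1 N - 1 = f * g" by (elim dvdE)
  define y where "y = z ^ q"
  have yN: "y ^ N = 1" by (metis y_def mult.commute power_mult power_one z)
  have "ipoly f y = 0"
  proof (rule ccontr)
    assume fy: "ipoly f y \<noteq> 0"
    have "ipoly f y * ipoly g y = ipoly (monom 1 N - 1) y" by (simp add: g)
    also have "\<dots> = 0" by (simp add: yN)
    finally have gy: "ipoly g y = 0" using fy by simp
    have der: "ipoly f y * ipoly (pderiv g) y = of_nat N * y ^ (N - 1)"
      by (rule ipoly_pderiv_unity [OF g [symmetric] gy])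
    obtain w where w: "f \<circ>\<^sub>p monom 1 q = f ^ q + of_nat q * w"
      using pcompose_monom_prime [OF q(1)] by blast
    have "ipoly f y = ipoly (f \<circ>\<^sub>p monom 1 q) z" by (simp add: y_def)
    also have "\<dots> = of_nat q * ipoly w z"
      unfolding w using fz prime_gt_0_nat [OF q(1)] by (simp add: of_nat_poly)
    finally have fy': "ipoly f y = of_nat q * ipoly w z" .
    \<comment> \<open>The last factor contributes \<open>y\<close>, which completes
      \<open>y ^ (N - 1)\<close> to \<open>y ^ N = 1\<close>; hence \<open>q\<close> times the value
      of \<open>v\<close> at \<open>z\<close> is exactly \<open>N\<close>.\<close>
    define v where "v = w * (pderiv g \<circ>\<^sub>p monom 1 q) * monom 1 q"
    have "ipoly v z = ipoly w z * ipoly (pderiv g) y * y"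
      by (simp add: v_def y_def)
    then have "of_nat q * ipoly v z = ipoly f y * ipoly (pderiv g) y * y"
      by (simp only: fy' mult.assoc)
    also have "\<dots> = of_nat N * y ^ N" unfolding der using N by (cases N) auto
    finally have v: "of_nat q * ipoly v z = of_nat N" using yN by simp
    obtain t r where vt: "v = f * t + r"
      and r: "r = 0 \<or> degree r < degree f"
      using monic_division [of f v] f by (auto simp: min_ipoly_def)
    \<comment> \<open>Reduced modulo \<open>f\<close>, the relation has degree below that of
      \<open>f\<close> and must vanish identically; its constant coefficient then exhibits
      \<open>q\<close> as a divisor of \<open>N\<close>.\<close>
    define k where "k = smult (int q) r - [:int N:]"
    have kz: "ipoly k z = 0" using v by (simp add: k_def vt fz)
    have df: "degree f > 0" by (rule min_ipoly_degree [OF f])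
    have "degree k < degree f"
      unfolding k_def using r df
      by (intro degree_diff_less) (auto intro: le_less_trans [OF degree_smult_le])
    then have "k = 0" using min_ipoly_low_degree [OF f kz] by blast
    then have "coeff k 0 = 0" by simp
    then have "int q * coeff r 0 = int N" by (simp add: k_def)
    then have "int q dvd int N" by (metis dvd_triv_left)
    then show False using q(2) by simp
  qed
  then show ?thesis by (simp add: s y_def)
qed

text \<open>This plays the part of the irreducibility of cyclotomic polynomials. The prime factors
  of \<open>a\<close> are processed one by one, each replacing the root \<open>z\<close> by a power,
  so \<open>z\<close> varies in the induction and may have any order dividing
  \<open>N\<close>.\<close>

lemma cyclotomic_conjugate:
  assumes N: "N \<ge> 1" and "z ^ N = 1" "coprime a N" "ipoly h z = 0"
  shows "ipoly h (z ^ a) = 0"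
  using assms(2-)
proof (induction a arbitrary: z rule: prime_divisors_induct)
  case zero
  then have "N = 1" by simp
  then show ?case using zero by simp
next
  case (unit a)
  then show ?case by simp
next
  case (factor p a)
  have "\<not> p dvd N"
  proof
    assume "p dvd N"
    moreover have "p dvd p * a" by simp
    ultimately have "is_unit p" using factor.prems(2) by (meson coprime_common_divisor)
    then show False using factor.hyps by (simp add: not_prime_unit)
  qed
  then have "ipoly h (z ^ p) = 0"
    using cyclotomic_prime [OF N factor.prems(1) factor.hyps _ factor.prems(3)] by blast
  moreover have "(z ^ p) ^ N = 1" using factor.prems(1) by (metis mult.commute power_mult power_one)
  moreover have "coprime a N" using factor.prems(2) by simp
  ultimately have "ipoly h ((z ^ p) ^ a) = 0" using factor.IH by blast
  then show ?case by (simp add: power_mult)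
qed

section \<open>Linear independence of radicals\<close>

text \<open>Subfields are plain sets closed under the operations of type \<open>complex\<close>.
  Since \<open>inverse 0 = 0\<close>, closure under inverses carries no side condition.\<close>

locale csubfield =
  fixes K :: "complex set"
  assumes one [simp, intro]: "1 \<in> K"
    and add [intro]: "x \<in> K \<Longrightarrow> y \<in> K \<Longrightarrow> x + y \<in> K"
    and mult [intro]: "x \<in> K \<Longrightarrow> y \<in> K \<Longrightarrow> x * y \<in> K"
    and uminus [intro]: "x \<in> K \<Longrightarrow> - x \<in> K"
    and inverse [intro]: "x \<in> K \<Longrightarrow> inverse x \<in> K"
begin

lemma zero [simp, intro]: "0 \<in> K"
  using add [OF one uminus [OF one]] by simp

lemma diff [intro]: "x \<in> K \<Longrightarrow> y \<in> K \<Longrightarrow> x - y \<in> K"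
  using add [OF _ uminus, of x y] by simp

lemma divide [intro]: "x \<in> K \<Longrightarrow> y \<in> K \<Longrightarrow> x / y \<in> K"
  using mult [OF _ inverse, of x y] by (simp add: field_simps)

lemma power [intro]: "x \<in> K \<Longrightarrow> x ^ n \<in> K"
  by (induction n) auto

lemma sum [intro]: "(\<And>i. i \<in> I \<Longrightarrow> f i \<in> K) \<Longrightarrow> sum f I \<in> K"
  by (induction I rule: infinite_finite_induct) auto

lemma prod [intro]: "(\<And>i. i \<in> I \<Longrightarrow> f i \<in> K) \<Longrightarrow> prod f I \<in> K"
  by (induction I rule: infinite_finite_induct) auto

lemma of_nat [simp, intro]: "of_nat n \<in> K"
  by (induction n) auto

lemma of_int [simp, intro]: "of_int n \<in> K"
  by (cases n rule: int_cases2) auto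

lemma rats: "\<rat> \<subseteq> K"
proof
  fix x :: complex assume "x \<in> \<rat>"
  then obtain q where "x = of_rat q" by (rule Rats_cases)
  then obtain a b where "x = of_int a / of_int b"
    by (cases q) (simp add: of_rat_rat)
  then show "x \<in> K" by auto
qed

lemma mult_cancel: "x \<in> K \<Longrightarrow> x \<noteq> 0 \<Longrightarrow> x * y \<in> K \<Longrightarrow> y \<in> K"
  using divide [of "x * y" x] by simp

section \<open>Polynomials over a subfield and simple algebraic extensions\<close>

definition polys :: "complex poly set"
  where "polys = {p. \<forall>i. coeff p i \<in> K}"

lemma polys_coeff: "p \<in> polys \<Longrightarrow> coeff p i \<in> K"
  by (simp add: polys_def)

lemma polys_0 [simp, intro]: "0 \<in> polys" by (simp add: polys_def)

lemma polys_add [intro]: "p \<in> polys \<Longrightarrow> q \<in> polys \<Longrightarrow> p + q \<in> polys"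
  by (auto simp: polys_def)

lemma polys_diff [intro]: "p \<in> polys \<Longrightarrow> q \<in> polys \<Longrightarrow> p - q \<in> polys"
  by (auto simp: polys_def)

lemma polys_uminus [intro]: "p \<in> polys \<Longrightarrow> - p \<in> polys"
  by (auto simp: polys_def)

lemma polys_mult [intro]: "p \<in> polys \<Longrightarrow> q \<in> polys \<Longrightarrow> p * q \<in> polys"
  by (auto simp: polys_def Polynomial.coeff_mult)

lemma polys_monom [intro]: "a \<in> K \<Longrightarrow> monom a n \<in> polys"
  by (auto simp: polys_def)

lemma polys_const [intro]: "a \<in> K \<Longrightarrow> [:a:] \<in> polys"
  by (auto simp: polys_def Polynomial.coeff_pCons split: nat.split)

lemma polys_1 [simp, intro]: "1 \<in> polys"
  using polys_const [OF one] by (simp add: one_pCons)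

lemma polys_power [intro]: "p \<in> polys \<Longrightarrow> p ^ n \<in> polys"
  by (induction n) auto

lemma polys_sum [intro]: "(\<And>i. i \<in> I \<Longrightarrow> f i \<in> polys) \<Longrightarrow> sum f I \<in> polys"
  by (induction I rule: infinite_finite_induct) auto

lemma polys_division:
  assumes f: "f \<in> polys" "f \<noteq> 0" and p: "p \<in> polys"
  shows "\<exists>s\<in>polys. \<exists>r\<in>polys. p = f * s + r \<and> (r = 0 \<or> degree r < degree f)"
  using p
proof (induction "degree p" arbitrary: p rule: less_induct)
  case less
  show ?case
  proof (cases "p = 0 \<or> degree p < degree f")
    case True
    then show ?thesis using less.prems by (intro bexI [of _ 0] bexI [of _ p]) auto
  next
    case False
    define m where "m = monom (lead_coeff p / lead_coeff f)
      (degree p - degree f)"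
    have m: "m \<in> polys" unfolding m_def by (intro polys_monom divide polys_coeff less.prems f)
    have lm: "lead_coeff m = lead_coeff p / lead_coeff f" unfolding m_def by (rule lead_coeff_monom)
    have dm: "degree m = degree p - degree f"
      using False f by (simp add: m_def degree_monom_eq)
    have m0: "m \<noteq> 0" using lm False f by auto
    have dmf: "degree (f * m) = degree p"
      using False f m0 dm by (simp add: Polynomial.degree_mult_eq)
    have lmf: "lead_coeff (f * m) = lead_coeff p"
      using f by (simp add: lead_coeff_mult lm)
    define p' where "p' = p - f * m"
    have p': "p' \<in> polys" using less.prems f m by (auto simp: p'_def)
    show ?thesis
    proof (cases "p' = 0")
      case True
      then show ?thesis using m by (intro bexI [of _ m] bexI [of _ 0]) (auto simp: p'_def)
    next
      case False
      have "degree p' \<le> degree p"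
        unfolding p'_def using dmf by (intro Polynomial.degree_diff_le) auto
      moreover have "coeff p' (degree p) = 0"
        using lmf dmf by (simp add: p'_def)
      ultimately have "degree p' < degree p"
        using False by (metis leading_coeff_0_iff order_le_less)
      then obtain s r where "s \<in> polys" "r \<in> polys" "p' = f * s + r"
        "r = 0 \<or> degree r < degree f"
        using less.hyps p' by blast
      then show ?thesis using m
        by (intro bexI [of _ "s + m"] bexI [of _ r]) (auto simp: p'_def algebra_simps)
    qed
  qed
qed

definition adjoin :: "complex \<Rightarrow> complex set"
  where "adjoin u = (\<lambda>p. poly p u) ` polys"

lemma adjoinI: "p \<in> polys \<Longrightarrow> poly p u \<in> adjoin u"
  by (simp add: adjoin_def)

lemma adjoin_base: "K \<subseteq> adjoin u"
  using adjoinI [OF polys_const] by fastforce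

lemma adjoin_gen: "u \<in> adjoin u"
  using adjoinI [OF polys_monom [OF one, of 1], of u] by (simp add: poly_monom)

lemma minimal_polynomial:
  assumes "p \<in> polys" "p \<noteq> 0" "poly p u = 0"
  shows "\<exists>f\<in>polys. f \<noteq> 0 \<and> poly f u = 0 \<and>
    (\<forall>g\<in>polys. g \<noteq> 0 \<longrightarrow> poly g u = 0 \<longrightarrow> degree f \<le> degree g)"
  using ex_has_least_nat [of "\<lambda>p. p \<in> polys \<and> p \<noteq> 0 \<and> poly p u = 0" p degree] assms
  by blast

text \<open>Inverses come from Euclidean descent: dividing the minimal polynomial \<open>f\<close>
  by \<open>g\<close> gives r(u) = -g(u) s(u), so an inverse of r(u) yields one of g(u). A zero
  remainder would make \<open>s\<close> an annihilator of smaller degree than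
  \<open>f\<close>.\<close>

lemma csubfield_adjoin:
  assumes p: "p \<in> polys" "p \<noteq> 0" "poly p u = 0"
  shows "csubfield (adjoin u)"
proof -
  obtain f where f: "f \<in> polys" "f \<noteq> 0" "poly f u = 0"
    and min: "\<And>g. g \<in> polys \<Longrightarrow> g \<noteq> 0 \<Longrightarrow> poly g u = 0 \<Longrightarrow> degree f \<le> degree g"
    using minimal_polynomial [OF p] by blast
  have small: "\<exists>h\<in>polys. poly g u * poly h u = 1"
    if "g \<in> polys" "g \<noteq> 0" "degree g < degree f" for g
    using that
  proof (induction "degree g" arbitrary: g rule: less_induct)
    case less
    have gu: "poly g u \<noteq> 0" using min [of g] less.prems by auto
    show ?case
    proof (cases "degree g = 0")
      case True
      then obtain a where a: "g = [:a:]" by (metis degree_eq_zeroE)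
      then have "a \<in> K" using polys_coeff [OF less.prems(1), of 0] by simp
      then show ?thesis using less.prems a by (intro bexI [of _ "[:inverse a:]"]) auto
    next
      case False
      obtain s r where sr: "s \<in> polys" "r \<in> polys" "f = g * s + r"
        "r = 0 \<or> degree r < degree g"
        using polys_division [OF less.prems(1,2) f(1)] by blast
      have "r \<noteq> 0"
      proof
        assume "r = 0"
        then have fgs: "f = g * s" using sr by simp
        then have "s \<noteq> 0" using f by auto
        moreover have "poly s u = 0" using f fgs gu by auto
        ultimately have "degree f \<le> degree s" using min sr by blast
        moreover have "degree f = degree g + degree s"
          using fgs \<open>s \<noteq> 0\<close> less.prems by (simp add: Polynomial.degree_mult_eq)
        ultimately show False using False by simp
      qed
      then obtain h where h: "h \<in> polys" "poly r u * poly h u = 1"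
        using less.hyps [of r] sr less.prems by auto
      have "poly r u = - (poly g u * poly s u)" using f(3) sr(3)
        by (simp add: eq_neg_iff_add_eq_0 add.commute)
      then have "poly g u * poly (- (s * h)) u = 1" using h by (simp add: mult.assoc)
      then show ?thesis using sr h by blast
    qed
  qed
  show ?thesis
  proof
    show "1 \<in> adjoin u" using adjoin_base by auto
  next
    fix x y assume "x \<in> adjoin u" "y \<in> adjoin u"
    then obtain a b where ab: "a \<in> polys" "b \<in> polys" "x = poly a u" "y = poly b u"
      by (auto simp: adjoin_def)
    show "x + y \<in> adjoin u" using adjoinI [of "a + b" u] ab by auto
    show "x * y \<in> adjoin u" using adjoinI [of "a * b" u] ab by auto
  next
    fix x assume "x \<in> adjoin u"
    then obtain a where a: "a \<in> polys" "x = poly a u" by (auto simp: adjoin_def)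
    show "- x \<in> adjoin u" using adjoinI [of "- a" u] a by auto
    obtain s r where sr: "s \<in> polys" "r \<in> polys" "a = f * s + r"
        "r = 0 \<or> degree r < degree f"
      using polys_division [OF f(1,2) a(1)] by blast
    have x: "x = poly r u" using a sr f by simp
    show "inverse x \<in> adjoin u"
    proof (cases "r = 0")
      case True
      then show ?thesis using x adjoin_base by auto
    next
      case False
      then obtain h where "h \<in> polys" "poly r u * poly h u = 1" using small sr by blast
      then have "h \<in> polys" "inverse x = poly h u" using x inverse_unique by auto
      then show ?thesis using adjoinI by auto
    qed
  qed
qed

end

lemma radical_annihilator_nonzero:
  "n \<ge> 1 \<Longrightarrow> monom 1 n - [:c :: complex:] \<noteq> 0"
proof
  assume "n \<ge> 1" "monom 1 n - [:c:] = 0"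
  moreover have "coeff (monom 1 n - [:c :: complex:]) n = 1"
    using \<open>n \<ge> 1\<close> by (cases n) auto
  ultimately show False by simp
qed

locale csubfield_unity = csubfield +
  assumes unity: "n \<ge> 1 \<Longrightarrow> z ^ n = 1 \<Longrightarrow> z \<in> K"
begin

lemma radical_annihilator: "u ^ n \<in> K \<Longrightarrow> monom 1 n - [:u ^ n:] \<in> polys"
  by (intro polys_diff polys_monom polys_const) auto

text \<open>The constant coefficient of a least-degree annihilator of a radical \<open>u\<close> is,
  up to a factor in \<open>K\<close>, a power of \<open>u\<close>, because all its roots are \<open>u\<close> times roots of unity.\<close>

lemma radical_degree:
  assumes u: "u \<noteq> 0" "n \<ge> 1" "u ^ n \<in> K" and p: "p \<in> polys" "p \<noteq> 0" "poly p u = 0"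
  shows "\<exists>e\<ge>1. e \<le> degree p \<and> u ^ e \<in> K"
proof -
  obtain f where f: "f \<in> polys" "f \<noteq> 0" "poly f u = 0"
    and min: "\<And>g. g \<in> polys \<Longrightarrow> g \<noteq> 0 \<Longrightarrow> poly g u = 0 \<Longrightarrow> degree f \<le> degree g"
    using minimal_polynomial [OF p] by blast
  define e where "e = degree f"
  have e1: "e \<ge> 1"
  proof (rule ccontr)
    assume "\<not> e \<ge> 1"
    then obtain a where "f = [:a:]" unfolding e_def by (metis degree_eq_zeroE less_one not_le)
    then show False using f by auto
  qed
  obtain s r where sr: "s \<in> polys" "r \<in> polys" "monom 1 n - [:u ^ n:] = f * s + r"
      "r = 0 \<or> degree r < degree f"
    using polys_division [OF f(1,2) radical_annihilator [OF u(3)]] by blast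
  have "poly r u = poly (monom 1 n - [:u ^ n:]) u - poly (f * s) u" unfolding sr(3) by simp
  also have "\<dots> = 0" using f by (simp add: poly_monom)
  finally have "r = 0" using min [of r] sr by force
  then have fs: "monom 1 n - [:u ^ n:] = f * s" using sr by simp
  obtain root where root: "smult (lead_coeff f) (\<Prod>i<e. [:-root i, 1:]) = f"
    unfolding e_def by (rule complex_poly_decompose')
  have rK: "- root i / u \<in> K" and r0: "root i \<noteq> 0" if "i < e" for i
  proof -
    have "poly f (root i) = 0" using that by (subst root [symmetric]) (auto simp: poly_prod)
    then have "poly (monom 1 n - [:u ^ n:]) (root i) = 0" by (simp add: fs)
    then have *: "root i ^ n = u ^ n" by (simp add: poly_monom)
    then have "(root i / u) ^ n = 1" using u by (simp add: power_divide)
    then have "root i / u \<in> K" using unity u by blast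
    then show "- root i / u \<in> K" using uminus by fastforce
    show "root i \<noteq> 0" using * u by (auto simp: zero_power)
  qed
  \<comment> \<open>Extracting one factor \<open>u\<close> from each of the \<open>e\<close> roots
    leaves this element of \<open>K\<close>; the constant coefficient of \<open>f\<close> is
    \<open>C * u ^ e\<close>.\<close>
  define C where "C = lead_coeff f * (\<Prod>i<e. - root i / u)"
  have CK: "C \<in> K" unfolding C_def using f rK by (intro mult prod) (auto simp: polys_coeff)
  have C0: "C \<noteq> 0" using f r0 u by (auto simp: C_def)
  have "poly f 0 = lead_coeff f * (\<Prod>i<e. - root i)"
    by (subst root [symmetric]) (simp add: poly_prod)
  also have "\<dots> = C * u ^ e" proof -
    have "(\<Prod>i<e. - root i) = (\<Prod>i<e. (- root i / u) * u)" using u by simp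
    also have "\<dots> = (\<Prod>i<e. - root i / u) * u ^ e" by (simp only: prod.distrib prod_constant card_lessThan)
    finally show ?thesis by (simp only: C_def mult.assoc)
  qed
  finally have "C * u ^ e \<in> K" using polys_coeff [OF f(1), of 0] by (simp add: poly_0_coeff_0)
  then have "u ^ e \<in> K" using mult_cancel CK C0 by blast
  then show ?thesis using e1 min [OF p] by (auto simp: e_def)
qed

text \<open>The order of a radical \<open>u\<close> in the quotient of the complex units by those of
  \<open>K\<close>; the bound \<open>d \<ge> 1\<close> excludes the trivial exponent 0. By
  \<open>radical_independent\<close> it is also the degree of \<open>u\<close> over
  \<open>K\<close>.\<close>

definition rad_order :: "complex \<Rightarrow> nat"
  where "rad_order u = (LEAST d. d \<ge> 1 \<and> u ^ d \<in> K)"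

lemma rad_order:
  assumes "n \<ge> 1" "u ^ n \<in> K"
  shows "rad_order u \<ge> 1" "u ^ rad_order u \<in> K"
  using LeastI [of "\<lambda>d. d \<ge> 1 \<and> u ^ d \<in> K" n] assms by (auto simp: rad_order_def)

lemma rad_order_le: "n \<ge> 1 \<Longrightarrow> u ^ n \<in> K \<Longrightarrow> rad_order u \<le> n"
  unfolding rad_order_def by (rule Least_le) auto

text \<open>A nonzero annihilator of degree below the order would yield, by
  \<open>radical_degree\<close>, a positive exponent below the order that takes \<open>u\<close>
  into \<open>K\<close>.\<close>

lemma radical_independent:
  assumes "u \<noteq> 0" "n \<ge> 1" "u ^ n \<in> K" and "p \<in> polys" "poly p u = 0"
    "degree p < rad_order u"
  shows "p = 0"
  using radical_degree [OF assms(1-4)] rad_order_le [of _ u] assms by (metis leD le_trans)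

lemma radical_reduce:
  assumes u: "u \<noteq> 0" "n \<ge> 1" "u ^ n \<in> K" and q: "q \<in> polys"
  shows "\<exists>s\<in>polys. \<exists>r\<in>polys. q = (monom 1 (rad_order u) - [:u ^ rad_order u:]) * s + r \<and>
    degree r < rad_order u"
proof -
  note d = rad_order [OF u(2,3)]
  define g where "g = monom 1 (rad_order u) - [:u ^ rad_order u:]"
  have g: "g \<in> polys" unfolding g_def by (rule radical_annihilator [OF d(2)])
  have g0: "g \<noteq> 0" unfolding g_def by (rule radical_annihilator_nonzero [OF d(1)])
  have "degree g \<le> rad_order u"
    unfolding g_def by (intro Polynomial.degree_diff_le) (auto simp: Polynomial.degree_monom_le)
  moreover obtain s r where "s \<in> polys" "r \<in> polys" "q = g * s + r"
      "r = 0 \<or> degree r < degree g"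
    using polys_division [OF g g0 q] by blast
  ultimately show ?thesis using d unfolding g_def [symmetric] by (intro bexI [of _ s] bexI [of _ r]) auto
qed

text \<open>This replaces the automorphism over \<open>K\<close> sending \<open>u\<close> to
  \<open>z * u\<close>. Reduction modulo X^d - u^d, with d the order, leaves remainder zero, and
  this binomial vanishes at \<open>z * u\<close> too.\<close>

lemma radical_conjugate:
  assumes u: "u \<noteq> 0" "n \<ge> 1" "u ^ n \<in> K" and q: "q \<in> polys" "poly q u = 0"
    and z: "z ^ rad_order u = 1"
  shows "poly q (z * u) = 0"
proof -
  obtain s r where sr: "s \<in> polys" "r \<in> polys"
    "q = (monom 1 (rad_order u) - [:u ^ rad_order u:]) * s + r"
    "degree r < rad_order u"
    using radical_reduce [OF u q(1)] by blast
  have "poly r u = 0" using q(2) by (simp add: sr(3) poly_monom)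
  then have "r = 0" using radical_independent [OF u] sr by blast
  then show ?thesis by (simp add: sr(3) poly_monom power_mult_distrib z)
qed

text \<open>Replacing \<open>u\<close> by \<open>z * u\<close> for a primitive root of unity
  \<open>z\<close> multiplies \<open>y\<close> by a root of unity \<open>w\<close>, since
  \<open>y ^ m\<close> lies in \<open>K\<close>. Comparing coefficients leaves only exponents i with
  z^i = w, and below the order there is just one.\<close>

lemma radical_in_adjoin:
  assumes u: "u \<noteq> 0" "n \<ge> 1" "u ^ n \<in> K"
    and y: "y \<in> adjoin u" "y \<noteq> 0" "m \<ge> 1" "y ^ m \<in> K"
  shows "\<exists>j<rad_order u. \<exists>k\<in>K. y = k * u ^ j"
proof -
  define d where "d = rad_order u"
  have d1: "d \<ge> 1" using rad_order [OF u(2,3)] by (simp add: d_def)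
  obtain q where q: "q \<in> polys" "y = poly q u" using y by (auto simp: adjoin_def)
  obtain s p where "s \<in> polys" and p: "p \<in> polys"
    "q = (monom 1 d - [:u ^ d:]) * s + p" "degree p < d"
    using radical_reduce [OF u q(1)] unfolding d_def by blast
  have yp: "y = poly p u" by (simp add: q(2) p(2) poly_monom)
  define z where "z = cis (2 * pi / real d)"
  have zpow: "z ^ k = cis (2 * pi * real k / real d)" for k
    by (simp add: z_def Complex.DeMoivre mult_ac)
  have zd: "z ^ d = 1" using d1 by (simp add: zpow)
  have inj: "i = j" if "z ^ i = z ^ j" "i < d" "j < d" for i j
    using bij_betw_roots_unity [of d] d1 that unfolding zpow bij_betw_def inj_on_def by auto
  have zK: "z \<in> K" using unity [OF d1 zd] .
  have "p ^ m - [:y ^ m:] \<in> polys" using p y by (intro polys_diff polys_power polys_const) auto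
  moreover have "poly (p ^ m - [:y ^ m:]) u = 0" by (simp add: yp)
  ultimately have "poly (p ^ m - [:y ^ m:]) (z * u) = 0"
    using radical_conjugate [OF u] zd unfolding d_def by blast
  then have eq: "poly p (z * u) ^ m = y ^ m" by simp
  define w where "w = poly p (z * u) / y"
  have "w ^ m = 1" using eq y by (simp add: w_def power_divide)
  then have wK: "w \<in> K" using unity y by blast
  \<comment> \<open>The difference of p(zX) and w p(X) vanishes at \<open>u\<close> and has degree
    below the order, so it is zero.\<close>
  define r where "r = p \<circ>\<^sub>p [:0, z:] - smult w p"
  have cr: "coeff r i = (z ^ i - w) * coeff p i" for i
    by (simp add: r_def coeff_pcompose_linear algebra_simps)
  have "r \<in> polys" unfolding polys_def using zK wK polys_coeff [OF p(1)] by (auto simp: cr)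
  moreover have "poly r u = 0" using y(2) by (simp add: r_def poly_pcompose w_def yp mult.commute)
  moreover have "degree r < d"
    using p(3) by (metis (no_types) cr coeff_eq_0 degree_le le_less_trans mult_zero_right)
  ultimately have r0: "r = 0" using radical_independent [OF u] by (simp add: d_def)
  have zw: "z ^ i = w" if "coeff p i \<noteq> 0" for i
    using cr [of i] r0 that by simp
  have "p \<noteq> 0" using y yp by auto
  then obtain j where j: "coeff p j \<noteq> 0" using leading_coeff_0_iff by blast
  have bound: "i < d" if "coeff p i \<noteq> 0" for i
    using le_degree [OF that] p(3) by simp
  have "p = monom (coeff p j) j"
  proof (rule poly_eqI)
    fix i
    show "coeff p i = coeff (monom (coeff p j) j) i"
      using inj [of i j] zw bound j by fastforce
  qed
  then have "y = coeff p j * u ^ j" unfolding yp by (metis poly_monom)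
  then show ?thesis using bound [OF j] polys_coeff [OF p(1)] unfolding d_def by blast
qed

end

text \<open>Kummer theory in linear form.  If two of the radicals have a quotient \<open>u\<close> outside \<open>K\<close>, the
  induction hypothesis is applied over \<open>K(u)\<close>, where fewer pairs lie in different classes.\<close>

lemma radical_class_sum:
  assumes "csubfield_unity K" and "finite S"
    and "\<And>x. x \<in> S \<Longrightarrow> x \<noteq> 0 \<and> (\<exists>n\<ge>1. x ^ n \<in> K)"
    and "\<And>x. x \<in> S \<Longrightarrow> c x \<in> K" and "(\<Sum>x\<in>S. c x * x) = 0" and "x0 \<in> S"
  shows "(\<Sum>x | x \<in> S \<and> x / x0 \<in> K. c x * x) = 0"
  using assms
proof (induction "card {(x, y) \<in> S \<times> S. x / y \<notin> K}" arbitrary: K rule: less_induct)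
  case less
  interpret csubfield_unity K by (rule less.prems(1))
  note rad = less.prems(3)
  note cK = less.prems(4)
  show ?case
  proof (cases "\<forall>x\<in>S. x / x0 \<in> K")
    case True
    then have "{x. x \<in> S \<and> x / x0 \<in> K} = S" by auto
    then show ?thesis using less.prems by simp
  next
    case False
    then obtain x1 where x1: "x1 \<in> S" "x1 / x0 \<notin> K" by blast
    define u where "u = x1 / x0"
    have radq: "x / x0 \<noteq> 0 \<and> (\<exists>n\<ge>1. (x / x0) ^ n \<in> K)" if x: "x \<in> S" for x
    proof -
      obtain a b where ab: "a \<ge> 1" "x ^ a \<in> K" "b \<ge> 1" "x0 ^ b \<in> K"
        using rad [OF x] rad [OF less.prems(6)] by blast
      have "(x / x0) ^ (a * b) = (x ^ a) ^ b / (x0 ^ b) ^ a"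
        by (simp add: power_divide power_mult [symmetric] mult.commute)
      moreover have "\<dots> \<in> K" using ab by auto
      ultimately show ?thesis using ab rad [OF x] rad [OF less.prems(6)]
        by (intro conjI exI [of _ "a * b"]) auto
    qed
    then obtain n where u: "u \<noteq> 0" "n \<ge> 1" "u ^ n \<in> K" using x1 u_def by blast
    define L where "L = adjoin u"
    have KL: "K \<subseteq> L" unfolding L_def by (rule adjoin_base)
    have uL: "u \<in> L" unfolding L_def by (rule adjoin_gen)
    have "csubfield L" unfolding L_def
      by (rule csubfield_adjoin [OF radical_annihilator [OF u(3)] radical_annihilator_nonzero [OF u(2)]])
         (simp add: poly_monom)
    then have L: "csubfield_unity L"
      using unity KL by (intro csubfield_unity.intro csubfield_unity_axioms.intro) auto
    have "(x1, x0) \<in> {(x, y) \<in> S \<times> S. x / y \<notin> K} - {(x, y) \<in> S \<times> S. x / y \<notin> L}"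
      using x1 less.prems uL by (auto simp: u_def)
    moreover have "{(x, y) \<in> S \<times> S. x / y \<notin> L} \<subseteq> {(x, y) \<in> S \<times> S. x / y \<notin> K}" using KL by auto
    ultimately have "card {(x, y) \<in> S \<times> S. x / y \<notin> L} < card {(x, y) \<in> S \<times> S. x / y \<notin> K}"
      using less.prems(2)
      by (intro psubset_card_mono) (auto intro: finite_subset [of _ "S \<times> S"])
    moreover have "x \<noteq> 0 \<and> (\<exists>n\<ge>1. x ^ n \<in> L)" if "x \<in> S" for x
      using rad [OF that] KL by blast
    ultimately have "(\<Sum>x | x \<in> S \<and> x / x0 \<in> L. c x * x) = 0"
      using less.hyps [OF _ L less.prems(2) _ _ less.prems(5,6)] cK KL by blast
    define C where "C = {x. x \<in> S \<and> x / x0 \<in> L}"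
    have C0: "(\<Sum>x\<in>C. c x * x) = 0" unfolding C_def by fact
    have finC: "finite C" using less.prems by (auto simp: C_def)
    have x00: "x0 \<noteq> 0" using rad less.prems by blast
    have "\<exists>j<rad_order u. \<exists>k\<in>K. x / x0 = k * u ^ j" if "x \<in> C" for x
      using radical_in_adjoin [OF u, of "x / x0"] that radq [of x] by (auto simp: C_def L_def)
    then obtain j k where j: "\<And>x. x \<in> C \<Longrightarrow> j x < rad_order u" and k: "\<And>x. x \<in> C \<Longrightarrow> k x \<in> K"
      and jk: "\<And>x. x \<in> C \<Longrightarrow> x / x0 = k x * u ^ j x" by metis
    \<comment> \<open>Divided by \<open>x0\<close>, the relation inside the class modulo
      \<open>L\<close> becomes a polynomial in \<open>u\<close> of degree below the order, which
      must be zero. Its constant coefficient collects the class modulo \<open>K\<close>.\<close>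
    define P where "P = (\<Sum>x\<in>C. monom (c x * k x) (j x))"
    have "P \<in> polys" unfolding P_def
      by (intro polys_sum polys_monom mult k cK) (auto simp: C_def)
    moreover have "poly P u = 0"
    proof -
      have "x0 * poly P u = (\<Sum>x\<in>C. c x * (x0 * (k x * u ^ j x)))"
        by (simp add: P_def poly_sum poly_monom sum_distrib_left mult_ac)
      also have "\<dots> = (\<Sum>x\<in>C. c x * x)"
        using x00 by (intro sum.cong) (auto simp flip: jk)
      finally show ?thesis using C0 x00 by simp
    qed
    moreover have "degree P < rad_order u"
      unfolding P_def using j rad_order(1) [OF u(2,3)]
      by (intro degree_sum_less) (auto intro: le_less_trans [OF Polynomial.degree_monom_le])
    ultimately have "P = 0" using radical_independent [OF u] by blast
    then have "coeff P 0 = 0" by simp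
    then have "(\<Sum>x\<in>C. if j x = 0 then c x * k x else 0) = 0"
      by (simp add: P_def coeff_sum)
    then have S0: "(\<Sum>x | x \<in> C \<and> j x = 0. c x * k x) = 0"
      using finC by (simp add: sum.inter_filter)
    \<comment> \<open>A power of \<open>u\<close> with exponent below the order lies in
      \<open>K\<close> only for exponent 0.\<close>
    have "{x. x \<in> S \<and> x / x0 \<in> K} = {x. x \<in> C \<and> j x = 0}"
    proof (intro equalityI subsetI)
      fix x assume "x \<in> {x. x \<in> S \<and> x / x0 \<in> K}"
      then have x: "x \<in> S" "x / x0 \<in> K" by auto
      then have xC: "x \<in> C" using KL by (auto simp: C_def)
      have "k x \<noteq> 0" using jk [OF xC] radq [OF x(1)] by auto
      then have "u ^ j x \<in> K" using x jk [OF xC] k [OF xC] mult_cancel by metis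
      then have "j x = 0" using j [OF xC] rad_order_le [of "j x" u] by (cases "j x") auto
      then show "x \<in> {x. x \<in> C \<and> j x = 0}" using xC by simp
    next
      fix x assume "x \<in> {x. x \<in> C \<and> j x = 0}"
      then show "x \<in> {x. x \<in> S \<and> x / x0 \<in> K}" using jk [of x] k [of x] by (auto simp: C_def)
    qed
    then have "(\<Sum>x | x \<in> S \<and> x / x0 \<in> K. c x * x) = (\<Sum>x | x \<in> C \<and> j x = 0. x0 * (c x * k x))"
    proof (intro sum.cong)
      fix x assume "x \<in> {x. x \<in> C \<and> j x = 0}"
      then have "x / x0 = k x" using jk [of x] by simp
      then show "c x * x = x0 * (c x * k x)" using x00 by (simp add: field_simps)
    qed
    also have "\<dots> = 0" unfolding sum_distrib_left [symmetric] S0 by simp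
    finally show ?thesis .
  qed
qed

section \<open>The field generated by the roots of unity\<close>

text \<open>A multiple root of \<open>f\<close> would be a common root of X^N - 1 and its derivative
  N X^(N-1), whose only possible root is 0.\<close>

lemma rsquarefree_unity:
  fixes f :: "complex poly"
  assumes N: "N \<ge> 1" and fg: "f * g = monom 1 N - 1"
  shows "rsquarefree f"
  unfolding rsquarefree_roots
proof (intro allI notI)
  fix a assume a: "poly f a = 0 \<and> poly (pderiv f) a = 0"
  have "poly (pderiv (f * g)) a = 0" using a by (simp add: pderiv_mult)
  then have "of_nat N * a ^ (N - 1) = 0"
    unfolding fg by (simp add: pderiv_diff pderiv_monom poly_monom)
  moreover have "poly (f * g) a = 0" using a by simp
  then have "a ^ N = 1" unfolding fg by (simp add: poly_monom)
  ultimately show False using N by (auto simp: zero_power)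
qed

lemma card_roots_rsquarefree:
  fixes f :: "complex poly"
  assumes "rsquarefree f"
  shows "card {z. poly f z = 0} = degree f"
proof -
  have f: "f \<noteq> 0" using assms by (auto simp: rsquarefree_def)
  have "degree f = degree (smult (lead_coeff f) (\<Prod>z|poly f z = 0. [:-z, 1:]))"
    by (simp add: complex_poly_decompose_rsquarefree [OF assms])
  also have "\<dots> = (\<Sum>z|poly f z = 0. degree [:-z, 1:])"
    using f by (simp add: degree_prod_eq_sum_degree)
  finally show ?thesis by simp
qed

text \<open>Both sides are the derivative of X^n - 1 at 1, computed once directly and once from the
  factorisation with X - 1 split off.\<close>

lemma prod_one_minus_unity:
  assumes n: "n \<ge> 1"
  shows "(\<Prod>z\<in>{z::complex. z ^ n = 1} - {1}. 1 - z) = of_nat n"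
proof -
  define A :: "complex poly" where "A = monom 1 n - 1"
  have "rsquarefree (A * 1)" using rsquarefree_unity [OF n, of A 1] by (simp add: A_def)
  then have "smult (lead_coeff A) (\<Prod>z|poly A z = 0. [:-z, 1:]) = A"
    by (intro complex_poly_decompose_rsquarefree) simp
  moreover have "{z. poly A z = 0} = {z. z ^ n = 1}" by (simp add: A_def poly_monom)
  moreover have "lead_coeff A = 1"
  proof -
    have "coeff A n = 1" using n by (simp add: A_def)
    moreover have "degree A \<le> n"
      unfolding A_def by (intro Polynomial.degree_diff_le) (auto simp: Polynomial.degree_monom_le)
    ultimately show ?thesis using le_degree [of A n] by auto
  qed
  ultimately have A: "A = (\<Prod>z\<in>{z. z ^ n = 1}. [:-z, 1:])" by simp
  have fin: "finite {z::complex. z ^ n = 1}" using n by (intro finite_roots_unity) auto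
  define R :: "complex poly" where "R = (\<Prod>z\<in>{z. z ^ n = 1} - {1}. [:-z, 1:])"
  have AR: "A = [:-1, 1:] * R" unfolding A R_def by (rule prod.remove [OF fin]) simp
  have "pderiv A = [:-1, 1:] * pderiv R + R * pderiv [:-1, 1:]" unfolding AR by (rule pderiv_mult)
  then have "poly (pderiv A) 1 = poly R 1" by (simp add: pderiv_pCons)
  moreover have "poly (pderiv A) 1 = of_nat n"
    by (simp add: A_def pderiv_diff pderiv_monom poly_monom)
  ultimately show ?thesis by (simp add: R_def poly_prod)
qed

lemma cmod_one_minus_cis:
  assumes "0 \<le> t" "t \<le> pi"
  shows "cmod (1 - cis (2 * t)) = 2 * sin t"
proof -
  have "cmod (1 - cis (2 * t)) ^ 2 = (1 - cos (2 * t)) ^ 2 + sin (2 * t) ^ 2"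
    by (simp add: cmod_power2)
  also have "\<dots> = 2 - 2 * cos (2 * t)"
    using sin_cos_squared_add [of "2 * t"] by (simp add: power2_eq_square algebra_simps)
  also have "\<dots> = (2 * sin t) ^ 2"
    using cos_double_sin [of t] by (simp add: power2_eq_square)
  finally show ?thesis by (rule power2_eq_imp_eq) (use sin_ge_zero [OF assms] in auto)
qed

text \<open>For n = 2m + 1, taking absolute values in the product of 1 - z over the nontrivial n-th
  roots of unity gives n as a product of sines. The factors for k and n - k agree, so n is the
  square of the product over half the range. The formula expresses \<surd>n through roots of unity
  without Gauss sums.\<close>

lemma sqrt_odd:
  "sqrt (real (2 * m + 1)) = (\<Prod>k\<in>{1..m}. 2 * sin (pi * real k / real (2 * m + 1)))"
proof -
  define n where "n = 2 * m + 1"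
  define s where "s k = 2 * sin (pi * real k / real n)" for k
  have n: "n \<ge> 1" by (simp add: n_def)
  have s_pos: "s k \<ge> 0" if "k < n" for k
    unfolding s_def using that n
    by (intro mult_nonneg_nonneg sin_ge_zero) (auto simp: field_simps)
  have bij: "bij_betw (\<lambda>k. cis (2 * pi * real k / real n)) ({..<n} - {0})
      ({z. z ^ n = 1} - {cis (2 * pi * real 0 / real n)})"
    by (rule bij_betw_DiffI [OF bij_betw_roots_unity]) (use n in \<open>auto simp: bij_betw_def\<close>)
  have "of_nat n = (\<Prod>z\<in>{z::complex. z ^ n = 1} - {1}. 1 - z)"
    by (rule prod_one_minus_unity [OF n, symmetric])
  also have "\<dots> = (\<Prod>k\<in>{..<n} - {0}. 1 - cis (2 * pi * real k / real n))"
    using prod.reindex_bij_betw [OF bij, of "\<lambda>z. 1 - z"] by simp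
  finally have "real n = cmod (\<Prod>k\<in>{..<n} - {0}. 1 - cis (2 * pi * real k / real n))"
    by (metis norm_of_nat)
  also have "\<dots> = (\<Prod>k\<in>{..<n} - {0}. s k)"
    unfolding prod_norm [symmetric]
  proof (intro prod.cong refl)
    fix k assume "k \<in> {..<n} - {0}"
    then have "pi * real k / real n \<le> pi" by (simp add: field_simps)
    then show "cmod (1 - cis (2 * pi * real k / real n)) = s k"
      using cmod_one_minus_cis [of "pi * real k / real n"] by (simp add: s_def mult.assoc)
  qed
  also have "{..<n} - {0} = {1..m} \<union> {m + 1..2 * m}" by (auto simp: n_def)
  also have "(\<Prod>k\<in>{1..m} \<union> {m + 1..2 * m}. s k) = (\<Prod>k\<in>{1..m}. s k) * (\<Prod>k\<in>{m + 1..2 * m}. s k)"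
    by (intro prod.union_disjoint) auto
  \<comment> \<open>The reflection of k to n - k exchanges the two halves and preserves the
    sine.\<close>
  also have "(\<Prod>k\<in>{m + 1..2 * m}. s k) = (\<Prod>k\<in>{1..m}. s k)"
  proof (rule prod.reindex_bij_witness [of _ "\<lambda>k. n - k" "\<lambda>k. n - k"])
    fix k assume "k \<in> {m + 1..2 * m}"
    then have "pi * real (n - k) / real n = pi - pi * real k / real n"
      by (simp add: n_def of_nat_diff field_simps)
    then show "s (n - k) = s k" by (simp add: s_def)
  qed (auto simp: n_def)
  finally have "real n = (\<Prod>k\<in>{1..m}. s k) ^ 2" by (simp add: power2_eq_square)
  moreover have "(\<Prod>k\<in>{1..m}. s k) \<ge> 0" by (intro prod_nonneg) (auto intro!: s_pos simp: n_def)
  ultimately show ?thesis unfolding n_def [symmetric] s_def [symmetric]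
    by (simp add: real_sqrt_unique)
qed

section \<open>Square roots of rational numbers in a field containing all roots of unity\<close>

context csubfield_unity
begin

lemma cis_rational: "n \<ge> 1 \<Longrightarrow> cis (pi * real k / real n) \<in> K"
proof (rule unity)
  assume "n \<ge> 1"
  have "cis (pi * real k / real n) ^ (2 * n) = cis (real (2 * n) * (pi * real k / real n))"
    by (rule Complex.DeMoivre)
  also have "real (2 * n) * (pi * real k / real n) = 2 * pi * real k" using \<open>n \<ge> 1\<close> by simp
  also have "cis (2 * pi * real k) = 1" by (metis cis_multiple_2pi Ints_of_nat of_nat_in_Nats Nats_subset_Ints subsetD)
  finally show "cis (pi * real k / real n) ^ (2 * n) = 1" .
qed auto

lemma sin_rational:
  assumes "n \<ge> 1"
  shows "complex_of_real (2 * sin (pi * real k / real n)) \<in> K"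
proof -
  define c where "c = cis (pi * real k / real n)"
  have c: "c \<in> K" unfolding c_def using assms by (rule cis_rational)
  have "\<i> ^ 4 = 1" by simp
  then have i: "\<i> \<in> K" by (rule unity [rotated]) simp
  have "complex_of_real (2 * sin (pi * real k / real n)) = - \<i> * (c - inverse c)"
    by (simp add: c_def complex_eq_iff cis_inverse)
  then show ?thesis using c i by (metis mult uminus diff inverse)
qed

text \<open>This is the case of Kronecker-Weber on which \<open>chi\<close> rests. Odd numbers are
  settled by \<open>sqrt_odd\<close>, and each factor 2 contributes \<surd>2 = 2 sin(pi/4).\<close>

lemma sqrt_nat: "complex_of_real (sqrt (real n)) \<in> K"
proof (induction n rule: less_induct)
  case (less n)
  consider "n = 0" | m where "n = 2 * m + 1" | m where "n = 2 * m" "m < n"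
    by (metis One_nat_def add.right_neutral add_Suc_right oddE evenE gr0I mult_0_right
        n_less_m_mult_n one_less_numeral_iff semiring_norm(76) mult.commute)
  then show ?case
  proof cases
    case 1
    then show ?thesis by simp
  next
    case (2 m)
    have eq: "complex_of_real (sqrt (real n)) =
        (\<Prod>k\<in>{1..m}. complex_of_real (2 * sin (pi * real k / real (2 * m + 1))))"
      unfolding 2 sqrt_odd by (rule of_real_prod)
    show ?thesis unfolding eq by (intro prod sin_rational) auto
  next
    case (3 m)
    have "complex_of_real (sqrt (real n)) =
        complex_of_real (2 * sin (pi * real 1 / real 4)) * complex_of_real (sqrt (real m))"
      by (simp add: 3 real_sqrt_mult sin_45 flip: of_real_mult)
    also have "\<dots> \<in> K" using less 3 by (intro mult sin_rational) auto
    finally show ?thesis .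
  qed
qed

lemma sqrt_rat:
  assumes "q \<ge> 0"
  shows "complex_of_real (sqrt (of_rat q)) \<in> K"
proof -
  obtain a b where ab: "quotient_of q = (a, b)" by fastforce
  have b: "b > 0" using quotient_of_denom_pos [OF ab] .
  have q: "q = of_int a / of_int b" by (rule quotient_of_div [OF ab])
  then have a: "a \<ge> 0" using assms b by (simp add: zero_le_divide_iff)
  have "(of_rat q :: real) = real (nat a) / real (nat b)"
    using a b by (simp add: q of_rat_divide)
  then have "complex_of_real (sqrt (of_rat q)) =
      complex_of_real (sqrt (real (nat a))) / complex_of_real (sqrt (real (nat b)))"
    by (simp add: real_sqrt_divide)
  then show ?thesis using sqrt_nat by auto
qed

end

section \<open>Cyclotomic fields and conjugates of their elements\<close>

definition zeta :: "nat \<Rightarrow> complex"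
  where "zeta n = cis (2 * pi / real n)"

lemma zeta_power: "zeta n ^ k = cis (2 * pi * real k / real n)"
  by (simp add: zeta_def Complex.DeMoivre mult_ac)

lemma zeta_power_self [simp]: "n \<ge> 1 \<Longrightarrow> zeta n ^ n = 1"
  by (simp add: zeta_power)

lemma zeta_power_inj: "zeta n ^ i = zeta n ^ j \<Longrightarrow> i < n \<Longrightarrow> j < n \<Longrightarrow> i = j"
  using bij_betw_roots_unity [of n] unfolding zeta_power bij_betw_def inj_on_def by force

lemma unity_zeta:
  assumes "n \<ge> 1" "z ^ n = 1"
  obtains k where "k < n" "z = zeta n ^ k"
proof -
  have "z \<in> (\<lambda>k. cis (2 * pi * real k / real n)) ` {..<n}"
    using bij_betw_roots_unity [of n] assms by (auto simp: bij_betw_def)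
  then show ?thesis using that by (auto simp: zeta_power)
qed

lemma zeta_mult: "n \<ge> 1 \<Longrightarrow> m \<ge> 1 \<Longrightarrow> zeta (n * m) ^ m = zeta n"
  unfolding zeta_power by (simp add: zeta_def)

text \<open>With complex conjugation written as a power map, reality of an element becomes an
  integer polynomial relation, which can be carried to its conjugates.\<close>

lemma cnj_zeta: "n \<ge> 1 \<Longrightarrow> cnj (zeta n) = zeta n ^ (n - 1)"
proof -
  assume n: "n \<ge> 1"
  have "zeta n * zeta n ^ (n - 1) = 1" using zeta_power_self [OF n] n by (cases n) auto
  moreover have "zeta n * cnj (zeta n) = 1" by (simp add: zeta_def cis_cnj cis_mult)
  moreover have "zeta n \<noteq> 0" by (simp add: zeta_def)
  ultimately show ?thesis by (metis mult_left_cancel)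
qed

interpretation Rats: csubfield "\<rat>"
  by standard auto

lemma Rats_fraction:
  fixes x :: complex
  assumes "x \<in> \<rat>"
  obtains a b :: int where "b \<noteq> 0" "x = of_int a / of_int b"
proof -
  obtain q where q: "x = of_rat q" using assms by (rule Rats_cases)
  obtain a b where "q = Rat.Fract a b" "b > 0" by (cases q) blast
  then show thesis using that [of b a] q by (simp add: of_rat_rat)
qed

text \<open>Clearing denominators passes from rational to integer polynomials, the form in which
  \<open>cyclotomic_conjugate\<close> applies.\<close>

lemma Rats_adjoin_iff:
  "x \<in> Rats.adjoin u \<longleftrightarrow> (\<exists>h d. d \<noteq> 0 \<and> x = ipoly h u / of_int d)"
proof
  assume "x \<in> Rats.adjoin u"
  then obtain p where p: "p \<in> Rats.polys" "x = poly p u" by (auto simp: Rats.adjoin_def)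
  have "\<exists>h d. d \<noteq> 0 \<and> poly p u = ipoly h u / of_int d" using p(1)
  proof (induction p)
    case 0
    show ?case by (intro exI [of _ 0] exI [of _ 1]) simp
  next
    case (pCons a p)
    have "coeff (pCons a p) 0 \<in> \<rat>" using pCons.prems by (rule Rats.polys_coeff)
    then have "a \<in> \<rat>" by simp
    then obtain m n where mn: "n \<noteq> 0" "a = of_int m / of_int n" by (rule Rats_fraction)
    have "coeff p i \<in> \<rat>" for i
      using Rats.polys_coeff [OF pCons.prems, of "Suc i"] by simp
    then obtain h d where "d \<noteq> 0" "poly p u = ipoly h u / of_int d"
      using pCons.IH by (auto simp: Rats.polys_def)
    then have "poly (pCons a p) u =
        ipoly ([:m * d:] + smult n (pCons 0 h)) u / of_int (n * d)"
      using mn by (simp add: field_simps)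
    then show ?case using mn \<open>d \<noteq> 0\<close> by (metis mult_eq_0_iff)
  qed
  then show "\<exists>h d. d \<noteq> 0 \<and> x = ipoly h u / of_int d" using p by simp
next
  assume "\<exists>h d. d \<noteq> 0 \<and> x = ipoly h u / of_int d"
  then obtain h d where hd: "x = ipoly h u / of_int d" by blast
  define p where "p = smult (inverse (of_int d)) (map_poly of_int h :: complex poly)"
  have "p \<in> Rats.polys" by (auto simp: p_def Rats.polys_def coeff_map_poly)
  moreover have "x = poly p u" by (simp add: p_def hd ipoly_def field_simps)
  ultimately show "x \<in> Rats.adjoin u" using Rats.adjoinI by blast
qed

lemma (in csubfield) ipoly_mem: "u \<in> K \<Longrightarrow> ipoly h u \<in> K"
  by (induction h) auto

lemma (in csubfield) Rats_adjoin_subset: "u \<in> K \<Longrightarrow> Rats.adjoin u \<subseteq> K"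
  by (auto simp: Rats_adjoin_iff intro!: divide ipoly_mem)

text \<open>The maximal cyclotomic field as a directed union, so that each element is a polynomial
  in a single root of unity. \<open>Q_adjoin_mu_inf\<close> identifies it with the field generated
  by \<open>mu_inf\<close>.\<close>

definition Q_unity :: "complex set"
  where "Q_unity = (\<Union>n\<in>{1..}. Rats.adjoin (zeta n))"

lemma csubfield_zeta: "n \<ge> 1 \<Longrightarrow> csubfield (Rats.adjoin (zeta n))"
  by (rule Rats.csubfield_adjoin [of "monom 1 n - [:1:]"])
     (use radical_annihilator_nonzero in \<open>auto simp: poly_monom\<close>)

lemma Rats_adjoin_zeta_mono:
  assumes "n \<ge> 1" "m \<ge> 1"
  shows "Rats.adjoin (zeta n) \<subseteq> Rats.adjoin (zeta (n * m))"
proof -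
  interpret csubfield "Rats.adjoin (zeta (n * m))" using assms by (intro csubfield_zeta) simp
  have "zeta n \<in> Rats.adjoin (zeta (n * m))"
    using power [OF Rats.adjoin_gen, of m] by (simp only: zeta_mult [OF assms])
  then show ?thesis by (rule Rats_adjoin_subset)
qed

interpretation QU: csubfield_unity Q_unity
proof
  have mem: "x \<in> Q_unity" if "n \<ge> 1" "x \<in> Rats.adjoin (zeta n)" for x n
    using that by (auto simp: Q_unity_def)
  show one: "1 \<in> Q_unity"
    using mem [of 1] csubfield.one [OF csubfield_zeta [of 1]] by simp
  fix x y assume x: "x \<in> Q_unity"
  then obtain n where n: "n \<ge> 1" "x \<in> Rats.adjoin (zeta n)" by (auto simp: Q_unity_def)
  show "- x \<in> Q_unity" "inverse x \<in> Q_unity"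
    using mem [OF n(1) csubfield.uminus [OF csubfield_zeta [OF n(1)] n(2)]]
      mem [OF n(1) csubfield.inverse [OF csubfield_zeta [OF n(1)] n(2)]] by auto
  assume "y \<in> Q_unity"
  then obtain m where m: "m \<ge> 1" "y \<in> Rats.adjoin (zeta m)" by (auto simp: Q_unity_def)
  have xy: "x \<in> Rats.adjoin (zeta (n * m))" "y \<in> Rats.adjoin (zeta (n * m))"
    using Rats_adjoin_zeta_mono [OF n(1) m(1)] Rats_adjoin_zeta_mono [OF m(1) n(1)] n m
    by (auto simp: mult.commute)
  have nm: "n * m \<ge> 1" using n m by simp
  show "x + y \<in> Q_unity" "x * y \<in> Q_unity"
    using mem [OF nm csubfield.add [OF csubfield_zeta [OF nm] xy]]
      mem [OF nm csubfield.mult [OF csubfield_zeta [OF nm] xy]] by auto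
next
  fix n :: nat and z :: complex assume n: "n \<ge> 1" "z ^ n = 1"
  then obtain k where "z = zeta n ^ k" by (rule unity_zeta)
  then have "z \<in> Rats.adjoin (zeta n)"
    using csubfield.power [OF csubfield_zeta [OF n(1)] Rats.adjoin_gen] by simp
  then show "z \<in> Q_unity" using n by (auto simp: Q_unity_def)
qed

text \<open>With d the gcd of \<open>a\<close> and \<open>N\<close>, the exponent N/d already takes
  \<open>z ^ a\<close> to 1, so d must be 1.\<close>

lemma coprime_if_primitive:
  fixes z :: complex
  assumes N: "N \<ge> 1" and z: "z ^ N = 1"
    and prim: "\<And>M. 1 \<le> M \<Longrightarrow> M < N \<Longrightarrow> (z ^ a) ^ M \<noteq> 1"
  shows "coprime a N"
proof -
  define M where "M = N div gcd a N"
  have NM: "N = M * gcd a N" by (simp add: M_def)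
  have M1: "M \<ge> 1" using N NM by (cases M) auto
  obtain b where b: "a = gcd a N * b" by (metis gcd_dvd1 dvdE)
  have "a * M = N * b" using b NM by (metis mult.assoc mult.commute)
  then have "(z ^ a) ^ M = 1" using z by (metis power_mult power_one)
  then have "\<not> M < N" using prim M1 by blast
  then have "gcd a N \<le> 1" using NM M1
    by (metis mult_le_cancel1 mult.right_neutral leI less_le_trans zero_less_one le_less_trans)
  moreover have "gcd a N \<noteq> 0" using N by simp
  ultimately have "gcd a N = 1" by linarith
  then show ?thesis by (simp add: coprime_iff_gcd_eq_1)
qed

text \<open>If \<open>w ^ M = 1\<close> with M below \<open>N\<close>, the minimal polynomial of
  \<open>w\<close> divides both \<open>f\<close> and X^M - 1. By minimality of \<open>f\<close> the
  cofactor does not vanish at \<open>zeta N\<close>, so \<open>zeta N\<close> would itself be an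
  M-th root of unity.\<close>

lemma min_ipoly_zeta_root:
  assumes N: "N \<ge> 1" and f: "min_ipoly (zeta N) f" and w: "ipoly f w = 0"
  obtains a where "coprime a N" "w = zeta N ^ a"
proof -
  have "f dvd monom 1 N - 1"
    by (rule min_ipoly_dvd [OF f]) (use N in simp)
  then obtain g where "monom 1 N - 1 = f * g" by (elim dvdE)
  then have "ipoly (monom 1 N - 1) w = 0" using w by simp
  then have wN: "w ^ N = 1" by simp
  then obtain a where a: "a < N" "w = zeta N ^ a" using unity_zeta [OF N] by blast
  have "coprime a N"
  proof (rule coprime_if_primitive [OF N zeta_power_self [OF N]])
    fix M :: nat assume M: "1 \<le> M" "M < N"
    show "(zeta N ^ a) ^ M \<noteq> 1"
    proof
      assume "(zeta N ^ a) ^ M = 1"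
      then have wM: "w ^ M = 1" using a by simp
      obtain fw where fw: "min_ipoly w fw" using min_ipoly_exists [OF M(1) wM] by blast
      obtain s where s: "f = fw * s" using min_ipoly_dvd [OF fw w] by (elim dvdE)
      have "degree fw > 0" by (rule min_ipoly_degree [OF fw])
      moreover have "f \<noteq> 0" using f by (auto simp: min_ipoly_def)
      ultimately have "s \<noteq> 0" "degree s < degree f"
        using s by (auto simp: Polynomial.degree_mult_eq)
      then have "ipoly s (zeta N) \<noteq> 0" using min_ipoly_low_degree [OF f, of s] by blast
      then have fwz: "ipoly fw (zeta N) = 0" using f s by (auto simp: min_ipoly_def)
      have "fw dvd monom 1 M - 1" by (rule min_ipoly_dvd [OF fw]) (simp add: wM)
      then obtain t where "monom 1 M - 1 = fw * t" by (elim dvdE)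
      then have "ipoly (monom 1 M - 1) (zeta N) = 0" using fwz by simp
      then have "zeta N ^ M = zeta N ^ 0" by simp
      then show False using zeta_power_inj [of N M 0] M by auto
    qed
  qed
  then show ?thesis using that a by simp
qed

text \<open>A counting argument in place of Galois descent: the remainder of \<open>h\<close> modulo
  the minimal polynomial \<open>f\<close> takes the value \<open>c\<close> at all roots of
  \<open>f\<close>. These are distinct and too many for a nonzero polynomial of degree below that of
  \<open>f\<close>, so the remainder is the constant \<open>c\<close>.\<close>

lemma conjugates_constant:
  assumes N: "N \<ge> 1" and c: "\<And>a. coprime a N \<Longrightarrow> ipoly h (zeta N ^ a) = c"
  shows "c \<in> \<rat>"
proof -
  obtain f where f: "min_ipoly (zeta N) f" using min_ipoly_exists [OF N] N by fastforce
  obtain s r where h: "h = f * s + r" and r: "r = 0 \<or> degree r < degree f"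
    using monic_division [of f h] f by (auto simp: min_ipoly_def)
  define F :: "complex poly" where "F = map_poly of_int f"
  have dF: "degree F = degree f"
    unfolding F_def by (rule degree_map_poly) simp
  have rc: "ipoly r w = c" if w: "ipoly f w = 0" for w
  proof -
    obtain a where "coprime a N" "w = zeta N ^ a" using min_ipoly_zeta_root [OF N f w] .
    then have "ipoly h w = c" using c by simp
    then show ?thesis using w by (simp add: h)
  qed
  define R :: "complex poly" where "R = map_poly of_int r - [:c:]"
  have "f dvd monom 1 N - 1"
    by (rule min_ipoly_dvd [OF f]) (use N in simp)
  then obtain g where g: "monom 1 N - 1 = f * g" by (elim dvdE)
  have "F * map_poly of_int g = monom 1 N - 1"
  proof (rule poly_ext)
    fix x
    have "ipoly (f * g) x = ipoly (monom 1 N - 1) x" by (simp only: g)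
    then show "poly (F * map_poly of_int g) x = poly (monom 1 N - 1) x"
      by (simp add: F_def poly_monom flip: ipoly_def)
  qed
  then have sq: "rsquarefree F" by (rule rsquarefree_unity [OF N])
  have "degree f > 0" by (rule min_ipoly_degree [OF f])
  then have dR: "degree R < degree f"
    unfolding R_def using r by (intro degree_diff_less) (auto simp: degree_map_poly)
  have "R = 0"
  proof (rule ccontr)
    assume R: "R \<noteq> 0"
    have "{z. poly F z = 0} \<subseteq> {z. poly R z = 0}"
      using rc by (auto simp: F_def R_def simp flip: ipoly_def)
    then have "card {z. poly F z = 0} \<le> card {z. poly R z = 0}"
      by (intro card_mono poly_roots_finite R)
    also have "\<dots> \<le> degree R" by (rule card_poly_roots_bound [OF R])
    finally show False using card_roots_rsquarefree [OF sq] dF dR by simp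
  qed
  then have "coeff R 0 = 0" by simp
  then have "c = of_int (coeff r 0)" by (simp add: R_def coeff_map_poly)
  then show ?thesis by simp
qed

text \<open>The extension \<open>\<rat>(\<mu>\<^sub>\<infinity>)/\<rat>\<close> is abelian, so all conjugates of a real element
  are real; for a radical they agree up to sign.\<close>

lemma real_radical_in_Q_unity:
  assumes t: "t > 0" and tK: "complex_of_real t \<in> Q_unity" and n: "n \<ge> 1"
    and tn: "complex_of_real t ^ n \<in> \<rat>"
  shows "complex_of_real t ^ 2 \<in> \<rat>"
proof -
  obtain N where N: "N \<ge> 1" "complex_of_real t \<in> Rats.adjoin (zeta N)"
    using tK by (auto simp: Q_unity_def)
  then obtain h d where d: "d \<noteq> 0" and th: "complex_of_real t = ipoly h (zeta N) / of_int d"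
    by (auto simp: Rats_adjoin_iff)
  obtain a b where ab: "b \<noteq> 0" "complex_of_real t ^ n = of_int a / of_int b"
    using Rats_fraction [OF tn] by blast
  have zN: "zeta N ^ N = 1" using N by simp
  have ht: "ipoly h (zeta N) = of_int d * complex_of_real t" using d by (simp add: th)
  have cnj_ipoly: "cnj (ipoly g z) = ipoly g (cnj z)" for g z
    by (induction g) auto
  have "ipoly h (zeta N ^ k) ^ 2 = (of_int d * complex_of_real t) ^ 2" if k: "coprime k N" for k
  proof -
    define y where "y = ipoly h (zeta N ^ k)"
    \<comment> \<open>This integer relation records the n-th power of d t. It carries over to the
      conjugate \<open>y\<close>, which therefore has the same absolute value as d t.\<close>
    have "ipoly (smult b (h ^ n) - [:a * d ^ n:]) (zeta N) = 0"
      using ab by (simp add: ht power_mult_distrib)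
    then have "ipoly (smult b (h ^ n) - [:a * d ^ n:]) (zeta N ^ k) = 0"
      by (rule cyclotomic_conjugate [OF N(1) zN k])
    then have "of_int b * y ^ n = of_int b * (of_int d * complex_of_real t) ^ n"
      using ab by (simp add: y_def power_mult_distrib)
    then have "y ^ n = (of_int d * complex_of_real t) ^ n" using ab by simp
    then have "cmod y ^ n = cmod (of_int d * complex_of_real t) ^ n" by (metis norm_power)
    then have cy: "cmod y = cmod (of_int d * complex_of_real t)"
      by (rule power_eq_imp_eq_base) (use n in auto)
    \<comment> \<open>Vanishing of h(X^(N-1)) - h at an N-th root of unity says that the value of
      \<open>h\<close> there is real, so reality passes to \<open>y\<close>.\<close>
    have "ipoly (h \<circ>\<^sub>p monom 1 (N - 1) - h) (zeta N) =
        cnj (ipoly h (zeta N)) - ipoly h (zeta N)"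
      by (simp add: cnj_ipoly cnj_zeta [OF N(1)])
    also have "\<dots> = 0" by (simp add: ht)
    finally have "ipoly (h \<circ>\<^sub>p monom 1 (N - 1) - h) (zeta N ^ k) = 0"
      by (rule cyclotomic_conjugate [OF N(1) zN k])
    moreover have "(zeta N ^ k) ^ (N - 1) = cnj (zeta N ^ k)"
      unfolding complex_cnj_power cnj_zeta [OF N(1)] by (simp only: mult.commute flip: power_mult)
    ultimately have "cnj y = y" by (simp add: y_def cnj_ipoly)
    then have "y \<in> \<real>" by (simp add: Reals_cnj_iff)
    then obtain s where s: "y = complex_of_real s" by (rule Reals_cases)
    then have "\<bar>s\<bar> = \<bar>of_int d * t\<bar>" using cy by (simp add: norm_mult abs_mult)
    then have "s ^ 2 = (of_int d * t) ^ 2" by (metis power2_abs)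
    then show ?thesis unfolding y_def [symmetric] s by (metis of_real_mult of_real_of_int_eq of_real_power)
  qed
  then have "(of_int d * complex_of_real t) ^ 2 \<in> \<rat>"
    by (intro conjugates_constant [OF N(1), of "h ^ 2"]) simp
  then have "(of_int d * complex_of_real t) ^ 2 / of_int d ^ 2 \<in> \<rat>" by auto
  then show ?thesis using d by (simp add: power_mult_distrib)
qed

section \<open>Extending group automorphisms to field automorphisms\<close>

lemma C_ring_simps [simp]:
  "carrier C_ring = UNIV" "x \<otimes>\<^bsub>C_ring\<^esub> y = x * y" "\<one>\<^bsub>C_ring\<^esub> = 1"
  "\<zero>\<^bsub>C_ring\<^esub> = 0" "x \<oplus>\<^bsub>C_ring\<^esub> y = x + y"
  by (simp_all add: ring_of_type_algebra_def)

lemma C_ring_a_inv [simp]: "\<ominus>\<^bsub>C_ring\<^esub> x = - x"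
  by (rule abelian_group.minus_equality [OF ring.is_abelian_group [OF ring_from_type_algebra]]) auto

lemma C_ring_m_inv: "x \<noteq> 0 \<Longrightarrow> inv\<^bsub>C_ring\<^esub> x = inverse x"
  by (rule monoid.inv_unique' [OF ring.is_monoid [OF ring_from_type_algebra], symmetric]) auto

lemma csubfield_Q_adjoin: "csubfield (Q_adjoin S)"
proof
  show "1 \<in> Q_adjoin S" using generate_field.one [of C_ring "\<rat> \<union> S"] by (simp add: Q_adjoin_def)
  fix x assume x: "x \<in> Q_adjoin S"
  then show "- x \<in> Q_adjoin S"
    using generate_field.a_inv [of x C_ring "\<rat> \<union> S"] by (simp add: Q_adjoin_def)
  show "inverse x \<in> Q_adjoin S"
    using generate_field.m_inv [of x C_ring "\<rat> \<union> S"] x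
    by (cases "x = 0") (simp_all add: Q_adjoin_def C_ring_m_inv)
  fix y assume "y \<in> Q_adjoin S"
  then show "x + y \<in> Q_adjoin S" "x * y \<in> Q_adjoin S"
    using generate_field.eng_add [of x C_ring "\<rat> \<union> S" y] x
      generate_field.eng_mult [of x C_ring "\<rat> \<union> S" y]
    by (simp_all add: Q_adjoin_def)
qed

lemma Q_adjoin_incl: "S \<subseteq> Q_adjoin S"
  by (auto simp: Q_adjoin_def intro: generate_field.incl)

lemma Q_adjoin_least:
  assumes "csubfield L" "S \<subseteq> L"
  shows "Q_adjoin S \<subseteq> L"
proof
  interpret csubfield L by fact
  fix x assume "x \<in> Q_adjoin S"
  then show "x \<in> L" unfolding Q_adjoin_def
    by (induction rule: generate_field.induct) (use rats assms in \<open>auto simp: C_ring_m_inv\<close>)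
qed

lemma Q_adjoin_mono: "S \<subseteq> T \<Longrightarrow> Q_adjoin S \<subseteq> Q_adjoin T"
  by (rule Q_adjoin_least [OF csubfield_Q_adjoin]) (use Q_adjoin_incl in blast)

section \<open>Homomorphisms on subfields and Galois groups\<close>

definition field_hom_on :: "complex set \<Rightarrow> (complex \<Rightarrow> complex) \<Rightarrow> bool"
  where "field_hom_on L f \<longleftrightarrow>
    (\<forall>x\<in>L. \<forall>y\<in>L. f (x + y) = f x + f y \<and> f (x * y) = f x * f y) \<and> f 1 = 1"

context csubfield
begin

lemma hom_props:
  assumes f: "field_hom_on K f"
  shows "f 0 = 0" "x \<in> K \<Longrightarrow> f (- x) = - f x" "x \<in> K \<Longrightarrow> f (inverse x) = inverse (f x)"
    "x \<in> K \<Longrightarrow> f (x ^ n) = f x ^ n"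
proof -
  have "f (0 + 0) = f 0 + f 0" using f zero unfolding field_hom_on_def by blast
  then show f0: "f 0 = 0" by simp
  {
    assume x: "x \<in> K"
    have "f (x + - x) = f x + f (- x)" using f x uminus unfolding field_hom_on_def by blast
    then show "f (- x) = - f x" using f0 by (simp add: eq_neg_iff_add_eq_0 add.commute)
    show "f (inverse x) = inverse (f x)"
    proof (cases "x = 0")
      case True
      then show ?thesis using f0 by simp
    next
      case False
      have "f (x * inverse x) = f x * f (inverse x)"
        using f x inverse unfolding field_hom_on_def by blast
      then have "f x * f (inverse x) = 1" using False f by (simp add: field_hom_on_def)
      then show ?thesis by (metis inverse_unique)
    qed
    show "f (x ^ n) = f x ^ n"
      by (induction n) (use f x power in \<open>auto simp: field_hom_on_def\<close>)
  }
qed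

lemma hom_equalizer:
  assumes f: "field_hom_on K f" and g: "field_hom_on K g"
  shows "csubfield {x \<in> K. f x = g x}"
proof
  fix x assume x: "x \<in> {x \<in> K. f x = g x}"
  then show "- x \<in> {x \<in> K. f x = g x}" "inverse x \<in> {x \<in> K. f x = g x}"
    using hom_props [OF f] hom_props [OF g] by auto
  fix y assume "y \<in> {x \<in> K. f x = g x}"
  with x show "x + y \<in> {x \<in> K. f x = g x}" "x * y \<in> {x \<in> K. f x = g x}"
    using f g by (auto simp: field_hom_on_def)
qed (use f g in \<open>auto simp: field_hom_on_def\<close>)

lemma hom_agree:
  assumes "field_hom_on K f" "field_hom_on K g" "S \<subseteq> K"
    and "\<And>x. x \<in> S \<Longrightarrow> f x = g x" and "x \<in> Q_adjoin S"
  shows "f x = g x"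
  using Q_adjoin_least [OF hom_equalizer [OF assms(1,2)], of S] assms(3-) by auto

lemma hom_Rats: "field_hom_on K f \<Longrightarrow> x \<in> \<rat> \<Longrightarrow> f x = x"
  using csubfield.rats [OF hom_equalizer, of f "\<lambda>x. x"] by (auto simp: field_hom_on_def)

lemma carrier_Gal_Q:
  "s \<in> carrier (Gal_Q K) \<longleftrightarrow> s \<in> extensional K \<and> bij_betw s K K \<and> field_hom_on K s"
proof
  assume "s \<in> carrier (Gal_Q K)"
  then show "s \<in> extensional K \<and> bij_betw s K K \<and> field_hom_on K s"
    by (auto simp: Gal_Q_def Bij_def ring_iso_def ring_hom_def field_hom_on_def)
next
  assume s: "s \<in> extensional K \<and> bij_betw s K K \<and> field_hom_on K s"
  then have "\<forall>x\<in>\<rat>. s x = x" using hom_Rats by blast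
  then show "s \<in> carrier (Gal_Q K)" using s
    by (auto simp: Gal_Q_def Bij_def ring_iso_def ring_hom_def field_hom_on_def bij_betw_def)
qed

lemma Gal_Q_mult:
  "s \<in> carrier (Gal_Q K) \<Longrightarrow> t \<in> carrier (Gal_Q K) \<Longrightarrow> s \<otimes>\<^bsub>Gal_Q K\<^esub> t = compose K s t"
  by (simp add: Gal_Q_def BijGroup_def)

lemma Gal_Q_compose:
  "s \<in> carrier (Gal_Q K) \<Longrightarrow> t \<in> carrier (Gal_Q K) \<Longrightarrow> compose K s t \<in> carrier (Gal_Q K)"
  unfolding carrier_Gal_Q
  by (intro conjI compose_extensional bij_betw_compose)
     (auto simp: field_hom_on_def compose_def bij_betwE add mult)

lemma Gal_Q_eqI:
  assumes "s \<in> carrier (Gal_Q (Q_adjoin S))" "t \<in> carrier (Gal_Q (Q_adjoin S))"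
    and "\<And>x. x \<in> S \<Longrightarrow> s x = t x"
  shows "s = t"
proof -
  interpret Q: csubfield "Q_adjoin S" by (rule csubfield_Q_adjoin)
  have "s x = t x" if "x \<in> Q_adjoin S" for x
    using Q.hom_agree [of s t S x] assms that Q_adjoin_incl by (auto simp: Q.carrier_Gal_Q)
  then show ?thesis using assms by (auto simp: Q.carrier_Gal_Q intro: extensionalityI)
qed

end

text \<open>The automorphism is built as its graph \<open>T\<close>. Both projections of
  \<open>T\<close> are subfields containing \<open>H\<close>, hence contain
  \<open>Q_adjoin H\<close>; applying \<open>zero\<close> to differences of pairs makes
  \<open>T\<close> single-valued and injective.\<close>

lemma graph_automorphism:
  assumes one: "(1, 1) \<in> T"
    and add: "\<And>a b c d. (a, b) \<in> T \<Longrightarrow> (c, d) \<in> T \<Longrightarrow> (a + c, b + d) \<in> T"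
    and mult: "\<And>a b c d. (a, b) \<in> T \<Longrightarrow> (c, d) \<in> T \<Longrightarrow> (a * c, b * d) \<in> T"
    and uminus: "\<And>a b. (a, b) \<in> T \<Longrightarrow> (- a, - b) \<in> T"
    and inverse: "\<And>a b. (a, b) \<in> T \<Longrightarrow> (inverse a, inverse b) \<in> T"
    and zero: "\<And>a b. (a, b) \<in> T \<Longrightarrow> a = 0 \<longleftrightarrow> b = 0"
    and H: "\<And>x. x \<in> H \<Longrightarrow> (x, \<alpha> x) \<in> T" and surj: "\<alpha> ` H = H"
    and T: "T \<subseteq> Q_adjoin H \<times> Q_adjoin H"
  shows "\<exists>s\<in>carrier (Gal_Q (Q_adjoin H)). \<forall>x\<in>H. s x = \<alpha> x"
proof -
  define L where "L = Q_adjoin H"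
  interpret L: csubfield L unfolding L_def by (rule csubfield_Q_adjoin)
  have field: "csubfield (f ` T)" if "f = fst \<or> f = snd" for f
  proof
    show "1 \<in> f ` T" using that one by force
    fix x assume "x \<in> f ` T"
    then obtain a b where x: "(a, b) \<in> T" "x = f (a, b)" by auto
    show "- x \<in> f ` T" "inverse x \<in> f ` T"
      using uminus [OF x(1)] inverse [OF x(1)] x(2) that by force+
    fix y assume "y \<in> f ` T"
    then obtain c d where y: "(c, d) \<in> T" "y = f (c, d)" by auto
    show "x + y \<in> f ` T" "x * y \<in> f ` T"
      using add [OF x(1) y(1)] mult [OF x(1) y(1)] x(2) y(2) that by force+
  qed
  have "L \<subseteq> fst ` T" unfolding L_def by (rule Q_adjoin_least [OF field]) (use H in force)+
  have "L \<subseteq> snd ` T" unfolding L_def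
    by (rule Q_adjoin_least [OF field]) (use H surj in \<open>force simp: image_iff\<close>)+
  have fun_T: "b = d" if "(a, b) \<in> T" "(a, d) \<in> T" for a b d
    using zero [OF add [OF that(1) uminus [OF that(2)]]] by simp
  have inj_T: "a = c" if "(a, b) \<in> T" "(c, b) \<in> T" for a b c
    using zero [OF add [OF that(1) uminus [OF that(2)]]] by simp
  define s where "s = (\<lambda>x\<in>L. THE y. (x, y) \<in> T)"
  have sT: "s x = y" if "(x, y) \<in> T" for x y
    using that T fun_T unfolding s_def L_def [symmetric] by (auto intro!: the_equality)
  have s: "(x, s x) \<in> T" if "x \<in> L" for x
    using \<open>L \<subseteq> fst ` T\<close> that sT by force
  have "inj_on s L" using inj_T s by (intro inj_onI) metis
  moreover have "s ` L = L"
    using s T sT \<open>L \<subseteq> snd ` T\<close> unfolding L_def [symmetric] by (force simp: image_iff)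
  ultimately have "bij_betw s L L" by (simp add: bij_betw_def)
  moreover have "field_hom_on L s" unfolding field_hom_on_def
    using sT [OF add] sT [OF mult] sT [OF one] s by blast
  ultimately have "s \<in> carrier (Gal_Q L)" by (simp add: L.carrier_Gal_Q s_def)
  moreover have "\<forall>x\<in>H. s x = \<alpha> x" using sT H by blast
  ultimately show ?thesis unfolding L_def by blast
qed

text \<open>The rational span of the graph of \<alpha>, built one term at a time so that closure
  under sums and products goes by induction; \<open>graph_span_sum\<close> recovers one coefficient
  per element.\<close>

inductive_set graph_span :: "complex set \<Rightarrow> (complex \<Rightarrow> complex) \<Rightarrow> (complex \<times> complex) set"
  for H :: "complex set" and \<alpha> :: "complex \<Rightarrow> complex" where
    zero: "(0, 0) \<in> graph_span H \<alpha>"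
  | step: "(a, b) \<in> graph_span H \<alpha> \<Longrightarrow> q \<in> \<rat> \<Longrightarrow> x \<in> H \<Longrightarrow> (a + q * x, b + q * \<alpha> x) \<in> graph_span H \<alpha>"

lemma graph_span_sum:
  assumes "(a, b) \<in> graph_span H \<alpha>"
  shows "\<exists>A c. finite A \<and> A \<subseteq> H \<and> (\<forall>x. c x \<in> \<rat>) \<and>
    a = (\<Sum>x\<in>A. c x * x) \<and> b = (\<Sum>x\<in>A. c x * \<alpha> x)"
  using assms
proof (induction rule: graph_span.induct)
  case zero
  show ?case by (intro exI [of _ "{}"] exI [of _ "\<lambda>_. 0"]) simp
next
  case (step a b q y)
  then obtain A c where A: "finite A" "A \<subseteq> H" "\<And>x. c x \<in> \<rat>"
    "a = (\<Sum>x\<in>A. c x * x)" "b = (\<Sum>x\<in>A. c x * \<alpha> x)" by blast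
  \<comment> \<open>\<open>y\<close> may already occur in \<open>A\<close>; its new coefficient is
    added to the old one, counted as 0 outside \<open>A\<close>.\<close>
  define c' where "c' x = (if x \<in> A then c x else 0) + (if x = y then q else 0)" for x
  have *: "(\<Sum>x\<in>insert y A. c' x * f x) = (\<Sum>x\<in>A. c x * f x) + q * f y" for f :: "complex \<Rightarrow> complex"
  proof -
    have "(\<Sum>x\<in>insert y A. c' x * f x) =
        (\<Sum>x\<in>insert y A. (if x \<in> A then c x * f x else 0) + (if x = y then q * f y else 0))"
      by (intro sum.cong) (auto simp: c'_def distrib_right)
    also have "\<dots> = (\<Sum>x\<in>insert y A. if x \<in> A then c x * f x else 0) + q * f y"
      using A by (simp add: sum.distrib)
    also have "(\<Sum>x\<in>insert y A. if x \<in> A then c x * f x else 0) = (\<Sum>x\<in>A. c x * f x)"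
      using A by (intro sum.mono_neutral_cong_right) auto
    finally show ?thesis .
  qed
  have "\<forall>x. c' x \<in> \<rat>" using A step by (auto simp: c'_def)
  then show ?case using A step * [of "\<lambda>x. x"] * [of \<alpha>]
    by (intro exI [of _ "insert y A"] exI [of _ c']) simp
qed

lemma graph_span_add:
  "(a, b) \<in> graph_span H \<alpha> \<Longrightarrow> (c, d) \<in> graph_span H \<alpha> \<Longrightarrow> (a + c, b + d) \<in> graph_span H \<alpha>"
proof (induction rule: graph_span.induct)
  case (step a b q x)
  then have "(a + c + q * x, b + d + q * \<alpha> x) \<in> graph_span H \<alpha>" by (intro graph_span.step) auto
  then show ?case by (simp add: algebra_simps)
qed simp

lemma graph_span_scale:
  assumes H: "\<And>x y. x \<in> H \<Longrightarrow> y \<in> H \<Longrightarrow> x * y \<in> H \<and> \<alpha> (x * y) = \<alpha> x * \<alpha> y"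
    and q: "q \<in> \<rat>" "x \<in> H" and "(a, b) \<in> graph_span H \<alpha>"
  shows "(q * x * a, q * \<alpha> x * b) \<in> graph_span H \<alpha>"
  using assms(4)
proof (induction rule: graph_span.induct)
  case zero
  show ?case using graph_span.zero by simp
next
  case (step a b r y)
  then have "(q * x * a + (q * r) * (x * y), q * \<alpha> x * b + (q * r) * \<alpha> (x * y)) \<in> graph_span H \<alpha>"
    using q H by (intro graph_span.step) auto
  then show ?case using q H step by (simp add: algebra_simps)
qed

lemma graph_span_mult:
  assumes H: "\<And>x y. x \<in> H \<Longrightarrow> y \<in> H \<Longrightarrow> x * y \<in> H \<and> \<alpha> (x * y) = \<alpha> x * \<alpha> y"
    and "(a, b) \<in> graph_span H \<alpha>" "(c, d) \<in> graph_span H \<alpha>"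
  shows "(a * c, b * d) \<in> graph_span H \<alpha>"
  using assms(2)
proof (induction rule: graph_span.induct)
  case zero
  show ?case using graph_span.zero by simp
next
  case (step a b q x)
  then have "(a * c + q * x * c, b * d + q * \<alpha> x * d) \<in> graph_span H \<alpha>"
    using graph_span_add graph_span_scale [OF H] assms(3) by blast
  then show ?case by (simp add: algebra_simps)
qed

text \<open>A relation-preserving automorphism extends to the rational span and then
  to quotients of elements of the span.\<close>

lemma extend_to_field_automorphism:
  assumes H: "1 \<in> H" "0 \<notin> H"
      "\<And>x y. x \<in> H \<Longrightarrow> y \<in> H \<Longrightarrow> x * y \<in> H \<and> \<alpha> (x * y) = \<alpha> x * \<alpha> y"
    and surj: "\<alpha> ` H = H"
    and rel: "\<And>A c. finite A \<Longrightarrow> A \<subseteq> H \<Longrightarrow> (\<And>x. c x \<in> \<rat>) \<Longrightarrow>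
      (\<Sum>x\<in>A. c x * x) = 0 \<longleftrightarrow> (\<Sum>x\<in>A. c x * \<alpha> x) = 0"
  shows "\<exists>s\<in>carrier (Gal_Q (Q_adjoin H)). \<forall>x\<in>H. s x = \<alpha> x"
proof -
  define S where "S = graph_span H \<alpha>"
  interpret Q: csubfield "Q_adjoin H" by (rule csubfield_Q_adjoin)
  have \<alpha>H: "\<alpha> x \<in> H" if "x \<in> H" for x using surj that by blast
  have "\<alpha> 1 * \<alpha> 1 = \<alpha> 1" using H(1) H(3) [of 1 1] by simp
  moreover have "\<alpha> 1 \<noteq> 0" using \<alpha>H [OF H(1)] H(2) by metis
  ultimately have \<alpha>1: "\<alpha> 1 = 1" by simp
  have S0: "a = 0 \<longleftrightarrow> b = 0" if "(a, b) \<in> S" for a b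
  proof -
    obtain A c where A: "finite A" "A \<subseteq> H" "\<forall>x. c x \<in> \<rat>"
      "a = (\<Sum>x\<in>A. c x * x)" "b = (\<Sum>x\<in>A. c x * \<alpha> x)"
      using graph_span_sum [OF \<open>(a, b) \<in> S\<close> [unfolded S_def]] by blast
    show ?thesis unfolding A(4,5) by (rule rel [OF A(1,2)]) (use A(3) in auto)
  qed
  have SQ: "a \<in> Q_adjoin H \<and> b \<in> Q_adjoin H" if "(a, b) \<in> S" for a b
    using that unfolding S_def
  proof (induction rule: graph_span.induct)
    case (step a b q x)
    moreover have "x \<in> Q_adjoin H" "\<alpha> x \<in> Q_adjoin H" "q \<in> Q_adjoin H"
      using step \<alpha>H Q_adjoin_incl Q.rats by blast+
    ultimately show ?case by blast
  qed auto
  have SH: "(q * x, q * \<alpha> x) \<in> S" if "q \<in> \<rat>" "x \<in> H" for q x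
    using graph_span.step [OF graph_span.zero that] by (simp add: S_def)
  have S1: "(1, 1) \<in> S" using SH [OF _ H(1), of 1] \<alpha>1 by simp
  have Sadd: "(a + c, b + d) \<in> S" and Smult: "(a * c, b * d) \<in> S"
    if "(a, b) \<in> S" "(c, d) \<in> S" for a b c d
    using that graph_span_add graph_span_mult [OF H(3)] unfolding S_def by blast+
  have Sneg: "(- a, - b) \<in> S" if "(a, b) \<in> S" for a b
    using Smult [OF SH [OF _ H(1), of "-1"] that] \<alpha>1 by simp
  \<comment> \<open>\<open>S\<close> is closed under ring operations; fractions supply the inverses.
    By \<open>S0\<close> a nonzero denominator on the left is matched by a nonzero one on the
    right.\<close>
  define T where "T = {(a / b, a' / b') | a a' b b'. (a, a') \<in> S \<and> (b, b') \<in> S \<and> b \<noteq> 0}"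
  have TI: "(a / b, a' / b') \<in> T" if "(a, a') \<in> S" "(b, b') \<in> S" "b \<noteq> 0" for a a' b b'
    using that by (auto simp: T_def)
  show ?thesis
  proof (rule graph_automorphism [of T])
    show "(1, 1) \<in> T" using TI [OF S1 S1] by simp
  next
    fix x y u v assume "(x, y) \<in> T" "(u, v) \<in> T"
    then obtain a a' b b' c c' d d' where
      xy: "x = a / b" "y = a' / b'" "u = c / d" "v = c' / d'"
      and S: "(a, a') \<in> S" "(b, b') \<in> S" "(c, c') \<in> S" "(d, d') \<in> S" and nz: "b \<noteq> 0" "d \<noteq> 0"
      unfolding T_def by blast
    have nz': "b' \<noteq> 0" "d' \<noteq> 0" using S0 S nz by metis+
    have bd: "(b * d, b' * d') \<in> S" "b * d \<noteq> 0" using Smult S nz by auto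
    have "((a * d + c * b) / (b * d), (a' * d' + c' * b') / (b' * d')) \<in> T"
      by (intro TI Sadd Smult S bd)
    then show "(x + u, y + v) \<in> T" using nz nz' by (simp add: xy add_frac_eq)
    have "((a * c) / (b * d), (a' * c') / (b' * d')) \<in> T"
      by (intro TI Smult S bd)
    then show "(x * u, y * v) \<in> T" by (simp add: xy)
  next
    fix x y assume "(x, y) \<in> T"
    then obtain a a' b b' where xy: "x = a / b" "y = a' / b'"
      and S: "(a, a') \<in> S" "(b, b') \<in> S" and nz: "b \<noteq> 0"
      unfolding T_def by blast
    have nz': "b' \<noteq> 0" using S0 S nz by metis
    show "(- x, - y) \<in> T" using TI [OF Sneg [OF S(1)] S(2) nz] by (simp add: xy)
    show "x = 0 \<longleftrightarrow> y = 0" using S0 [OF S(1)] nz nz' by (simp add: xy)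
    show "(inverse x, inverse y) \<in> T"
    proof (cases "a = 0")
      \<comment> \<open>The pair is then (0, 0), which is its own inverse under the convention
        \<open>inverse 0 = 0\<close>.\<close>
      case True
      then have "a' = 0" using S0 S by blast
      then show ?thesis using \<open>(x, y) \<in> T\<close> True by (simp add: xy)
    next
      case False
      then show ?thesis using TI [OF S(2,1)] by (simp add: xy)
    qed
  next
    fix x assume "x \<in> H"
    then show "(x, \<alpha> x) \<in> T" using TI [OF SH [of 1 x] S1] by simp
  next
    show "T \<subseteq> Q_adjoin H \<times> Q_adjoin H" unfolding T_def using SQ by blast
  qed (rule surj)
qed

section \<open>Bases of groups of rational numbers\<close>

locale csubgroup =
  fixes D :: "complex set"
  assumes one [simp, intro]: "1 \<in> D"
    and mult [intro]: "x \<in> D \<Longrightarrow> y \<in> D \<Longrightarrow> x * y \<in> D"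
    and inverse [intro]: "x \<in> D \<Longrightarrow> inverse x \<in> D"
    and nonzero: "0 \<notin> D"
begin

lemma nz: "x \<in> D \<Longrightarrow> x \<noteq> 0"
  using nonzero by auto

lemma divide: "x \<in> D \<Longrightarrow> y \<in> D \<Longrightarrow> x / y \<in> D"
  using mult [OF _ inverse, of x y] by (simp add: field_simps)

lemma power: "x \<in> D \<Longrightarrow> x ^ n \<in> D"
  by (induction n) auto

lemma powi: "x \<in> D \<Longrightarrow> x powi k \<in> D"
  by (simp add: power_int_def power inverse)

lemma prod: "(\<And>i. i \<in> I \<Longrightarrow> f i \<in> D) \<Longrightarrow> prod f I \<in> D"
  by (induction I rule: infinite_finite_induct) auto

end

locale int_hom = csubgroup +
  fixes v :: "complex \<Rightarrow> int"
  assumes add: "x \<in> D \<Longrightarrow> y \<in> D \<Longrightarrow> v (x * y) = v x + v y"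
begin

lemma v_one: "v 1 = 0"
  using add [OF one one] by simp

lemma v_inverse: "x \<in> D \<Longrightarrow> v (inverse x) = - v x"
  using add [of x "inverse x"] inverse [of x] nz [of x] v_one by simp

lemma v_power: "x \<in> D \<Longrightarrow> v (x ^ n) = int n * v x"
  by (induction n) (auto simp: v_one add power algebra_simps)

lemma v_powi: "x \<in> D \<Longrightarrow> v (x powi k) = k * v x"
  by (simp add: power_int_def v_power v_inverse inverse)

lemma v_prod: "(\<And>i. i \<in> I \<Longrightarrow> f i \<in> D) \<Longrightarrow> v (prod f I) = (\<Sum>i\<in>I. v (f i))"
  by (induction I rule: infinite_finite_induct) (auto simp: v_one add prod)

end

text \<open>The homomorphisms in \<open>V\<close> embed \<open>D\<close> into a free abelian group
  of finite rank. An element \<open>b\<close> with least positive value under \<open>v\<close>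
  splits off: all values of \<open>v\<close> are multiples of \<open>v b\<close>, so
  \<open>D\<close> is the product of the powers of \<open>b\<close> and the kernel of
  \<open>v\<close>, which the remaining homomorphisms separate.\<close>

lemma finite_basis:
  assumes "finite V" and "csubgroup D" and "\<And>v. v \<in> V \<Longrightarrow> int_hom D v"
    and "\<And>x. x \<in> D \<Longrightarrow> (\<And>v. v \<in> V \<Longrightarrow> v x = 0) \<Longrightarrow> x = 1"
  shows "\<exists>B\<subseteq>D. finite B \<and> mult_independent B \<and>
    (\<forall>x\<in>D. \<exists>k :: complex \<Rightarrow> int. x = (\<Prod>b\<in>B. b powi k b))"
  using assms
proof (induction V arbitrary: D rule: finite_induct)
  case empty
  then show ?case by (intro exI [of _ "{}"]) (auto simp: mult_independent_def)
next
  case (insert v V)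
  interpret csubgroup D by (rule insert.prems)
  interpret int_hom D v by (rule insert.prems) simp
  show ?case
  proof (cases "\<forall>x\<in>D. v x = 0")
    case True
    then show ?thesis
      by (intro insert.IH csubgroup_axioms insert.prems) auto
  next
    case False
    then obtain x0 where x0: "x0 \<in> D" "v x0 \<noteq> 0" by blast
    have "\<exists>x. x \<in> D \<and> v x > 0"
    proof (cases "v x0 > 0")
      case False
      then show ?thesis using x0 v_inverse [of x0] inverse [of x0]
        by (intro exI [of _ "inverse x0"]) auto
    qed (use x0 in auto)
    then obtain b where b: "b \<in> D" "v b > 0"
      and min: "\<And>x. x \<in> D \<and> v x > 0 \<Longrightarrow> nat (v b) \<le> nat (v x)"
      using ex_has_least_nat [of "\<lambda>x. x \<in> D \<and> v x > 0" _ "\<lambda>x. nat (v x)"] by blast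
    define D' where "D' = {x \<in> D. v x = 0}"
    have D': "csubgroup D'"
      by standard (auto simp: D'_def v_one add v_inverse nonzero)
    have "int_hom D' w" if "w \<in> V" for w
    proof -
      have "int_hom D w" using insert.prems that by simp
      then show ?thesis using D'
        by (auto simp: int_hom_def int_hom_axioms_def D'_def)
    qed
    moreover have "x = 1" if "x \<in> D'" "\<And>w. w \<in> V \<Longrightarrow> w x = 0" for x
      using insert.prems(3) [of x] that by (auto simp: D'_def)
    ultimately obtain B' where B': "B' \<subseteq> D'" "finite B'" "mult_independent B'"
      and gen: "\<And>x. x \<in> D' \<Longrightarrow> \<exists>k :: complex \<Rightarrow> int. x = (\<Prod>b\<in>B'. b powi k b)"
      using insert.IH [OF D'] by metis
    have bB: "b \<notin> B'" using b B' by (auto simp: D'_def)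
    have BD: "insert b B' \<subseteq> D" using b B' by (auto simp: D'_def)
    have "mult_independent (insert b B')"
      unfolding mult_independent_def
    proof (intro allI impI)
      fix c :: "complex \<Rightarrow> int"
      assume one: "(\<Prod>x\<in>insert b B'. x powi c x) = 1"
      have "v (\<Prod>x\<in>insert b B'. x powi c x) = (\<Sum>x\<in>insert b B'. c x * v x)"
        using BD by (subst v_prod) (auto simp: v_powi intro!: powi sum.cong)
      also have "\<dots> = c b * v b + (\<Sum>x\<in>B'. c x * v x)" using bB B' by simp
      also have "(\<Sum>x\<in>B'. c x * v x) = 0" using B' by (intro sum.neutral) (auto simp: D'_def)
      finally have "c b = 0" using one b v_one by simp
      then have "(\<Prod>x\<in>B'. x powi c x) = 1" using one bB B' by simp
      then have "\<forall>x\<in>B'. c x = 0" using B'(3) unfolding mult_independent_def by blast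
      then show "\<forall>x\<in>insert b B'. c x = 0" using \<open>c b = 0\<close> by simp
    qed
    moreover have "\<exists>k :: complex \<Rightarrow> int. x = (\<Prod>b\<in>insert b B'. b powi k b)" if x: "x \<in> D" for x
    proof -
      define q where "q = v x div v b"
      define y where "y = x * inverse (b powi q)"
      have bq: "b powi q \<in> D" using b by (intro powi)
      have yD: "y \<in> D" unfolding y_def using x bq by (intro mult inverse)
      have vy: "v y = v x mod v b"
        unfolding y_def using x bq b
        by (simp add: add v_inverse inverse v_powi q_def minus_div_mult_eq_mod)
      have "v y = 0"
      proof (rule ccontr)
        assume "v y \<noteq> 0"
        then have "v y > 0" using vy b by (simp add: order_less_le)
        then have "v b \<le> v y" using min [of y] yD by simp
        then show False using vy b pos_mod_bound [OF b(2), of "v x"] by simp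
      qed
      then obtain k :: "complex \<Rightarrow> int" where k: "y = (\<Prod>b\<in>B'. b powi k b)"
        using gen [of y] yD by (auto simp: D'_def)
      have "x = b powi q * y" using nz [OF bq] by (simp add: y_def)
      also have "y = (\<Prod>c\<in>B'. c powi (k(b := q)) c)"
        unfolding k
      proof (intro prod.cong refl)
        fix c assume "c \<in> B'"
        then have "c \<noteq> b" using bB by auto
        then show "c powi k c = c powi (k(b := q)) c" by simp
      qed
      also have "b powi q * (\<Prod>c\<in>B'. c powi (k(b := q)) c) =
          (\<Prod>c\<in>insert b B'. c powi (k(b := q)) c)"
        using bB B' by simp
      finally show ?thesis by blast
    qed
    ultimately show ?thesis using BD B' by (intro exI [of _ "insert b B'"]) auto
  qed
qed

text \<open>Fraction-free Gaussian elimination: a row \<open>i0\<close> with nonzero entry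
  \<open>p\<close> in column \<open>j\<close> clears that column from the other rows. Its own
  coefficient is chosen at the end so that column \<open>j\<close> cancels.\<close>

lemma integer_relation:
  fixes m :: "'a \<Rightarrow> 'b \<Rightarrow> int"
  assumes "finite J" "finite I" "card J < card I"
  shows "\<exists>c. (\<exists>i\<in>I. c i \<noteq> 0) \<and> (\<forall>j\<in>J. (\<Sum>i\<in>I. c i * m i j) = 0)"
  using assms
proof (induction J arbitrary: I m rule: finite_induct)
  case empty
  then obtain i where "i \<in> I" by (metis card.empty equals0I less_irrefl)
  then show ?case by (intro exI [of _ "\<lambda>_. 1"]) auto
next
  case (insert j J)
  show ?case
  proof (cases "\<forall>i\<in>I. m i j = 0")
    case True
    have "card J < card I" using insert by simp
    then show ?thesis using insert.IH [OF insert.prems(1), of m] True by auto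
  next
    case False
    then obtain i0 where i0: "i0 \<in> I" "m i0 j \<noteq> 0" by blast
    define p where "p = m i0 j"
    define I' where "I' = I - {i0}"
    have "card J < card I'" "finite I'" using insert i0 by (auto simp: I'_def)
    then obtain c' where c': "\<exists>i\<in>I'. c' i \<noteq> 0"
      "\<And>l. l \<in> J \<Longrightarrow> (\<Sum>i\<in>I'. c' i * (p * m i l - m i j * m i0 l)) = 0"
      using insert.IH [of I' "\<lambda>i l. p * m i l - m i j * m i0 l"] by blast
    define c where "c i = (if i = i0 then - (\<Sum>i\<in>I'. c' i * m i j) else p * c' i)" for i
    have S: "(\<Sum>i\<in>I. c i * m i l) = (\<Sum>i\<in>I'. c' i * (p * m i l - m i j * m i0 l))" for l
    proof -
      have "(\<Sum>i\<in>I. c i * m i l) = c i0 * m i0 l + (\<Sum>i\<in>I'. c i * m i l)"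
        unfolding I'_def using insert.prems i0 by (intro sum.remove) auto
      also have "(\<Sum>i\<in>I'. c i * m i l) = (\<Sum>i\<in>I'. c' i * (p * m i l))"
        by (intro sum.cong) (auto simp: c_def I'_def)
      finally show ?thesis
        by (simp add: c_def sum_distrib_right sum_subtractf right_diff_distrib mult.assoc)
    qed
    have "(\<Sum>i\<in>I. c i * m i l) = 0" if "l \<in> insert j J" for l
      using that c'(2) unfolding S by (auto simp: p_def mult.commute)
    moreover have "\<exists>i\<in>I. c i \<noteq> 0"
      using c'(1) i0 by (auto simp: c_def I'_def p_def)
    ultimately show ?thesis by blast
  qed
qed

section \<open>Valuations of rational numbers at primes\<close>

definition pval :: "int \<Rightarrow> complex \<Rightarrow> int"
  where "pval p x = (let (a, b) = quotient_of (THE q. x = of_rat q) in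
    int (multiplicity p a) - int (multiplicity p b))"

text \<open>\<open>pval\<close> refers to the reduced fraction; cross-multiplication with it shows
  that every representation as a fraction computes the same value.\<close>

lemma pval_eq:
  assumes p: "prime p" and ab: "a \<noteq> 0" "b \<noteq> 0"
  shows "pval p (of_int a / of_int b) = int (multiplicity p a) - int (multiplicity p b)"
proof -
  have "complex_of_int a / of_int b = of_rat (of_int a / of_int b)" by (simp add: of_rat_divide)
  then have "(THE q. complex_of_int a / of_int b = of_rat q) = of_int a / of_int b"
    by (simp only: of_rat_eq_iff) auto
  moreover obtain c d where cd: "quotient_of (of_int a / of_int b) = (c, d)" by fastforce
  ultimately have *: "pval p (of_int a / of_int b) = int (multiplicity p c) - int (multiplicity p d)"
    by (simp add: pval_def)
  have d: "d > 0" using quotient_of_denom_pos [OF cd] .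
  have "(of_int a / of_int b :: rat) = of_int c / of_int d" using quotient_of_div [OF cd] .
  then have "(of_int (a * d) :: rat) = of_int (c * b)" using ab d by (simp add: field_simps)
  then have eq: "a * d = c * b" by (simp only: of_int_eq_iff)
  then have c: "c \<noteq> 0" using ab d by auto
  have "multiplicity p a + multiplicity p d = multiplicity p c + multiplicity p b"
    using arg_cong [OF eq, of "multiplicity p"] ab c d prime_imp_prime_elem [OF p]
    by (simp add: prime_elem_multiplicity_mult_distrib)
  then show ?thesis unfolding * by simp
qed

lemma csubgroup_Rats: "csubgroup (\<rat> - {0})"
  by standard auto

lemma int_hom_pval:
  assumes p: "prime p"
  shows "int_hom (\<rat> - {0}) (pval p)"
proof (intro int_hom.intro csubgroup_Rats int_hom_axioms.intro)
  fix x y :: complex assume xy: "x \<in> \<rat> - {0}" "y \<in> \<rat> - {0}"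
  then have "x \<in> \<rat>" "y \<in> \<rat>" by auto
  obtain a b where ab: "b \<noteq> 0" "x = of_int a / of_int b"
    using \<open>x \<in> \<rat>\<close> by (rule Rats_fraction)
  obtain c d where cd: "d \<noteq> 0" "y = of_int c / of_int d"
    using \<open>y \<in> \<rat>\<close> by (rule Rats_fraction)
  have nz: "a \<noteq> 0" "c \<noteq> 0" using xy ab cd by auto
  have "pval p (x * y) = pval p (of_int (a * c) / of_int (b * d))" by (simp add: ab cd)
  also have "\<dots> = pval p x + pval p y"
    using pval_eq [OF p, of "a * c" "b * d"] pval_eq [OF p, of a b] pval_eq [OF p, of c d] nz ab cd prime_imp_prime_elem [OF p]
    by (simp add: prime_elem_multiplicity_mult_distrib)
  finally show "pval p (x * y) = pval p x + pval p y" .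
qed

text \<open>A prime occurring in the reduced fraction would divide numerator and denominator alike.
  Valuations do not see the sign, which is why \<open>q\<close> is taken positive.\<close>

lemma pval_trivial:
  fixes q :: rat
  assumes q: "q > 0" and v: "\<And>p. prime p \<Longrightarrow> pval p (of_rat q) = 0"
  shows "q = 1"
proof -
  obtain a b where ab: "quotient_of q = (a, b)" by fastforce
  have b: "b > 0" and cop: "coprime a b" and qab: "q = of_int a / of_int b"
    using quotient_of_denom_pos quotient_of_coprime quotient_of_div ab by auto
  have a: "a > 0" using q b by (simp add: qab zero_less_divide_iff)
  have m: "multiplicity p a = multiplicity p b" if "prime p" for p
    using v [OF that] pval_eq [OF that, of a b] a b by (simp add: qab of_rat_divide)
  have nodvd: "\<not> p dvd a \<and> \<not> p dvd b" if p: "prime p" for p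
  proof -
    have "p dvd a \<longleftrightarrow> p dvd b" using m [OF p] a b p
      by (metis less_irrefl not_dvd_imp_multiplicity_0 prime_multiplicity_gt_zero_iff prime_imp_prime_elem)
    then show ?thesis using cop p by (meson coprime_common_divisor not_prime_unit)
  qed
  have "is_unit a" "is_unit b" using nodvd prime_divisor_exists [of a] prime_divisor_exists [of b] a b
    by (metis less_irrefl)+
  then show ?thesis using a b by (simp add: qab)
qed

section \<open>Subgroups of the multiplicative group and the primes they involve\<close>

lemma C_units_simps [simp]:
  "carrier C_units = UNIV - {0}" "x \<otimes>\<^bsub>C_units\<^esub> y = x * y" "\<one>\<^bsub>C_units\<^esub> = 1"
  by (simp_all add: Multiplicative_Group.mult_of_def)

lemma group_C_units: "group C_units"
  using field.field_mult_group [OF field_from_type_algebra] .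

lemma C_units_inv: "x \<noteq> 0 \<Longrightarrow> inv\<^bsub>C_units\<^esub> x = inverse x"
  by (rule group.inv_equality [OF group_C_units]) auto

lemma csubgroup_of_subgroup:
  assumes "subgroup \<Gamma> C_units"
  shows "csubgroup \<Gamma>"
proof
  show "1 \<in> \<Gamma>" using subgroup.one_closed [OF assms] by simp
  show nz: "0 \<notin> \<Gamma>" using subgroup.subset [OF assms] by auto
  fix x assume "x \<in> \<Gamma>"
  then show "inverse x \<in> \<Gamma>"
    using subgroup.m_inv_closed [OF assms, of x] nz C_units_inv [of x] by (cases "x = 0") auto
  fix y assume "y \<in> \<Gamma>"
  then show "x * y \<in> \<Gamma>" using subgroup.m_closed [OF assms \<open>x \<in> \<Gamma>\<close>] by simp
qed

text \<open>The primes dividing numerator or denominator of a generator suffice: the valuation at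
  any other prime is a homomorphism vanishing on the generators. Finite generation enters
  here.\<close>

lemma finite_support:
  assumes "fin_gen_subgroup \<Gamma>" "\<Gamma> \<subseteq> \<rat> - {0}"
  shows "\<exists>P. finite P \<and> (\<forall>p\<in>P. prime p) \<and> (\<forall>p x. prime p \<longrightarrow> p \<notin> P \<longrightarrow> x \<in> \<Gamma> \<longrightarrow> pval p x = 0)"
proof -
  obtain S where S: "finite S" "\<Gamma> = generate C_units S"
    using assms(1) by (auto simp: fin_gen_subgroup_def)
  have SQ: "S \<subseteq> \<rat> - {0}" using assms(2) S(2) generate.incl [of _ S C_units] by blast
  have "\<exists>a b :: int. a \<noteq> 0 \<and> b \<noteq> 0 \<and> x = of_int a / of_int b" if "x \<in> S" for x
  proof -
    have "x \<in> \<rat>" "x \<noteq> 0" using SQ that by auto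
    obtain a b where "b \<noteq> 0" "x = of_int a / of_int b" using \<open>x \<in> \<rat>\<close> by (rule Rats_fraction)
    then show ?thesis using \<open>x \<noteq> 0\<close> by (intro exI [of _ a] exI [of _ b]) auto
  qed
  then obtain a b :: "complex \<Rightarrow> int" where
    ab: "\<And>x. x \<in> S \<Longrightarrow> a x \<noteq> 0 \<and> b x \<noteq> 0 \<and> x = of_int (a x) / of_int (b x)"
    by metis
  define P where "P = (\<Union>x\<in>S. prime_factors (a x) \<union> prime_factors (b x))"
  have "pval p x = 0" if p: "prime p" "p \<notin> P" and x: "x \<in> \<Gamma>" for p x
  proof -
    interpret int_hom "\<rat> - {0}" "pval p" by (rule int_hom_pval [OF p(1)])
    have "x \<in> \<rat> - {0} \<and> pval p x = 0" using x unfolding S(2)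
    proof (induction rule: generate.induct)
      case one
      then show ?case using v_one by simp
    next
      case (incl h)
      then have "\<not> p dvd a h" "\<not> p dvd b h"
        using p ab [of h] by (auto simp: P_def in_prime_factors_iff)
      then show ?case using ab [OF incl] pval_eq [OF p(1), of "a h" "b h"] incl SQ
        by (auto simp: not_dvd_imp_multiplicity_0)
    next
      case (inv h)
      then have "\<not> p dvd a h" "\<not> p dvd b h"
        using p ab [of h] by (auto simp: P_def in_prime_factors_iff)
      then have "pval p h = 0" using ab [OF inv] pval_eq [OF p(1), of "a h" "b h"]
        by (auto simp: not_dvd_imp_multiplicity_0)
      moreover have "h \<in> \<rat> - {0}" using inv SQ by auto
      ultimately show ?case using C_units_inv [of h] inverse [of h] v_inverse [of h] by auto
    next
      case (eng h1 h2)
      then show ?case using add [of h1 h2] by auto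
    qed
    then show ?thesis by simp
  qed
  moreover have "finite P" using S(1) by (simp add: P_def)
  moreover have "\<forall>p\<in>P. prime p" by (auto simp: P_def)
  ultimately show ?thesis by blast
qed

section \<open>Radicals of a group of rational numbers\<close>

lemma of_real_of_rat: "complex_of_real (of_rat q) = of_rat q"
  by (cases q) (simp add: of_rat_rat)

lemma Rats_of_real_cmod_sq:
  assumes "x \<in> \<rat>"
  shows "complex_of_real (cmod x) ^ 2 = x ^ 2"
proof -
  obtain q where "x = of_rat q" using assms by (rule Rats_cases)
  then obtain t where "x = complex_of_real t" by (metis of_real_of_rat)
  then show ?thesis by (simp flip: of_real_power)
qed

section \<open>The group of roots of unity and its automorphisms\<close>

lemma mu_infI: "n \<ge> 1 \<Longrightarrow> z ^ n = 1 \<Longrightarrow> z \<in> mu_inf"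
  by (auto simp: mu_inf_def)

lemma mu_infE:
  assumes "z \<in> mu_inf"
  obtains n :: nat where "n \<ge> 1" "z ^ n = 1"
  using assms by (auto simp: mu_inf_def)

lemma csubgroup_mu_inf: "csubgroup mu_inf"
proof
  show "1 \<in> mu_inf" by (rule mu_infI [of 1]) auto
  show "0 \<notin> mu_inf" by (auto simp: mu_inf_def zero_power)
  fix x assume "x \<in> mu_inf"
  then obtain n :: nat where n: "n \<ge> 1" "x ^ n = 1" by (rule mu_infE)
  then show "inverse x \<in> mu_inf" by (intro mu_infI [of n]) (auto simp: power_inverse)
  fix y assume "y \<in> mu_inf"
  then obtain m :: nat where m: "m \<ge> 1" "y ^ m = 1" by (rule mu_infE)
  have "(x * y) ^ (n * m) = (x ^ n) ^ m * (y ^ m) ^ n"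
    by (simp add: power_mult_distrib power_mult [symmetric] mult.commute)
  then show "x * y \<in> mu_inf" using n m by (intro mu_infI [of "n * m"]) auto
qed

lemma Q_adjoin_mu_inf: "Q_adjoin mu_inf = Q_unity"
proof
  show "Q_adjoin mu_inf \<subseteq> Q_unity"
    by (rule Q_adjoin_least [OF QU.csubfield_axioms]) (auto simp: mu_inf_def intro: QU.unity)
  interpret Q: csubfield "Q_adjoin mu_inf" by (rule csubfield_Q_adjoin)
  show "Q_unity \<subseteq> Q_adjoin mu_inf"
    unfolding Q_unity_def
  proof (intro UN_least Q.Rats_adjoin_subset)
    fix n :: nat assume "n \<in> {1..}"
    then have "zeta n \<in> mu_inf" by (intro mu_infI [of n]) auto
    then show "zeta n \<in> Q_adjoin mu_inf" using Q_adjoin_incl by blast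
  qed
qed

lemma common_denominator:
  fixes c :: "'a \<Rightarrow> complex"
  assumes "finite A" "\<And>x. x \<in> A \<Longrightarrow> c x \<in> \<rat>"
  shows "\<exists>d m. d \<noteq> 0 \<and> (\<forall>x\<in>A. c x = of_int (m x) / of_int d)"
  using assms
proof (induction A rule: finite_induct)
  case empty
  show ?case by (intro exI [of _ 1]) auto
next
  case (insert a A)
  then obtain d m where d: "d \<noteq> 0" "\<And>x. x \<in> A \<Longrightarrow> c x = of_int (m x) / of_int d" by auto
  have "c a \<in> \<rat>" using insert by simp
  then obtain p q where pq: "q \<noteq> 0" "c a = of_int p / of_int q" by (rule Rats_fraction)
  have "c x = of_int (if x = a then p * d else m x * q) / of_int (d * q)" if "x \<in> insert a A" for x
    using that d pq by (auto simp: field_simps)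
  then show ?case using d pq
    by (intro exI [of _ "d * q"] exI [of _ "\<lambda>x. if x = a then p * d else m x * q"]) auto
qed

lemma finite_mu_inf_exponent:
  assumes "finite A" "A \<subseteq> mu_inf"
  shows "\<exists>N\<ge>1. \<forall>x\<in>A. x ^ N = 1"
  using assms
proof (induction A rule: finite_induct)
  case (insert a A)
  then obtain N where N: "N \<ge> 1" "\<forall>x\<in>A. x ^ N = 1" by auto
  have "a \<in> mu_inf" using insert by simp
  then obtain n :: nat where n: "n \<ge> 1" "a ^ n = 1" by (rule mu_infE)
  have "x ^ (N * n) = 1" if "x \<in> insert a A" for x
    using that N n by (auto simp: power_mult) (metis mult.commute power_mult power_one)
  then show ?case using N n by (intro exI [of _ "N * n"]) auto
qed auto

text \<open>On the N-th roots of unity an automorphism is a power map z to z^a with a prime to N. A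
  rational relation amounts to an integer polynomial vanishing at z, which
  \<open>cyclotomic_conjugate\<close> carries to z^a; an inverse exponent modulo N carries it
  back.\<close>

lemma mu_inf_relation_iff:
  assumes bij: "bij_betw \<beta> mu_inf mu_inf"
    and hom: "\<And>x y. x \<in> mu_inf \<Longrightarrow> y \<in> mu_inf \<Longrightarrow> \<beta> (x * y) = \<beta> x * \<beta> y"
    and A: "finite A" "A \<subseteq> mu_inf" and c: "\<And>x. c x \<in> \<rat>"
  shows "(\<Sum>x\<in>A. c x * x) = 0 \<longleftrightarrow> (\<Sum>x\<in>A. c x * \<beta> x) = 0"
proof -
  interpret M: csubgroup mu_inf by (rule csubgroup_mu_inf)
  have \<beta>M: "\<beta> x \<in> mu_inf" if "x \<in> mu_inf" for x using bij that by (auto simp: bij_betw_def)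
  have "\<beta> 1 * \<beta> 1 = \<beta> 1" using hom [OF M.one M.one] by simp
  then have \<beta>1: "\<beta> 1 = 1" using \<beta>M [OF M.one] M.nz by (metis mult_cancel_left2)
  have \<beta>pow: "\<beta> (x ^ n) = \<beta> x ^ n" if "x \<in> mu_inf" for x n
    by (induction n) (use that \<beta>1 hom M.power in auto)
  obtain N where N: "N \<ge> 1" "\<forall>x\<in>A. x ^ N = 1" using finite_mu_inf_exponent [OF A] by blast
  define z where "z = zeta N"
  have zN: "z ^ N = 1" using N by (simp add: z_def)
  have zM: "z \<in> mu_inf" using mu_infI [OF N(1) zN] .
  have "\<beta> z ^ N = 1" using \<beta>pow [OF zM, of N] zN \<beta>1 by simp
  then obtain a where a: "a < N" "\<beta> z = z ^ a" using unity_zeta [OF N(1)] unfolding z_def by blast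
  have cop: "coprime a N"
  proof (rule coprime_if_primitive [OF N(1) zN])
    fix M :: nat assume M: "1 \<le> M" "M < N"
    show "(z ^ a) ^ M \<noteq> 1"
    proof
      assume "(z ^ a) ^ M = 1"
      then have "\<beta> (z ^ M) = \<beta> 1" using \<beta>pow [OF zM] a \<beta>1 by simp
      then have "z ^ M = z ^ 0" using bij M.power [OF zM] by (simp add: bij_betw_def inj_on_def)
      then show False using zeta_power_inj [of N M 0] M unfolding z_def by auto
    qed
  qed
  \<comment> \<open>For \<open>N = 1\<close> the exponent \<open>a\<close> is 0 and satisfies no
    relation a a' = N q + 1 in natural numbers; there \<open>z = 1\<close> and any \<open>a'\<close>
    serves.\<close>
  have "\<exists>a'. coprime a' N \<and> (z ^ a) ^ a' = z"
  proof (cases "N = 1")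
    case True
    then show ?thesis using zN by simp
  next
    case False
    then obtain a' q where aq: "a * a' = N * q + 1" using coprime_bezout_strong [OF cop] by blast
    have "coprime a' N"
    proof (rule coprimeI)
      fix c assume "c dvd a'" "c dvd N"
      then have "c dvd N * q + 1" "c dvd N * q" unfolding aq [symmetric] by auto
      then show "is_unit c" by (metis dvd_add_right_iff)
    qed
    moreover have "(z ^ a) ^ a' = z" unfolding power_mult [symmetric] aq using zN by (simp add: power_mult)
    ultimately show ?thesis by blast
  qed
  then obtain a' where cop': "coprime a' N" and za: "(z ^ a) ^ a' = z" by blast
  have "\<exists>k. x = z ^ k" if "x \<in> A" for x
  proof -
    have "x ^ N = 1" using N that by blast
    then obtain k where "x = zeta N ^ k" by (rule unity_zeta [OF N(1)])
    then show ?thesis unfolding z_def by blast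
  qed
  then obtain k where k: "\<And>x. x \<in> A \<Longrightarrow> x = z ^ k x" by metis
  obtain d m where d: "d \<noteq> 0" "\<And>x. x \<in> A \<Longrightarrow> c x = of_int (m x) / of_int d"
    using common_denominator [OF A(1), of c] c by metis
  define h where "h = (\<Sum>x\<in>A. monom (m x) (k x))"
  have "(\<Sum>x\<in>A. c x * x) = ipoly h z / of_int d"
    unfolding h_def ipoly_sum sum_divide_distrib
    by (intro sum.cong refl) (auto simp: d(2) simp flip: k)
  moreover have "(\<Sum>x\<in>A. c x * \<beta> x) = ipoly h (z ^ a) / of_int d"
    unfolding h_def ipoly_sum sum_divide_distrib
  proof (intro sum.cong refl)
    fix x assume x: "x \<in> A"
    have "\<beta> x = \<beta> (z ^ k x)" using k [OF x] by simp
    also have "\<dots> = (z ^ a) ^ k x" using \<beta>pow [OF zM] a by simp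
    finally show "c x * \<beta> x = ipoly (monom (m x) (k x)) (z ^ a) / of_int d"
      using d(2) [OF x] by simp
  qed
  moreover have "ipoly h z = 0 \<longleftrightarrow> ipoly h (z ^ a) = 0"
  proof
    assume "ipoly h z = 0"
    then show "ipoly h (z ^ a) = 0" by (rule cyclotomic_conjugate [OF N(1) zN cop])
  next
    assume "ipoly h (z ^ a) = 0"
    moreover have "(z ^ a) ^ N = 1" using zN by (metis mult.commute power_mult power_one)
    ultimately have "ipoly h ((z ^ a) ^ a') = 0"
      using cyclotomic_conjugate [OF N(1) _ cop'] by blast
    then show "ipoly h z = 0" by (simp only: za)
  qed
  ultimately show ?thesis using d by simp
qed

text \<open>The surjectivity half of the isomorphism between the Galois group and the automorphisms
  of the roots of unity; it provides the preimage that \<open>sigma_of\<close> selects.\<close>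

lemma mu_inf_automorphism:
  assumes bij: "bij_betw \<beta> mu_inf mu_inf"
    and hom: "\<And>x y. x \<in> mu_inf \<Longrightarrow> y \<in> mu_inf \<Longrightarrow> \<beta> (x * y) = \<beta> x * \<beta> y"
  shows "\<exists>s\<in>carrier (Gal_Q (Q_adjoin mu_inf)). \<forall>x\<in>mu_inf. s x = \<beta> x"
proof (rule extend_to_field_automorphism)
  interpret M: csubgroup mu_inf by (rule csubgroup_mu_inf)
  show "1 \<in> mu_inf" "0 \<notin> mu_inf" using M.nonzero by auto
  show "\<And>x y. x \<in> mu_inf \<Longrightarrow> y \<in> mu_inf \<Longrightarrow> x * y \<in> mu_inf \<and> \<beta> (x * y) = \<beta> x * \<beta> y"
    using hom by auto
  show "\<beta> ` mu_inf = mu_inf" using bij by (simp add: bij_betw_def)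
qed (rule mu_inf_relation_iff [OF bij hom])

lemma pos_sqrt_props:
  assumes "b \<in> of_rat ` {q. q > 0}"
  shows "pos_sqrt b ^ 2 = b" "pos_sqrt b \<noteq> 0" "pos_sqrt b \<in> Q_unity"
    "\<exists>t>0. pos_sqrt b = complex_of_real t"
proof -
  obtain q where q: "b = of_rat q" "q > 0" using assms by auto
  have b: "b = complex_of_real (of_rat q)" using q(1) by (simp add: of_real_of_rat)
  have re: "Re b = of_rat q" by (simp add: b)
  have pos: "(of_rat q :: real) > 0" using q by simp
  show "pos_sqrt b ^ 2 = b"
    unfolding pos_sqrt_def re using pos b by (simp flip: of_real_power)
  show "pos_sqrt b \<noteq> 0" unfolding pos_sqrt_def re using pos by simp
  show "pos_sqrt b \<in> Q_unity" unfolding pos_sqrt_def re using QU.sqrt_rat [of q] q by simp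
  show "\<exists>t>0. pos_sqrt b = complex_of_real t"
    unfolding pos_sqrt_def re using pos by (intro exI [of _ "sqrt (of_rat q)"]) simp
qed

lemma pos_sqrt_of_real_square: "t \<ge> 0 \<Longrightarrow> pos_sqrt (complex_of_real t ^ 2) = complex_of_real t"
  by (simp add: pos_sqrt_def flip: of_real_power)

section \<open>The group of radicals and its positive rational part\<close>

locale rational_group =
  fixes \<Gamma> :: "complex set"
  assumes sub: "subgroup \<Gamma> C_units" and rat: "\<Gamma> \<subseteq> \<rat> - {0}" and fg: "fin_gen_subgroup \<Gamma>"
begin

sublocale G: csubgroup \<Gamma>
  by (rule csubgroup_of_subgroup [OF sub])

abbreviation "H \<equiv> Gamma_inf \<Gamma>"
abbreviation "D \<equiv> Gamma_0_pos \<Gamma>"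

lemma H_iff: "x \<in> H \<longleftrightarrow> (\<exists>n\<ge>1. x ^ n \<in> \<Gamma>)"
  using G.nonzero by (auto simp: Gamma_inf_def zero_power)

lemma D_iff: "x \<in> D \<longleftrightarrow> x \<in> H \<and> x \<in> of_rat ` {q. q > 0}"
  by (auto simp: Gamma_0_pos_def Gamma_0_def)

sublocale H: csubgroup H
proof
  show "1 \<in> H" unfolding H_iff by (intro exI [of _ 1]) auto
  show "0 \<notin> H" by (simp add: Gamma_inf_def)
  fix x assume "x \<in> H"
  then obtain n where n: "n \<ge> 1" "x ^ n \<in> \<Gamma>" by (auto simp: H_iff)
  then show "inverse x \<in> H" unfolding H_iff
    by (intro exI [of _ n]) (auto simp: power_inverse)
  fix y assume "y \<in> H"
  then obtain m where m: "m \<ge> 1" "y ^ m \<in> \<Gamma>" by (auto simp: H_iff)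
  have "(x * y) ^ (n * m) = (x ^ n) ^ m * (y ^ m) ^ n"
    by (simp add: power_mult_distrib power_mult [symmetric] mult.commute)
  moreover have "\<dots> \<in> \<Gamma>" by (rule G.mult [OF G.power [OF n(2)] G.power [OF m(2)]])
  ultimately show "x * y \<in> H" using n m unfolding H_iff by (intro exI [of _ "n * m"]) auto
qed

lemma H_root: "x ^ n \<in> H \<Longrightarrow> n \<ge> 1 \<Longrightarrow> x \<in> H"
proof -
  assume n: "x ^ n \<in> H" "n \<ge> 1"
  then obtain m where m: "m \<ge> 1" "(x ^ n) ^ m \<in> \<Gamma>" by (auto simp: H_iff)
  then show "x \<in> H" using n unfolding H_iff by (intro exI [of _ "n * m"]) (auto simp: power_mult)
qed

sublocale D: csubgroup D
proof
  show "1 \<in> D" unfolding D_iff by (auto intro!: image_eqI [of _ _ 1])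
  show "0 \<notin> D" unfolding D_iff using H.nonzero by auto
  fix x assume x: "x \<in> D"
  then obtain q where q: "x = of_rat q" "q > 0" by (auto simp: D_iff)
  then show "inverse x \<in> D" using x unfolding D_iff
    by (auto intro!: image_eqI [of _ _ "inverse q"] simp: of_rat_inverse)
  fix y assume y: "y \<in> D"
  then obtain p where p: "y = of_rat p" "p > 0" by (auto simp: D_iff)
  then show "x * y \<in> D" using x y q unfolding D_iff
    by (auto intro!: image_eqI [of _ _ "q * p"] simp: of_rat_mult)
qed

lemma D_H: "D \<subseteq> H" by (auto simp: D_iff)

lemma D_Rats: "D \<subseteq> \<rat> - {0}" using D.nonzero by (auto simp: D_iff)

lemma D_Gamma_0: "D \<subseteq> Gamma_0 \<Gamma>" by (auto simp: Gamma_0_pos_def)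

lemma Gamma_0_H: "Gamma_0 \<Gamma> \<subseteq> H" by (auto simp: Gamma_0_def)

lemma mu_H: "mu_inf \<subseteq> H"
proof
  fix x assume "x \<in> mu_inf"
  then obtain n :: nat where "n \<ge> 1" "x ^ n = 1" by (rule mu_infE)
  then show "x \<in> H" unfolding H_iff by (intro exI [of _ n]) simp
qed

lemma sign_Gamma_0: "e \<in> {1, -1} \<Longrightarrow> e \<in> Gamma_0 \<Gamma>"
proof -
  assume e: "e \<in> {1, -1}"
  then have "e ^ 2 = 1" by auto
  then have "e \<in> mu_inf" by (intro mu_infI [of 2]) auto
  then show ?thesis using e mu_H by (auto simp: Gamma_0_def)
qed

lemma D_posI: "x \<in> H \<Longrightarrow> x \<in> \<rat> \<Longrightarrow> x = complex_of_real t \<Longrightarrow> t > 0 \<Longrightarrow> x \<in> D"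
proof -
  assume x: "x \<in> H" "x \<in> \<rat>" and t: "x = complex_of_real t" "t > 0"
  obtain q where q: "x = of_rat q" using x(2) by (rule Rats_cases)
  have "complex_of_real (of_rat q) = complex_of_real t" using q t by (simp add: of_real_of_rat)
  then have "of_rat q = t" by (simp only: of_real_eq_iff)
  then have "q > 0" using t by (metis zero_less_of_rat_iff)
  then show "x \<in> D" using x q by (auto simp: D_iff)
qed

text \<open>Polar decomposition inside \<open>H\<close>: some power of \<open>x\<close> is rational,
  and its square equals the corresponding power of the modulus. The exponent is doubled because the
  rational power may be negative.\<close>

lemma modulus_power:
  assumes "x \<in> H"
  obtains n where "n \<ge> 1" "complex_of_real (cmod x) ^ n \<in> D"
    "(x / complex_of_real (cmod x)) ^ n = 1"
proof -
  obtain m where m: "m \<ge> 1" "x ^ m \<in> \<Gamma>" using assms by (auto simp: H_iff)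
  have x0: "x \<noteq> 0" using H.nz assms .
  have "x ^ m \<in> \<rat>" using m rat by auto
  from Rats_of_real_cmod_sq [OF this]
  have eq: "complex_of_real (cmod x) ^ (m * 2) = x ^ (m * 2)"
    by (simp add: norm_power power_mult)
  have "complex_of_real (cmod x) ^ (m * 2) \<in> D"
  proof (rule D_posI)
    show "complex_of_real (cmod x) ^ (m * 2) \<in> H" unfolding eq using assms by (rule H.power)
    have "x ^ (m * 2) \<in> \<rat>" using Rats_power [OF \<open>x ^ m \<in> \<rat>\<close>, of 2] by (simp only: power_mult)
    then show "complex_of_real (cmod x) ^ (m * 2) \<in> \<rat>" unfolding eq .
    show "complex_of_real (cmod x) ^ (m * 2) = complex_of_real (cmod x ^ (m * 2))" by simp
    show "0 < cmod x ^ (m * 2)" using x0 by simp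
  qed
  moreover have "(x / complex_of_real (cmod x)) ^ (m * 2) = 1"
    using x0 by (simp add: power_divide flip: eq)
  ultimately show thesis using that [of "m * 2"] m by simp
qed

text \<open>The phase of \<open>x\<close> is a root of unity, so the modulus lies in the cyclotomic
  field too; the square of the modulus is rational by \<open>real_radical_in_Q_unity\<close> and
  serves as \<open>b\<close>.\<close>

lemma radical_in_Q_unity:
  assumes "x \<in> H" "x \<in> Q_unity"
  obtains w b where "w \<in> mu_inf" "b \<in> D" "x = w * pos_sqrt b"
proof -
  define t where "t = cmod x"
  obtain n where n: "n \<ge> 1" "complex_of_real t ^ n \<in> D" "(x / complex_of_real t) ^ n = 1"
    using modulus_power [OF assms(1)] unfolding t_def by metis
  have t: "t > 0" using H.nz [OF assms(1)] by (simp add: t_def)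
  have w: "x / complex_of_real t \<in> mu_inf" using mu_infI n by blast
  have "x / (x / complex_of_real t) \<in> Q_unity"
    using assms(2) QU.unity [OF n(1,3)] by (rule QU.divide)
  then have tK: "complex_of_real t \<in> Q_unity" using H.nz [OF assms(1)] by simp
  have "complex_of_real t ^ n \<in> \<rat>" using n(2) D_Rats by auto
  then have "complex_of_real t ^ 2 \<in> \<rat>" by (rule real_radical_in_Q_unity [OF t tK n(1)])
  moreover have "complex_of_real t \<in> H" using H_root n D_H by blast
  then have "complex_of_real t ^ 2 \<in> H" by (rule H.power)
  ultimately have "complex_of_real t ^ 2 \<in> D" using D_posI [of _ "t ^ 2"] t by simp
  moreover have "x = (x / complex_of_real t) * pos_sqrt (complex_of_real t ^ 2)"
    using t by (simp add: pos_sqrt_of_real_square)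
  ultimately show thesis using that w by blast
qed

text \<open>Although \<open>D\<close> arises by taking roots, it involves no more primes than
  \<Gamma>: a power of each element lies in \<Gamma>, and the integers have no torsion. Unique
  factorisation then makes the valuations at these primes separate \<open>D\<close>.\<close>

lemma basis_exists:
  "\<exists>B\<subseteq>D. finite B \<and> mult_independent B \<and> (\<forall>x\<in>D. \<exists>k :: complex \<Rightarrow> int. x = (\<Prod>b\<in>B. b powi k b))"
proof -
  obtain P where P: "finite P" "\<forall>p\<in>P. prime p"
    "\<And>p x. prime p \<Longrightarrow> p \<notin> P \<Longrightarrow> x \<in> \<Gamma> \<Longrightarrow> pval p x = 0"
    using finite_support [OF fg rat] by blast
  show ?thesis
  proof (rule finite_basis [of "pval ` P"])
    show "finite (pval ` P)" using P by simp
    show "csubgroup D" by (rule D.csubgroup_axioms)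
    have hom: "int_hom D (pval p)" if "prime p" for p
      using int_hom_pval [OF that] D.csubgroup_axioms D_Rats
      by (auto simp: int_hom_def int_hom_axioms_def)
    then show "\<And>v. v \<in> pval ` P \<Longrightarrow> int_hom D v" using P by auto
    fix x assume x: "x \<in> D" "\<And>v. v \<in> pval ` P \<Longrightarrow> v x = 0"
    obtain q where q: "x = of_rat q" "q > 0" using x by (auto simp: D_iff)
    have "pval p (of_rat q) = 0" if p: "prime p" for p
    proof (cases "p \<in> P")
      case True
      then show ?thesis using x q by auto
    next
      case False
      interpret int_hom D "pval p" by (rule hom [OF p])
      have "x \<in> H" using x D_H by blast
      then obtain n where n: "n \<ge> 1" "x ^ n \<in> \<Gamma>" by (auto simp: H_iff)
      then have "int n * pval p x = 0" using v_power [OF x(1), of n] P(3) [OF p False] by simp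
      then show ?thesis using n q by simp
    qed
    then show "x = 1" using pval_trivial q by simp
  qed
qed

end

lemma (in csubfield) hom_sum:
  assumes f: "field_hom_on K f" and g: "\<And>i. i \<in> I \<Longrightarrow> g i \<in> K"
  shows "f (sum g I) = (\<Sum>i\<in>I. f (g i))"
  using g
proof (induction I rule: infinite_finite_induct)
  case (insert i I)
  then have "f (g i + sum g I) = f (g i) + f (sum g I)"
    using f sum [of I g] unfolding field_hom_on_def by blast
  then show ?case using insert by simp
qed (simp_all add: hom_props(1) [OF f])

lemma prod_powi_add:
  assumes "\<And>b. b \<in> B \<Longrightarrow> b \<noteq> (0::complex)"
  shows "(\<Prod>b\<in>B. b powi (k b + l b)) = (\<Prod>b\<in>B. b powi k b) * (\<Prod>b\<in>B. b powi l b)"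
  unfolding prod.distrib [symmetric]
  by (intro prod.cong refl) (use assms in \<open>auto simp: power_int_add\<close>)

lemma independent_unique:
  assumes B: "mult_independent B" "\<And>b. b \<in> B \<Longrightarrow> b \<noteq> 0"
    and eq: "(\<Prod>b\<in>B. b powi k b) = (\<Prod>b\<in>B. b powi l b)" and b: "b \<in> B"
  shows "k b = l b"
proof -
  have "(\<Prod>b\<in>B. b powi (k b + - l b)) * (\<Prod>b\<in>B. b powi l b) = (\<Prod>b\<in>B. b powi (k b + - l b + l b))"
    by (rule prod_powi_add [symmetric]) (rule B)
  also have "\<dots> = 1 * (\<Prod>b\<in>B. b powi l b)" using eq by simp
  finally have "(\<Prod>b\<in>B. b powi (k b + - l b)) = 1"
    using B(2) by (cases "finite B") auto
  then have "k b + - l b = 0"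
    using B(1) [unfolded mult_independent_def, THEN spec, of "\<lambda>b. k b + - l b"] b by simp
  then show ?thesis by simp
qed

section \<open>Rank and bases of the positive rational part\<close>

context rational_group
begin

text \<open>Raising to powers compares the ranks both ways: suitable powers of a basis of
  \<open>D\<close> are independent in \<Gamma>, and the squares of an independent set in \<Gamma>
  lie in \<open>D\<close>, where elimination bounds their number.\<close>

lemma card_basis:
  assumes B: "B \<subseteq> D" "finite B" "mult_independent B"
    and gen: "\<And>x. x \<in> D \<Longrightarrow> \<exists>k :: complex \<Rightarrow> int. x = (\<Prod>b\<in>B. b powi k b)"
    and r: "has_rank \<Gamma> r"
  shows "card B = r"
proof (rule antisym)
  have B0: "b \<noteq> 0" if "b \<in> B" for b using that B D.nz by blast
  have "\<exists>n::nat\<ge>1. b ^ n \<in> \<Gamma>" if "b \<in> B" for b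
  proof -
    have "b \<in> H" using that B D_H by blast
    then show ?thesis by (auto simp: H_iff)
  qed
  then obtain n :: "complex \<Rightarrow> nat" where n: "\<And>b. b \<in> B \<Longrightarrow> n b \<ge> 1" "\<And>b. b \<in> B \<Longrightarrow> b ^ n b \<in> \<Gamma>"
    by metis
  define f where "f b = b ^ n b" for b
  have inj: "inj_on f B"
  proof (rule inj_onI, rule ccontr)
    fix a b assume ab: "a \<in> B" "b \<in> B" "f a = f b" "a \<noteq> b"
    have single: "(\<Prod>x\<in>B. x powi (if x = y then int (n y) else 0)) = f y" if "y \<in> B" for y
    proof -
      have "(\<Prod>x\<in>B. x powi (if x = y then int (n y) else 0)) = (\<Prod>x\<in>B. if x = y then f y else 1)"
        by (intro prod.cong) (auto simp: f_def)
      then show ?thesis using B that by simp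
    qed
    have "(if a = a then int (n a) else 0) = (if a = b then int (n b) else 0)"
      by (rule independent_unique [OF B(3) B0 _ ab(1)]) (simp_all only: single ab)
    then show False using ab n(1) [of a] by simp
  qed
  have "mult_independent (f ` B)"
    unfolding mult_independent_def
  proof (intro allI impI ballI)
    fix c :: "complex \<Rightarrow> int" and y
    assume one: "(\<Prod>x\<in>f ` B. x powi c x) = 1" and "y \<in> f ` B"
    then obtain b where b: "b \<in> B" "y = f b" by blast
    have "(\<Prod>x\<in>f ` B. x powi c x) = (\<Prod>b\<in>B. f b powi c (f b))"
      by (simp add: prod.reindex [OF inj])
    also have "\<dots> = (\<Prod>b\<in>B. b powi (int (n b) * c (f b)))"
      by (simp add: f_def power_int_mult)
    finally have "(\<Prod>x\<in>f ` B. x powi c x) = (\<Prod>b\<in>B. b powi (int (n b) * c (f b)))" .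
    then have "\<forall>b\<in>B. int (n b) * c (f b) = 0"
      using one B(3) unfolding mult_independent_def by metis
    then show "c y = 0" using b n(1) [of b] by auto
  qed
  moreover have "f ` B \<subseteq> \<Gamma>" using n by (auto simp: f_def)
  ultimately have "card (f ` B) \<le> r" using r B(2) by (auto simp: has_rank_def)
  then show "card B \<le> r" by (simp add: card_image [OF inj])
  obtain E where E: "E \<subseteq> \<Gamma>" "finite E" "mult_independent E" "card E = r"
    using r by (auto simp: has_rank_def)
  show "r \<le> card B"
  proof (rule ccontr)
    assume "\<not> r \<le> card B"
    then have lt: "card B < card E" using E by simp
    have ED: "x ^ 2 \<in> D" and E0: "x \<noteq> 0" if x: "x \<in> E" for x
    proof -
      have xQ: "x \<in> \<rat>" "x \<in> \<Gamma>" "x \<noteq> 0" using x E rat by auto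
      then show "x \<noteq> 0" by simp
      have "x \<in> H" unfolding H_iff using xQ by (intro exI [of _ 1]) simp
      then have "x ^ 2 \<in> H" by (rule H.power)
      moreover have "x ^ 2 \<in> \<rat>" using xQ by simp
      moreover have "x ^ 2 = complex_of_real (cmod x ^ 2)"
        using Rats_of_real_cmod_sq [OF xQ(1)] by simp
      ultimately show "x ^ 2 \<in> D" by (rule D_posI) (use xQ in simp)
    qed
    define k :: "complex \<Rightarrow> complex \<Rightarrow> int"
      where "k x = (SOME l. x ^ 2 = (\<Prod>b\<in>B. b powi l b))" for x
    have k: "x ^ 2 = (\<Prod>b\<in>B. b powi k x b)" if "x \<in> E" for x
      unfolding k_def by (rule someI_ex [OF gen [OF ED [OF that]]])
    obtain c where c: "\<exists>x\<in>E. c x \<noteq> 0" "\<And>b. b \<in> B \<Longrightarrow> (\<Sum>x\<in>E. c x * k x b) = 0"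
      using integer_relation [OF B(2) E(2) lt, of k] by blast
    have powi_sum: "(\<Prod>x\<in>E. b powi (g x)) = b powi (\<Sum>x\<in>E. g x)" if "b \<in> B" for b and g :: "complex \<Rightarrow> int"
      using E(2) by (induction E rule: finite_induct) (use B0 [OF that] in \<open>auto simp: power_int_add\<close>)
    have powi_prod: "(\<Prod>b\<in>B. g b) powi j = (\<Prod>b\<in>B. g b powi j)" for g :: "complex \<Rightarrow> complex" and j
      using B(2) by (induction B rule: finite_induct) (auto simp: power_int_mult_distrib)
    \<comment> \<open>The coordinates \<open>k x\<close> describe the square of \<open>x\<close>,
      hence the doubled exponents.\<close>
    have "(\<Prod>x\<in>E. x powi (2 * c x)) = (\<Prod>x\<in>E. (\<Prod>b\<in>B. b powi k x b) powi c x)"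
      by (intro prod.cong refl) (simp add: power_int_mult flip: k)
    also have "\<dots> = (\<Prod>x\<in>E. \<Prod>b\<in>B. b powi (c x * k x b))"
      by (simp add: powi_prod mult.commute flip: power_int_mult)
    also have "\<dots> = (\<Prod>b\<in>B. \<Prod>x\<in>E. b powi (c x * k x b))"
      by (rule prod.swap)
    also have "\<dots> = 1" by (simp add: powi_sum c(2))
    finally have "\<forall>x\<in>E. 2 * c x = 0" using E(3) unfolding mult_independent_def by metis
    then show False using c(1) by auto
  qed
qed

text \<open>Summing the coordinates with index in \<open>S\<close> gives the homomorphism. Its
  values supply the exponents from which \<open>dual_automorphism\<close> produces prescribed signs
  on the basis.\<close>

lemma dual_hom:
  assumes B: "B \<subseteq> D" "finite B" "mult_independent B"
    and gen: "\<And>x. x \<in> D \<Longrightarrow> \<exists>k :: complex \<Rightarrow> int. x = (\<Prod>b\<in>B. b powi k b)"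
    and S: "S \<subseteq> B"
  shows "\<exists>v. int_hom D v \<and> (\<forall>b\<in>B. v b = (if b \<in> S then 1 else 0))"
proof -
  have B0: "b \<noteq> 0" if "b \<in> B" for b using that B D.nz by blast
  define k :: "complex \<Rightarrow> complex \<Rightarrow> int"
    where "k x = (SOME l. x = (\<Prod>b\<in>B. b powi l b))" for x
  have k: "x = (\<Prod>b\<in>B. b powi k x b)" if "x \<in> D" for x
    unfolding k_def by (rule someI_ex [OF gen [OF that]])
  define v where "v x = (\<Sum>b\<in>S. k x b)" for x
  have "int_hom D v"
  proof (intro int_hom.intro D.csubgroup_axioms int_hom_axioms.intro)
    fix x y assume xy: "x \<in> D" "y \<in> D"
    have "(\<Prod>b\<in>B. b powi k (x * y) b) = (\<Prod>b\<in>B. b powi (k x b + k y b))"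
      using k [OF xy(1)] k [OF xy(2)] k [OF D.mult [OF xy]] prod_powi_add [OF B0, of B "k x" "k y"]
      by simp
    then have "k (x * y) b = k x b + k y b" if "b \<in> B" for b
      using independent_unique [OF B(3) B0, of "k (x * y)" "\<lambda>b. k x b + k y b"] that by blast
    then show "v (x * y) = v x + v y" using S unfolding v_def sum.distrib [symmetric]
      by (intro sum.cong) auto
  qed
  moreover have "v a = (if a \<in> S then 1 else 0)" if a: "a \<in> B" for a
  proof -
    have "(\<Prod>b\<in>B. b powi k a b) = (\<Prod>b\<in>B. b powi (if b = a then 1 else 0))"
    proof -
      have "(\<Prod>b\<in>B. b powi (if b = a then 1 else 0)) = (\<Prod>b\<in>B. if b = a then b else 1)"
        by (intro prod.cong) auto
      then show ?thesis using B a k [of a] by auto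
    qed
    then have "k a b = (if b = a then 1 else 0)" if "b \<in> B" for b
      using independent_unique [OF B(3) B0, of "k a" "\<lambda>b. if b = a then 1 else 0"] that by blast
    then have "v a = (\<Sum>b\<in>S. if b = a then 1 else 0)"
      unfolding v_def using S by (intro sum.cong) auto
    moreover have "finite S" using S B(2) by (rule finite_subset)
    ultimately show ?thesis by simp
  qed
  ultimately show ?thesis by blast
qed

lemma basis_mod_squares:
  assumes B: "B \<subseteq> D" "finite B"
    and gen: "\<And>x. x \<in> D \<Longrightarrow> \<exists>k :: complex \<Rightarrow> int. x = (\<Prod>b\<in>B. b powi k b)"
    and x: "x \<in> D"
  shows "\<exists>S\<subseteq>B. \<exists>y\<in>D. x = (\<Prod>b\<in>S. b) * y ^ 2"
proof -
  obtain k :: "complex \<Rightarrow> int" where k: "x = (\<Prod>b\<in>B. b powi k b)" using gen [OF x] by blast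
  \<comment> \<open>Each exponent splits into its residue modulo 2 and an even part; the residues
    form the product over \<open>S\<close>, the even parts the square.\<close>
  define S where "S = {b \<in> B. odd (k b)}"
  define y where "y = (\<Prod>b\<in>B. b powi (k b div 2))"
  have "b powi k b = (if odd (k b) then b else 1) * (b powi (k b div 2)) ^ 2" if "b \<in> B" for b
  proof -
    have b0: "b \<noteq> 0" using that B D.nz by blast
    have "b powi k b = b powi (k b mod 2 + (k b div 2) * 2)" by simp
    also have "\<dots> = b powi (k b mod 2) * b powi ((k b div 2) * 2)" using b0 by (intro power_int_add) auto
    also have "b powi ((k b div 2) * 2) = (b powi (k b div 2)) ^ 2" by (simp add: power_int_mult)
    also have "b powi (k b mod 2) = (if odd (k b) then b else 1)"
      by (cases "even (k b)") (auto simp: odd_iff_mod_2_eq_one even_iff_mod_2_eq_zero)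
    finally show ?thesis .
  qed
  then have "x = (\<Prod>b\<in>B. if odd (k b) then b else 1) * y ^ 2"
    unfolding k y_def prod_power_distrib prod.distrib [symmetric] by (intro prod.cong) auto
  also have "(\<Prod>b\<in>B. if odd (k b) then b else 1) = (\<Prod>b\<in>S. b)"
    using B by (simp add: S_def prod.inter_filter)
  finally have "x = (\<Prod>b\<in>S. b) * y ^ 2" .
  moreover have "y \<in> D" unfolding y_def using B by (intro D.prod D.powi) auto
  moreover have "S \<subseteq> B" by (auto simp: S_def)
  ultimately show ?thesis by blast
qed

section \<open>The automorphism group and the quadratic characters\<close>

abbreviation "A \<equiv> grp_A \<Gamma>"

lemma carrier_A: "\<alpha> \<in> carrier A \<longleftrightarrow> \<alpha> \<in> extensional H \<and> bij_betw \<alpha> H H \<and>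
    (\<forall>x\<in>H. \<forall>y\<in>H. \<alpha> (x * y) = \<alpha> x * \<alpha> y) \<and> (\<forall>x\<in>Gamma_0 \<Gamma>. \<alpha> x = x)"
  unfolding grp_A_def Aut_fixing_def auto_def hom_def Bij_def
  by (auto simp: bij_betw_def)

lemma A_BijGroup: "A = (BijGroup H)\<lparr>carrier := carrier A\<rparr>"
  by (simp add: grp_A_def Aut_fixing_def AutoGroup_def)

lemma A_Bij: "carrier A \<subseteq> Bij H"
  by (auto simp: carrier_A Bij_def)

lemma A_mult: "\<alpha> \<in> carrier A \<Longrightarrow> \<beta> \<in> carrier A \<Longrightarrow> \<alpha> \<otimes>\<^bsub>A\<^esub> \<beta> = compose H \<alpha> \<beta>"
  using A_Bij by (subst A_BijGroup) (auto simp: BijGroup_def)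

lemma A_one: "\<one>\<^bsub>A\<^esub> = (\<lambda>x\<in>H. x)"
  by (subst A_BijGroup) (simp add: BijGroup_def)

lemma A_closed: "\<alpha> \<in> carrier A \<Longrightarrow> x \<in> H \<Longrightarrow> \<alpha> x \<in> H"
  by (auto simp: carrier_A bij_betw_def)

lemma A_hom: "\<alpha> \<in> carrier A \<Longrightarrow> x \<in> H \<Longrightarrow> y \<in> H \<Longrightarrow> \<alpha> (x * y) = \<alpha> x * \<alpha> y"
  by (auto simp: carrier_A)

lemma A_fix: "\<alpha> \<in> carrier A \<Longrightarrow> x \<in> Gamma_0 \<Gamma> \<Longrightarrow> \<alpha> x = x"
  by (auto simp: carrier_A)

lemma A_inj: "\<alpha> \<in> carrier A \<Longrightarrow> x \<in> H \<Longrightarrow> y \<in> H \<Longrightarrow> \<alpha> x = \<alpha> y \<Longrightarrow> x = y"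
  by (auto simp: carrier_A bij_betw_def inj_on_def)

lemma A_fix_one: "\<alpha> \<in> carrier A \<Longrightarrow> \<alpha> 1 = 1"
  using A_fix sign_Gamma_0 by simp

lemma A_power: "\<alpha> \<in> carrier A \<Longrightarrow> x \<in> H \<Longrightarrow> \<alpha> (x ^ n) = \<alpha> x ^ n"
  by (induction n) (auto simp: A_fix_one A_hom H.power)

lemma group_A: "group A"
proof -
  interpret BG: group "BijGroup H" by (rule group_BijGroup)
  have "subgroup (carrier A) (BijGroup H)"
  proof (rule BG.subgroupI)
    show "carrier A \<subseteq> carrier (BijGroup H)" using A_Bij by (simp add: BijGroup_def)
    have "(\<lambda>x\<in>H. x) \<in> carrier A" using Gamma_0_H H.mult
      by (auto simp: carrier_A bij_betw_def inj_on_def)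
    then show "carrier A \<noteq> {}" by blast
  next
    fix \<alpha> assume \<alpha>: "\<alpha> \<in> carrier A"
    then have aB: "\<alpha> \<in> Bij H" using A_Bij by blast
    have bij: "bij_betw \<alpha> H H" using \<alpha> by (simp add: carrier_A)
    define \<beta> where "\<beta> = inv_into H \<alpha>"
    have b: "\<beta> x \<in> H" "\<alpha> (\<beta> x) = x" if "x \<in> H" for x
      using bij that by (auto simp: \<beta>_def bij_betw_def inv_into_into f_inv_into_f)
    have "(\<lambda>x\<in>H. \<beta> x) \<in> carrier A"
      unfolding carrier_A
    proof (intro conjI ballI)
      show "bij_betw (\<lambda>x\<in>H. \<beta> x) H H"
        using bij_betw_inv_into [OF bij] by (simp add: \<beta>_def cong: bij_betw_cong)
      fix x y assume xy: "x \<in> H" "y \<in> H"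
      have "\<beta> (x * y) = \<beta> x * \<beta> y"
        by (rule A_inj [OF \<alpha>]) (use b xy A_hom [OF \<alpha>] H.mult in auto)
      then show "(\<lambda>x\<in>H. \<beta> x) (x * y) = (\<lambda>x\<in>H. \<beta> x) x * (\<lambda>x\<in>H. \<beta> x) y"
        using xy H.mult by simp
    next
      fix x assume x: "x \<in> Gamma_0 \<Gamma>"
      then have "x \<in> H" using Gamma_0_H by blast
      moreover have "\<beta> x = x"
        by (rule A_inj [OF \<alpha>]) (use b \<open>x \<in> H\<close> A_fix [OF \<alpha> x] in auto)
      ultimately show "(\<lambda>x\<in>H. \<beta> x) x = x" by simp
    qed simp
    then show "inv\<^bsub>BijGroup H\<^esub> \<alpha> \<in> carrier A" using aB by (simp add: inv_BijGroup \<beta>_def)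
    fix \<gamma> assume \<gamma>: "\<gamma> \<in> carrier A"
    have "compose H \<alpha> \<gamma> \<in> carrier A"
      unfolding carrier_A
    proof (intro conjI ballI)
      show "bij_betw (compose H \<alpha> \<gamma>) H H"
        using \<alpha> \<gamma> by (auto simp: carrier_A intro: bij_betw_compose)
    next
      fix x y assume "x \<in> H" "y \<in> H"
      then show "compose H \<alpha> \<gamma> (x * y) = compose H \<alpha> \<gamma> x * compose H \<alpha> \<gamma> y"
        using \<alpha> \<gamma> by (simp add: compose_eq H.mult A_hom A_closed)
    next
      fix x assume "x \<in> Gamma_0 \<Gamma>"
      then show "compose H \<alpha> \<gamma> x = x"
        using \<alpha> \<gamma> Gamma_0_H by (auto simp: compose_eq A_fix)
    qed (rule compose_extensional)
    then show "\<alpha> \<otimes>\<^bsub>BijGroup H\<^esub> \<gamma> \<in> carrier A"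
      using \<alpha> \<gamma> A_Bij by (auto simp: BijGroup_def)
  qed
  then show ?thesis using BG.subgroup_imp_group A_BijGroup by metis
qed

sublocale A: group A
  by (rule group_A)

lemma A_mu_inf:
  assumes \<alpha>: "\<alpha> \<in> carrier A"
  shows "bij_betw \<alpha> mu_inf mu_inf"
  unfolding bij_betw_def
proof (intro conjI equalityI subsetI)
  show "inj_on \<alpha> mu_inf" using A_inj [OF \<alpha>] mu_H by (auto simp: inj_on_def)
  fix y
  {
    assume "y \<in> \<alpha> ` mu_inf"
    then obtain x where x: "x \<in> mu_inf" "y = \<alpha> x" by blast
    then obtain n :: nat where n: "n \<ge> 1" "x ^ n = 1" by (auto elim: mu_infE)
    have "y ^ n = 1" using A_power [OF \<alpha>, of x n] x mu_H n A_fix_one [OF \<alpha>] by auto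
    then show "y \<in> mu_inf" using n mu_infI by blast
  next
    assume y: "y \<in> mu_inf"
    then obtain n :: nat where n: "n \<ge> 1" "y ^ n = 1" by (rule mu_infE)
    have "y \<in> \<alpha> ` H" using y mu_H \<alpha> by (auto simp: carrier_A bij_betw_def)
    then obtain x where x: "x \<in> H" "y = \<alpha> x" by blast
    then have "\<alpha> (x ^ n) = \<alpha> 1" using n A_power [OF \<alpha>] A_fix_one [OF \<alpha>] by simp
    then have "x ^ n = 1" using A_inj [OF \<alpha>] x H.power by blast
    then show "y \<in> \<alpha> ` mu_inf" using x n mu_infI by blast
  }
qed

text \<open>Field automorphisms of the cyclotomic field are determined by their values on the
  generators, so restriction is injective and any automorphism agreeing with \<alpha> on
  \<open>mu_inf\<close> is the one chosen by \<open>the_inv_into\<close>.\<close>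

lemma sigma_of_unique:
  assumes "s \<in> carrier (Gal_Q (Q_adjoin mu_inf))" "\<And>x. x \<in> mu_inf \<Longrightarrow> s x = \<alpha> x"
  shows "sigma_of \<alpha> = s"
proof -
  interpret Q: csubfield "Q_adjoin mu_inf" by (rule csubfield_Q_adjoin)
  have inj: "inj_on (\<lambda>\<sigma>. restrict \<sigma> mu_inf) (carrier (Gal_Q (Q_adjoin mu_inf)))"
  proof (rule inj_onI)
    fix s t assume st: "s \<in> carrier (Gal_Q (Q_adjoin mu_inf))" "t \<in> carrier (Gal_Q (Q_adjoin mu_inf))"
      and eq: "restrict s mu_inf = restrict t mu_inf"
    show "s = t"
    proof (rule Q.Gal_Q_eqI [OF st])
      fix x assume "x \<in> mu_inf"
      then show "s x = t x" using fun_cong [OF eq, of x] by simp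
    qed
  qed
  have eq: "restrict \<alpha> mu_inf = restrict s mu_inf" using assms(2) by auto
  show ?thesis unfolding sigma_of_def eq using the_inv_into_f_f [OF inj assms(1)] by simp
qed

lemma sigma_of:
  assumes \<alpha>: "\<alpha> \<in> carrier A"
  shows "sigma_of \<alpha> \<in> carrier (Gal_Q Q_unity)" "x \<in> mu_inf \<Longrightarrow> sigma_of \<alpha> x = \<alpha> x"
proof -
  obtain s where "s \<in> carrier (Gal_Q (Q_adjoin mu_inf))" "\<forall>x\<in>mu_inf. s x = \<alpha> x"
    using mu_inf_automorphism [OF A_mu_inf [OF \<alpha>]] A_hom [OF \<alpha>] mu_H by blast
  then show "sigma_of \<alpha> \<in> carrier (Gal_Q Q_unity)" "x \<in> mu_inf \<Longrightarrow> sigma_of \<alpha> x = \<alpha> x"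
    using sigma_of_unique [of s \<alpha>] by (auto simp: Q_adjoin_mu_inf)
qed

lemma sigma_of_hom: "\<alpha> \<in> carrier A \<Longrightarrow> field_hom_on Q_unity (sigma_of \<alpha>)"
  using sigma_of(1) QU.carrier_Gal_Q by blast

lemma sqrt_props:
  assumes "b \<in> D"
  shows "pos_sqrt b ^ 2 = b" "pos_sqrt b \<noteq> 0" "pos_sqrt b \<in> Q_unity" "pos_sqrt b \<in> H"
    "\<exists>t>0. pos_sqrt b = complex_of_real t"
proof -
  have b: "b \<in> of_rat ` {q. q > 0}" using assms by (simp add: D_iff)
  show "pos_sqrt b ^ 2 = b" "pos_sqrt b \<noteq> 0" "pos_sqrt b \<in> Q_unity"
    "\<exists>t>0. pos_sqrt b = complex_of_real t"
    by (rule pos_sqrt_props [OF b])+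
  then have "pos_sqrt b ^ 2 \<in> H" using assms D_H by auto
  then show "pos_sqrt b \<in> H" by (rule H_root) simp
qed

lemma pos_sqrt_mult:
  assumes "a \<in> D" "b \<in> D"
  shows "pos_sqrt (a * b) = pos_sqrt a * pos_sqrt b"
proof -
  obtain s where s: "s > 0" "pos_sqrt a = complex_of_real s" using sqrt_props(5) [OF assms(1)] by blast
  obtain t where t: "t > 0" "pos_sqrt b = complex_of_real t" using sqrt_props(5) [OF assms(2)] by blast
  note st = s t
  have "a * b = complex_of_real (s * t) ^ 2"
    using sqrt_props(1) [OF assms(1)] sqrt_props(1) [OF assms(2)] st by (simp add: power_mult_distrib)
  then show ?thesis using pos_sqrt_of_real_square [of "s * t"] st by simp
qed

lemma A_sqrt:
  assumes \<alpha>: "\<alpha> \<in> carrier A" and b: "b \<in> D"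
  obtains e where "e \<in> {1, -1}" "\<alpha> (pos_sqrt b) = e * pos_sqrt b"
proof -
  have "\<alpha> (pos_sqrt b) ^ 2 = \<alpha> b"
    using A_power [OF \<alpha> sqrt_props(4) [OF b], of 2] sqrt_props(1) [OF b] by simp
  also have "\<dots> = pos_sqrt b ^ 2" using A_fix [OF \<alpha>] b D_Gamma_0 sqrt_props(1) [OF b] by auto
  finally have "\<alpha> (pos_sqrt b) = pos_sqrt b \<or> \<alpha> (pos_sqrt b) = - pos_sqrt b"
    by (rule power2_eq_iff [THEN iffD1])
  then show thesis using that [of 1] that [of "-1"] by auto
qed

lemma sigma_sqrt:
  assumes \<alpha>: "\<alpha> \<in> carrier A" and b: "b \<in> D"
  obtains e where "e \<in> {1, -1}" "sigma_of \<alpha> (pos_sqrt b) = e * pos_sqrt b"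
proof -
  have "sigma_of \<alpha> (pos_sqrt b) ^ 2 = sigma_of \<alpha> b"
    using QU.hom_props(4) [OF sigma_of_hom [OF \<alpha>] sqrt_props(3) [OF b], of 2] sqrt_props(1) [OF b]
    by simp
  also have "\<dots> = pos_sqrt b ^ 2"
    using QU.hom_Rats [OF sigma_of_hom [OF \<alpha>]] b D_Rats sqrt_props(1) [OF b] by auto
  finally have "sigma_of \<alpha> (pos_sqrt b) = pos_sqrt b \<or> sigma_of \<alpha> (pos_sqrt b) = - pos_sqrt b"
    by (rule power2_eq_iff [THEN iffD1])
  then show thesis using that [of 1] that [of "-1"] by auto
qed

lemma chi_sign: "\<alpha> \<in> carrier A \<Longrightarrow> b \<in> D \<Longrightarrow> chi b \<alpha> \<in> {1, -1}"
proof -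
  assume \<alpha>: "\<alpha> \<in> carrier A" and b: "b \<in> D"
  obtain e where e: "e \<in> {1, -1}" "\<alpha> (pos_sqrt b) = e * pos_sqrt b" using A_sqrt [OF \<alpha> b] .
  obtain f where f: "f \<in> {1, -1}" "sigma_of \<alpha> (pos_sqrt b) = f * pos_sqrt b"
    using sigma_sqrt [OF \<alpha> b] .
  from e f show "chi b \<alpha> \<in> {1, -1}" using sqrt_props(2) [OF b] by (auto simp: chi_def)
qed

lemma chi_mult_right:
  assumes \<alpha>: "\<alpha> \<in> carrier A" and ab: "a \<in> D" "b \<in> D"
  shows "chi (a * b) \<alpha> = chi a \<alpha> * chi b \<alpha>"
proof -
  have "\<alpha> (pos_sqrt (a * b)) = \<alpha> (pos_sqrt a) * \<alpha> (pos_sqrt b)"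
    using A_hom [OF \<alpha>] sqrt_props(4) ab by (simp add: pos_sqrt_mult)
  moreover have "sigma_of \<alpha> (pos_sqrt (a * b)) = sigma_of \<alpha> (pos_sqrt a) * sigma_of \<alpha> (pos_sqrt b)"
    using sigma_of_hom [OF \<alpha>] sqrt_props(3) ab by (simp add: pos_sqrt_mult field_hom_on_def)
  ultimately show ?thesis by (simp add: chi_def pos_sqrt_mult [OF ab] mult_ac)
qed

lemma sigma_of_mult:
  assumes \<alpha>: "\<alpha> \<in> carrier A" "\<beta> \<in> carrier A"
  shows "sigma_of (\<alpha> \<otimes>\<^bsub>A\<^esub> \<beta>) = compose Q_unity (sigma_of \<alpha>) (sigma_of \<beta>)"
proof (rule sigma_of_unique)
  show "compose Q_unity (sigma_of \<alpha>) (sigma_of \<beta>) \<in> carrier (Gal_Q (Q_adjoin mu_inf))"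
    unfolding Q_adjoin_mu_inf using sigma_of(1) \<alpha> by (intro QU.Gal_Q_compose)
  fix x assume x: "x \<in> mu_inf"
  then have "x \<in> H" "x \<in> Q_unity" "\<beta> x \<in> mu_inf"
    using mu_H Q_adjoin_incl [of mu_inf] Q_adjoin_mu_inf A_mu_inf [OF \<alpha>(2)] by (auto simp: bij_betw_def)
  then show "compose Q_unity (sigma_of \<alpha>) (sigma_of \<beta>) x = (\<alpha> \<otimes>\<^bsub>A\<^esub> \<beta>) x"
    using x sigma_of(2) \<alpha> by (simp add: compose_eq A_mult)
qed

text \<open>In its two actions \<beta> multiplies \<surd>b by signs \<open>e\<close> and
  \<open>f\<close>. Signs are rational, hence fixed by \<alpha> and by its field automorphism, and
  they factor out.\<close>

lemma chi_mult_left: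
  assumes \<alpha>: "\<alpha> \<in> carrier A" "\<beta> \<in> carrier A" and b: "b \<in> D"
  shows "chi b (\<alpha> \<otimes>\<^bsub>A\<^esub> \<beta>) = chi b \<alpha> * chi b \<beta>"
proof -
  let ?s = "pos_sqrt b"
  obtain e where e: "e \<in> {1, -1}" "\<beta> ?s = e * ?s" using A_sqrt [OF \<alpha>(2) b] .
  obtain f where f: "f \<in> {1, -1}" "sigma_of \<beta> ?s = f * ?s" using sigma_sqrt [OF \<alpha>(2) b] .
  have "(\<alpha> \<otimes>\<^bsub>A\<^esub> \<beta>) ?s = \<alpha> (e * ?s)"
    using sqrt_props(4) [OF b] by (simp add: A_mult \<alpha> compose_eq e(2))
  also have "\<dots> = e * \<alpha> ?s"
    using A_hom [OF \<alpha>(1) _ sqrt_props(4) [OF b], of e] A_fix [OF \<alpha>(1)] sign_Gamma_0 [OF e(1)] Gamma_0_H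
    by auto
  finally have 1: "(\<alpha> \<otimes>\<^bsub>A\<^esub> \<beta>) ?s = e * \<alpha> ?s" .
  have fQ: "f \<in> \<rat>" using f(1) by auto
  have "sigma_of (\<alpha> \<otimes>\<^bsub>A\<^esub> \<beta>) ?s = sigma_of \<alpha> (f * ?s)"
    using sqrt_props(3) [OF b] by (simp add: sigma_of_mult \<alpha> compose_eq f(2))
  also have "\<dots> = sigma_of \<alpha> f * sigma_of \<alpha> ?s"
    using sigma_of_hom [OF \<alpha>(1)] QU.rats fQ sqrt_props(3) [OF b] by (auto simp: field_hom_on_def)
  also have "sigma_of \<alpha> f = f" using QU.hom_Rats [OF sigma_of_hom [OF \<alpha>(1)] fQ] .
  finally have 2: "sigma_of (\<alpha> \<otimes>\<^bsub>A\<^esub> \<beta>) ?s = f * sigma_of \<alpha> ?s" .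
  show ?thesis unfolding chi_def 1 2 e(2) f(2) by simp
qed

end

section \<open>Pairings with values in \<open>\<mu>\<^sub>2\<close>\<close>

lemma mult_grp_simps [simp]:
  "carrier (mult_grp S) = S" "x \<otimes>\<^bsub>mult_grp S\<^esub> y = x * y" "\<one>\<^bsub>mult_grp S\<^esub> = 1"
  by (simp_all add: Multiplicative_Group.mult_of_def)

lemma mu_2_simps [simp]: "carrier mu_2 = {1, -1}" "x \<otimes>\<^bsub>mu_2\<^esub> y = x * y" "\<one>\<^bsub>mu_2\<^esub> = 1"
  by (simp_all add: mu_2_def)

lemma (in csubgroup) comm_group_mult_grp: "comm_group (mult_grp D)"
proof (rule comm_groupI)
  fix x assume "x \<in> carrier (mult_grp D)"
  then show "\<exists>y\<in>carrier (mult_grp D). y \<otimes>\<^bsub>mult_grp D\<^esub> x = \<one>\<^bsub>mult_grp D\<^esub>"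
    using inverse nz by (intro bexI [of _ "inverse x"]) auto
qed (auto simp: mult.assoc mult.commute)

text \<open>The two halves of a perfect pairing of quotients have the same shape,
  with the roles of the groups exchanged.\<close>

locale half_pairing = A: group A + E: group E
  for A :: "('a, 'm) monoid_scheme" (structure) and E :: "('b, 'n) monoid_scheme" +
  fixes c :: "'a \<Rightarrow> 'b \<Rightarrow> complex" and M :: "'a set" and N :: "'b set"
  assumes M: "M \<lhd> A" and N: "N \<lhd> E"
    and sign: "x \<in> carrier A \<Longrightarrow> y \<in> carrier E \<Longrightarrow> c x y \<in> {1, -1}"
    and mult_left: "x \<in> carrier A \<Longrightarrow> x' \<in> carrier A \<Longrightarrow> y \<in> carrier E \<Longrightarrow>
      c (x \<otimes> x') y = c x y * c x' y"
    and mult_right: "x \<in> carrier A \<Longrightarrow> y \<in> carrier E \<Longrightarrow> y' \<in> carrier E \<Longrightarrow>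
      c x (y \<otimes>\<^bsub>E\<^esub> y') = c x y * c x y'"
    and kernel: "x \<in> carrier A \<Longrightarrow> x \<in> M \<longleftrightarrow> (\<forall>y\<in>carrier E. c x y = 1)"
    and surjective: "(\<And>y. y \<in> carrier E \<Longrightarrow> h y \<in> {1, -1}) \<Longrightarrow>
      (\<And>y y'. y \<in> carrier E \<Longrightarrow> y' \<in> carrier E \<Longrightarrow> h (y \<otimes>\<^bsub>E\<^esub> y') = h y * h y') \<Longrightarrow>
      (\<And>y. y \<in> N \<Longrightarrow> h y = 1) \<Longrightarrow> \<exists>x\<in>carrier A. \<forall>y\<in>carrier E. c x y = h y"
begin

interpretation M: normal M A by (rule M)
interpretation N: normal N E by (rule N)

lemma c_one: "y \<in> carrier E \<Longrightarrow> c \<one> y = 1"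
  using mult_left [of "\<one>" "\<one>" y] sign [of "\<one>" y] by auto

lemma c_inv: "x \<in> carrier A \<Longrightarrow> y \<in> carrier E \<Longrightarrow> c (inv x) y = c x y"
  using mult_left [of "inv x" x y] sign [of x y] sign [of "inv x" y] c_one [of y] by auto

lemma coset_eq_iff:
  assumes x: "x \<in> carrier A" "x' \<in> carrier A"
  shows "M #> x = M #> x' \<longleftrightarrow> (\<forall>y\<in>carrier E. c x y = c x' y)"
proof -
  have "M #> x = M #> x' \<longleftrightarrow> M #> (x \<otimes> inv x') = M"
    using A.coset_mult_inv1 [of M x x'] A.coset_mult_inv2 [of M x x'] x M.subset by auto
  also have "\<dots> \<longleftrightarrow> x \<otimes> inv x' \<in> M"
    using A.coset_join1 [of M] A.coset_join2 [of _ M] M.subgroup_axioms M.subset x by auto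
  also have "\<dots> \<longleftrightarrow> (\<forall>y\<in>carrier E. c x y * c x' y = 1)"
    using x by (simp add: kernel mult_left c_inv)
  also have "\<dots> \<longleftrightarrow> (\<forall>y\<in>carrier E. c x y = c x' y)"
    using sign [OF x(1)] sign [OF x(2)] by fastforce
  finally show ?thesis .
qed

text \<open>Cosets are determined by their values under \<open>c\<close>, which are commuting signs
  with square 1; commutativity is thus gained in the quotient.\<close>

lemma elementary_quotient: "elementary_abelian_2 (A Mod M)"
proof -
  interpret Q: group "A Mod M" by (rule M.factorgroup_is_group)
  have "comm_group (A Mod M)"
  proof (rule Q.group_comm_groupI)
    fix u v assume "u \<in> carrier (A Mod M)" "v \<in> carrier (A Mod M)"
    then obtain x y where xy: "x \<in> carrier A" "y \<in> carrier A" "u = M #> x" "v = M #> y"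
      by (auto simp: carrier_FactGroup)
    then show "u \<otimes>\<^bsub>A Mod M\<^esub> v = v \<otimes>\<^bsub>A Mod M\<^esub> u"
      by (simp add: mult_FactGroup M.rcos_sum coset_eq_iff mult_left mult.commute)
  qed
  moreover have "u \<otimes>\<^bsub>A Mod M\<^esub> u = \<one>\<^bsub>A Mod M\<^esub>" if u: "u \<in> carrier (A Mod M)" for u
  proof -
    obtain x where x: "x \<in> carrier A" "u = M #> x" using u by (auto simp: carrier_FactGroup)
    have "c x y * c x y = 1" if "y \<in> carrier E" for y using sign [OF x(1) that] by auto
    then have "x \<otimes> x \<in> M" using x by (simp add: kernel mult_left)
    then have "M #> (x \<otimes> x) = M"
      using A.coset_join2 [of _ M] M.subgroup_axioms x by auto
    then show ?thesis using x by (simp add: mult_FactGroup M.rcos_sum)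
  qed
  ultimately show ?thesis by (simp add: elementary_abelian_2_def)
qed

text \<open>\<open>p\<close> is constrained only by its values on cosets, so one pairing serves both
  halves, with its arguments exchanged in the second. For surjectivity a character of the quotient
  is pulled back to \<open>E\<close> and handed to \<open>surjective\<close>.\<close>

lemma duality_iso:
  assumes p: "\<And>x y. x \<in> carrier A \<Longrightarrow> y \<in> carrier E \<Longrightarrow> p (M #> x) (N #>\<^bsub>E\<^esub> y) = c x y"
  shows "(\<lambda>u. \<lambda>v\<in>carrier (E Mod N). p u v) \<in> iso (A Mod M) (Hom_group (E Mod N) mu_2)"
proof -
  define f where "f u = (\<lambda>v\<in>carrier (E Mod N). p u v)" for u
  have carA: "\<exists>x\<in>carrier A. u = M #> x" if "u \<in> carrier (A Mod M)" for u
    using that by (auto simp: carrier_FactGroup)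
  have carE: "\<exists>y\<in>carrier E. v = N #>\<^bsub>E\<^esub> y" if "v \<in> carrier (E Mod N)" for v
    using that by (auto simp: carrier_FactGroup)
  have inE: "N #>\<^bsub>E\<^esub> y \<in> carrier (E Mod N)" if "y \<in> carrier E" for y
    using that by (auto simp: carrier_FactGroup)
  have inA: "M #> x \<in> carrier (A Mod M)" if "x \<in> carrier A" for x
    using that by (auto simp: carrier_FactGroup)
  have multE: "(N #>\<^bsub>E\<^esub> y) \<otimes>\<^bsub>E Mod N\<^esub> (N #>\<^bsub>E\<^esub> y') = N #>\<^bsub>E\<^esub> (y \<otimes>\<^bsub>E\<^esub> y')"
    if "y \<in> carrier E" "y' \<in> carrier E" for y y'
    using that by (simp add: mult_FactGroup N.rcos_sum)
  have fval: "f (M #> x) (N #>\<^bsub>E\<^esub> y) = c x y" if "x \<in> carrier A" "y \<in> carrier E" for x y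
    using that p inE by (simp add: f_def)
  have f_mem: "f u \<in> carrier (Hom_group (E Mod N) mu_2)" if u: "u \<in> carrier (A Mod M)" for u
  proof -
    obtain x where x: "x \<in> carrier A" "u = M #> x" using carA [OF u] by blast
    have "f u \<in> hom (E Mod N) mu_2"
    proof (rule homI)
      fix v assume "v \<in> carrier (E Mod N)"
      then obtain y where "y \<in> carrier E" "v = N #>\<^bsub>E\<^esub> y" using carE by blast
      then show "f u v \<in> carrier mu_2" using x sign fval by simp
    next
      fix v w assume "v \<in> carrier (E Mod N)" "w \<in> carrier (E Mod N)"
      then obtain y z where yz: "y \<in> carrier E" "v = N #>\<^bsub>E\<^esub> y" "z \<in> carrier E" "w = N #>\<^bsub>E\<^esub> z"
        using carE by metis
      have "f u (v \<otimes>\<^bsub>E Mod N\<^esub> w) = f u (N #>\<^bsub>E\<^esub> (y \<otimes>\<^bsub>E\<^esub> z))"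
        by (simp only: yz(2,4) multE [OF yz(1,3)])
      then show "f u (v \<otimes>\<^bsub>E Mod N\<^esub> w) = f u v \<otimes>\<^bsub>mu_2\<^esub> f u w"
        using x yz by (simp add: fval mult_right)
    qed
    then show ?thesis by (simp add: Hom_group_def f_def)
  qed
  have "f \<in> iso (A Mod M) (Hom_group (E Mod N) mu_2)"
  proof (rule isoI)
    show "f \<in> hom (A Mod M) (Hom_group (E Mod N) mu_2)"
    proof (rule homI)
      show "\<And>u. u \<in> carrier (A Mod M) \<Longrightarrow> f u \<in> carrier (Hom_group (E Mod N) mu_2)" by (rule f_mem)
      fix u u' assume "u \<in> carrier (A Mod M)" "u' \<in> carrier (A Mod M)"
      then obtain x x' where x: "x \<in> carrier A" "u = M #> x" "x' \<in> carrier A" "u' = M #> x'"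
        using carA by blast
      have "u \<otimes>\<^bsub>A Mod M\<^esub> u' = M #> (x \<otimes> x')"
        using x by (simp add: mult_FactGroup M.rcos_sum)
      moreover have "f (M #> (x \<otimes> x')) v = f u v * f u' v" if v: "v \<in> carrier (E Mod N)" for v
      proof -
        obtain y where "y \<in> carrier E" "v = N #>\<^bsub>E\<^esub> y" using carE v by blast
        then show ?thesis using x by (simp add: fval mult_left)
      qed
      ultimately show "f (u \<otimes>\<^bsub>A Mod M\<^esub> u') = f u \<otimes>\<^bsub>Hom_group (E Mod N) mu_2\<^esub> f u'"
        by (auto simp: Hom_group_def fun_eq_iff f_def)
    qed
    show "bij_betw f (carrier (A Mod M)) (carrier (Hom_group (E Mod N) mu_2))"
      unfolding bij_betw_def
    proof (intro conjI equalityI subsetI)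
      show "inj_on f (carrier (A Mod M))"
      proof (rule inj_onI)
        fix u u' assume "u \<in> carrier (A Mod M)" "u' \<in> carrier (A Mod M)" and eq: "f u = f u'"
        then obtain x x' where x: "x \<in> carrier A" "u = M #> x" "x' \<in> carrier A" "u' = M #> x'"
          using carA by blast
        have "c x y = c x' y" if "y \<in> carrier E" for y
          using fval [OF x(1) that] fval [OF x(3) that] eq x by simp
        then show "u = u'" using x coset_eq_iff by simp
      qed
    next
      fix g assume "g \<in> f ` carrier (A Mod M)"
      then show "g \<in> carrier (Hom_group (E Mod N) mu_2)" using f_mem by blast
    next
      fix g assume "g \<in> carrier (Hom_group (E Mod N) mu_2)"
      then have g: "g \<in> hom (E Mod N) mu_2" "g \<in> extensional (carrier (E Mod N))"
        by (auto simp: Hom_group_def)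
      define h where "h y = g (N #>\<^bsub>E\<^esub> y)" for y
      have hs: "h y \<in> {1, -1}" if "y \<in> carrier E" for y
        using hom_in_carrier [OF g(1) inE [OF that]] by (simp add: h_def)
      have hm: "h (y \<otimes>\<^bsub>E\<^esub> y') = h y * h y'" if "y \<in> carrier E" "y' \<in> carrier E" for y y'
        using hom_mult [OF g(1) inE [OF that(1)] inE [OF that(2)]]
        unfolding h_def multE [OF that] by simp
      have h1: "h y = 1" if "y \<in> N" for y
      proof -
        have y: "y \<in> carrier E" using that N.subset by blast
        have "N #>\<^bsub>E\<^esub> y = N" "N #>\<^bsub>E\<^esub> \<one>\<^bsub>E\<^esub> = N"
          using E.coset_join2 [of _ N] N.subgroup_axioms that y N.one_closed by auto
        then have "h y = h \<one>\<^bsub>E\<^esub>" by (simp add: h_def)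
        moreover have "h \<one>\<^bsub>E\<^esub> = 1" using hm [of "\<one>\<^bsub>E\<^esub>" "\<one>\<^bsub>E\<^esub>"] hs [of "\<one>\<^bsub>E\<^esub>"] by auto
        ultimately show ?thesis by simp
      qed
      obtain x where x: "x \<in> carrier A" "\<forall>y\<in>carrier E. c x y = h y"
        using surjective [OF hs hm h1] by blast
      have "f (M #> x) = g"
      proof (rule extensionalityI [OF _ g(2)])
        show "f (M #> x) \<in> extensional (carrier (E Mod N))" by (simp add: f_def)
        fix v assume "v \<in> carrier (E Mod N)"
        then obtain y where "y \<in> carrier E" "v = N #>\<^bsub>E\<^esub> y" using carE by blast
        then show "f (M #> x) v = g v" using x by (simp add: fval h_def)
      qed
      then show "g \<in> f ` carrier (A Mod M)" using inA [OF x(1)] by blast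
    qed
  qed
  then show ?thesis unfolding f_def .
qed

end

text \<open>The arithmetic is condensed into \<open>generated\<close> and \<open>dual\<close>:
  \<open>B\<close> spans \<open>D\<close> modulo squares, and every sign pattern on \<open>B\<close>
  is realised by a group element. Both halves of the pairing follow from this by group
  theory.\<close>

locale sign_pairing = A: group A + csubgroup D
  for A :: "('a, 'm) monoid_scheme" (structure) and D +
  fixes chi :: "complex \<Rightarrow> 'a \<Rightarrow> complex" and B :: "complex set"
  assumes sign: "\<alpha> \<in> carrier A \<Longrightarrow> b \<in> D \<Longrightarrow> chi b \<alpha> \<in> {1, -1}"
    and mult_left: "\<alpha> \<in> carrier A \<Longrightarrow> \<beta> \<in> carrier A \<Longrightarrow> b \<in> D \<Longrightarrow>
      chi b (\<alpha> \<otimes> \<beta>) = chi b \<alpha> * chi b \<beta>"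
    and mult_right: "\<alpha> \<in> carrier A \<Longrightarrow> a \<in> D \<Longrightarrow> b \<in> D \<Longrightarrow> chi (a * b) \<alpha> = chi a \<alpha> * chi b \<alpha>"
    and B: "finite B" "B \<subseteq> D"
    and generated: "x \<in> D \<Longrightarrow> \<exists>S\<subseteq>B. \<exists>y\<in>D. x = (\<Prod>b\<in>S. b) * y ^ 2"
    and dual: "S \<subseteq> B \<Longrightarrow> \<exists>\<alpha>\<in>carrier A. \<forall>b\<in>B. chi b \<alpha> = (if b \<in> S then -1 else 1)"
begin

definition ker :: "'a set"
  where "ker = {\<alpha> \<in> carrier A. \<forall>b\<in>D. chi b \<alpha> = 1}"

text \<open>A sign-valued homomorphism kills squares, so its values on \<open>B\<close> determine
  it.\<close>

lemma sign_hom_prod: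
  assumes h: "\<And>b. b \<in> D \<Longrightarrow> h b \<in> {1, -1 :: complex}" "\<And>a b. a \<in> D \<Longrightarrow> b \<in> D \<Longrightarrow> h (a * b) = h a * h b"
    and S: "S \<subseteq> B" and y: "y \<in> D"
  shows "h ((\<Prod>b\<in>S. b) * y ^ 2) = (\<Prod>b\<in>S. h b)"
proof -
  have h1: "h 1 = 1" using h(2) [of 1 1] h(1) [of 1] by auto
  have "finite S" using S B finite_subset by blast
  then have "h (\<Prod>b\<in>S. b) = (\<Prod>b\<in>S. h b)" using S
  proof (induction S rule: finite_induct)
    case (insert s S)
    then have "s \<in> D" "(\<Prod>b\<in>S. b) \<in> D" using B by (auto intro!: prod)
    then show ?case using insert h(2) by simp
  qed (simp add: h1)
  moreover have "h (y ^ 2) = 1" using h(2) [OF y y] h(1) [OF y] by (auto simp: power2_eq_square)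
  moreover have "(\<Prod>b\<in>S. b) \<in> D" using S B by (auto intro!: prod)
  ultimately show ?thesis using h(2) power [OF y] by simp
qed

lemma sign_hom_agree:
  assumes h: "\<And>b. b \<in> D \<Longrightarrow> h b \<in> {1, -1 :: complex}" "\<And>a b. a \<in> D \<Longrightarrow> b \<in> D \<Longrightarrow> h (a * b) = h a * h b"
    and \<alpha>: "\<alpha> \<in> carrier A" and eq: "\<And>b. b \<in> B \<Longrightarrow> chi b \<alpha> = h b" and b: "b \<in> D"
  shows "chi b \<alpha> = h b"
proof -
  obtain S y where S: "S \<subseteq> B" "y \<in> D" "b = (\<Prod>b\<in>S. b) * y ^ 2" using generated [OF b] by blast
  have "chi b \<alpha> = (\<Prod>b\<in>S. chi b \<alpha>)" unfolding S(3)
    by (rule sign_hom_prod [OF _ _ S(1,2)]) (use sign mult_right \<alpha> in auto)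
  also have "\<dots> = (\<Prod>b\<in>S. h b)" using S(1) eq by (intro prod.cong) auto
  also have "\<dots> = h b" unfolding S(3) by (rule sign_hom_prod [OF h S(1,2), symmetric])
  finally show ?thesis .
qed

lemma chi_one: "b \<in> D \<Longrightarrow> chi b \<one> = 1"
  using mult_left [of "\<one>" "\<one>" b] sign [of "\<one>" b] by auto

lemma chi_inv: "\<alpha> \<in> carrier A \<Longrightarrow> b \<in> D \<Longrightarrow> chi b (inv \<alpha>) = chi b \<alpha>"
  using mult_left [of "inv \<alpha>" \<alpha> b] sign [of \<alpha> b] sign [of "inv \<alpha>" b] chi_one [of b] by auto

lemma normal_ker: "ker \<lhd> A"
  unfolding A.normal_inv_iff
proof (intro conjI ballI)
  show "subgroup ker A"
  proof (rule A.subgroupI)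
    show "ker \<noteq> {}" using chi_one by (auto simp: ker_def)
  qed (auto simp: ker_def chi_inv mult_left)
  fix x h assume "x \<in> carrier A" "h \<in> ker"
  then show "x \<otimes> h \<otimes> inv x \<in> ker"
    using sign [of x] by (fastforce simp: ker_def mult_left chi_inv)
qed

sublocale E: comm_group "mult_grp D"
  by (rule comm_group_mult_grp)

lemma m_inv_mult_grp: "x \<in> D \<Longrightarrow> inv\<^bsub>mult_grp D\<^esub> x = inverse x"
  by (rule E.inv_equality) (use nz inverse in auto)

lemma normal_squares: "squares D \<lhd> mult_grp D"
proof -
  have "subgroup (squares D) (mult_grp D)"
  proof (rule E.subgroupI)
    show "squares D \<subseteq> carrier (mult_grp D)" using power by (auto simp: squares_def)
    show "squares D \<noteq> {}" using one by (auto simp: squares_def)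
    fix x assume "x \<in> squares D"
    then obtain a where a: "a \<in> D" "x = a ^ 2" by (auto simp: squares_def)
    then have "x \<in> D" using power by simp
    have "inverse x = inverse a ^ 2" by (simp add: a power_inverse)
    then show "inv\<^bsub>mult_grp D\<^esub> x \<in> squares D"
      unfolding squares_def m_inv_mult_grp [OF \<open>x \<in> D\<close>]
      by (rule image_eqI) (rule inverse [OF a(1)])
    fix y assume "y \<in> squares D"
    then obtain b where b: "b \<in> D" "y = b ^ 2" by (auto simp: squares_def)
    have "x \<otimes>\<^bsub>mult_grp D\<^esub> y = (a * b) ^ 2" by (simp add: a b power_mult_distrib)
    then show "x \<otimes>\<^bsub>mult_grp D\<^esub> y \<in> squares D"
      unfolding squares_def by (rule image_eqI) (rule mult [OF a(1) b(1)])
  qed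
  then show ?thesis by (rule E.subgroup_imp_normal)
qed

text \<open>If the product part of \<open>b\<close> is nonempty, the element dual to one of its
  factors gives the value -1.\<close>

lemma square_iff: "b \<in> D \<Longrightarrow> b \<in> squares D \<longleftrightarrow> (\<forall>\<alpha>\<in>carrier A. chi b \<alpha> = 1)"
proof
  assume "b \<in> squares D"
  then obtain y where "y \<in> D" "b = y ^ 2" by (auto simp: squares_def)
  then show "\<forall>\<alpha>\<in>carrier A. chi b \<alpha> = 1"
    using mult_right [of _ y y] sign [of _ y] by (fastforce simp: power2_eq_square)
next
  assume b: "b \<in> D" and triv: "\<forall>\<alpha>\<in>carrier A. chi b \<alpha> = 1"
  obtain S y where S: "S \<subseteq> B" "y \<in> D" "b = (\<Prod>b\<in>S. b) * y ^ 2" using generated [OF b] by blast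
  have "S = {}"
  proof (rule ccontr)
    assume "S \<noteq> {}"
    then obtain s where s: "s \<in> S" by blast
    then obtain \<alpha> where \<alpha>: "\<alpha> \<in> carrier A" "\<forall>b\<in>B. chi b \<alpha> = (if b \<in> {s} then -1 else 1)"
      using dual [of "{s}"] S by auto
    have "chi b \<alpha> = (\<Prod>b\<in>S. chi b \<alpha>)" unfolding S(3)
      by (rule sign_hom_prod [OF _ _ S(1,2)]) (use sign mult_right \<alpha> in auto)
    also have "\<dots> = (\<Prod>b\<in>S. if b = s then -1 else 1)"
      using S(1) \<alpha> by (intro prod.cong) auto
    also have "\<dots> = -1" using s finite_subset [OF S(1) B(1)] by simp
    finally show False using triv \<alpha> by auto
  qed
  then show "b \<in> squares D" using S by (auto simp: squares_def)
qed

text \<open>The class modulo \<open>ker\<close> as a vector over the field with two elements,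
  recorded as a subset of \<open>B\<close>.\<close>

definition supp :: "'a \<Rightarrow> complex set"
  where "supp \<alpha> = {b \<in> B. chi b \<alpha> = -1}"

lemma supp_surj:
  assumes "S \<subseteq> B"
  shows "\<exists>\<alpha>\<in>carrier A. supp \<alpha> = S"
proof -
  obtain \<alpha> where \<alpha>: "\<alpha> \<in> carrier A" "\<And>b. b \<in> B \<Longrightarrow> chi b \<alpha> = (if b \<in> S then -1 else 1)"
    using dual [OF assms] by blast
  have "supp \<alpha> = {b \<in> B. b \<in> S}"
    unfolding supp_def by (intro Collect_cong conj_cong refl) (simp add: \<alpha>(2))
  then show ?thesis using \<alpha>(1) assms by blast
qed

text \<open>Multiplying by \<open>a s\<close> removes \<open>s\<close> from the support and changes
  \<open>f\<close> by the sign \<open>f (a s)\<close>; an element with empty support lies in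
  \<open>ker\<close>.\<close>

lemma hom_on_A_supp:
  assumes f: "\<And>\<alpha>. \<alpha> \<in> carrier A \<Longrightarrow> f \<alpha> \<in> {1, -1 :: complex}"
      "\<And>\<alpha> \<beta>. \<alpha> \<in> carrier A \<Longrightarrow> \<beta> \<in> carrier A \<Longrightarrow> f (\<alpha> \<otimes> \<beta>) = f \<alpha> * f \<beta>"
      "\<And>\<alpha>. \<alpha> \<in> ker \<Longrightarrow> f \<alpha> = 1"
    and a: "\<And>s. s \<in> B \<Longrightarrow> a s \<in> carrier A" "\<And>s. s \<in> B \<Longrightarrow> supp (a s) = {s}"
    and \<alpha>: "\<alpha> \<in> carrier A"
  shows "f \<alpha> = (\<Prod>s\<in>supp \<alpha>. f (a s))"
proof -
  have "finite (supp \<alpha>)" using B by (simp add: supp_def)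
  then show ?thesis using \<alpha>
  proof (induction "supp \<alpha>" arbitrary: \<alpha> rule: finite_induct)
    case empty
    have "chi b \<alpha> = 1" if "b \<in> B" for b
      using empty sign [of \<alpha> b] that B by (auto simp: supp_def)
    then have "chi b \<alpha> = 1" if "b \<in> D" for b
      using sign_hom_agree [of "\<lambda>_. 1" \<alpha> b] empty that by simp
    then show ?case using f(3) [of \<alpha>] empty by (simp add: ker_def flip: empty(1))
  next
    case (insert s S)
    have s: "s \<in> B" using insert by (auto simp: supp_def)
    have as: "a s \<in> carrier A" "supp (a s) = {s}" using a s by auto
    have "supp (\<alpha> \<otimes> a s) = S"
    proof (rule Set.set_eqI)
      fix b
      show "b \<in> supp (\<alpha> \<otimes> a s) \<longleftrightarrow> b \<in> S"
      proof (cases "b \<in> B")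
        case True
        then have bD: "b \<in> D" using B by blast
        have "b \<in> supp \<alpha> \<longleftrightarrow> b = s \<or> b \<in> S" by (simp flip: insert.hyps(4))
        then have 1: "chi b \<alpha> = -1 \<longleftrightarrow> b = s \<or> b \<in> S" using True by (simp add: supp_def)
        have "b \<in> supp (a s) \<longleftrightarrow> b = s" using as by simp
        then have 2: "chi b (a s) = -1 \<longleftrightarrow> b = s" using True by (simp add: supp_def)
        have "chi b \<alpha> * chi b (a s) = -1 \<longleftrightarrow> (chi b \<alpha> = -1 \<longleftrightarrow> chi b (a s) \<noteq> -1)"
          using sign [OF insert.prems bD] sign [OF as(1) bD] by auto
        then have "chi b \<alpha> * chi b (a s) = -1 \<longleftrightarrow> b \<in> S" using 1 2 insert.hyps(2) by blast
        then show ?thesis using True by (simp add: supp_def mult_left [OF insert.prems as(1) bD])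
      next
        case False
        then show ?thesis using insert.hyps by (auto simp: supp_def)
      qed
    qed
    then have IH: "f (\<alpha> \<otimes> a s) = (\<Prod>s\<in>S. f (a s))"
      using insert.hyps(3) [of "\<alpha> \<otimes> a s"] insert.prems as by auto
    have "f (a s) * f (a s) = 1" using f(1) [OF as(1)] by auto
    then have "f \<alpha> = f (a s) * (f \<alpha> * f (a s))" by (simp add: mult.left_commute)
    also have "\<dots> = f (a s) * (\<Prod>s\<in>S. f (a s))"
      using f(2) [OF insert.prems as(1)] IH by simp
    also have "\<dots> = (\<Prod>s\<in>insert s S. f (a s))" using insert.hyps(1,2) by simp
    finally show ?case unfolding insert.hyps(4) .
  qed
qed

sublocale left: half_pairing A "mult_grp D" "\<lambda>\<alpha> b. chi b \<alpha>" ker "squares D"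
proof (intro half_pairing.intro A.group_axioms E.group_axioms half_pairing_axioms.intro
    normal_ker normal_squares)
  fix h assume h: "\<And>y. y \<in> carrier (mult_grp D) \<Longrightarrow> h y \<in> {1, -1 :: complex}"
    "\<And>y y'. y \<in> carrier (mult_grp D) \<Longrightarrow> y' \<in> carrier (mult_grp D) \<Longrightarrow>
      h (y \<otimes>\<^bsub>mult_grp D\<^esub> y') = h y * h y'"
  obtain \<alpha> where \<alpha>: "\<alpha> \<in> carrier A" "\<forall>b\<in>B. chi b \<alpha> = (if b \<in> {b\<in>B. h b = -1} then -1 else 1)"
    using dual [of "{b\<in>B. h b = -1}"] by auto
  have "chi b \<alpha> = h b" if "b \<in> B" for b using \<alpha> that h(1) [of b] B by auto
  then have "\<forall>b\<in>D. chi b \<alpha> = h b" using sign_hom_agree [of h \<alpha>] h \<alpha>(1) by simp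
  then show "\<exists>x\<in>carrier A. \<forall>y\<in>carrier (mult_grp D). chi y x = h y" using \<alpha>(1) by auto
qed (use sign mult_left mult_right in \<open>auto simp: ker_def\<close>)

sublocale right: half_pairing "mult_grp D" A chi "squares D" ker
proof (intro half_pairing.intro A.group_axioms E.group_axioms half_pairing_axioms.intro
    normal_ker normal_squares)
  fix f assume f: "\<And>\<alpha>. \<alpha> \<in> carrier A \<Longrightarrow> f \<alpha> \<in> {1, -1 :: complex}"
      "\<And>\<alpha> \<beta>. \<alpha> \<in> carrier A \<Longrightarrow> \<beta> \<in> carrier A \<Longrightarrow> f (\<alpha> \<otimes> \<beta>) = f \<alpha> * f \<beta>"
      "\<And>\<alpha>. \<alpha> \<in> ker \<Longrightarrow> f \<alpha> = 1"
  have "\<exists>\<alpha>\<in>carrier A. supp \<alpha> = {s}" if "s \<in> B" for s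
    using supp_surj [of "{s}"] that by simp
  then obtain a where a: "\<And>s. s \<in> B \<Longrightarrow> a s \<in> carrier A" "\<And>s. s \<in> B \<Longrightarrow> supp (a s) = {s}"
    by metis
  \<comment> \<open>The character \<open>f\<close> is evaluation at the product of \<open>T\<close>:
    both are -1 raised to the number of elements common to \<open>T\<close> and the support.\<close>
  define T where "T = {s \<in> B. f (a s) = -1}"
  have TB: "T \<subseteq> B" by (auto simp: T_def)
  define b where "b = (\<Prod>s\<in>T. s)"
  have bD: "b \<in> D" unfolding b_def using TB B by (auto intro!: prod)
  have "chi b \<alpha> = f \<alpha>" if \<alpha>: "\<alpha> \<in> carrier A" for \<alpha>
  proof -
    have "chi b \<alpha> = chi ((\<Prod>s\<in>T. s) * 1 ^ 2) \<alpha>" by (simp add: b_def)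
    also have "\<dots> = (\<Prod>s\<in>T. chi s \<alpha>)"
      by (rule sign_hom_prod [OF _ _ TB]) (use sign mult_right \<alpha> in auto)
    also have "\<dots> = (\<Prod>s\<in>T. if s \<in> supp \<alpha> then -1 else 1)"
      using sign [OF \<alpha>] TB B by (intro prod.cong) (auto simp: supp_def)
    also have "\<dots> = (\<Prod>s\<in>{s\<in>T. s \<in> supp \<alpha>}. -1)"
      using TB B finite_subset by (subst prod.inter_filter) auto
    also have "{s\<in>T. s \<in> supp \<alpha>} = {s\<in>supp \<alpha>. s \<in> T}" by auto
    also have "(\<Prod>s\<in>{s\<in>supp \<alpha>. s \<in> T}. -1) = (\<Prod>s\<in>supp \<alpha>. if s \<in> T then -1 else 1)"
      using B by (subst prod.inter_filter) (auto simp: supp_def)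
    also have "\<dots> = (\<Prod>s\<in>supp \<alpha>. f (a s))"
      using f(1) a by (intro prod.cong) (auto simp: T_def supp_def)
    also have "\<dots> = f \<alpha>" by (rule hom_on_A_supp [OF f a \<alpha>, symmetric])
    finally show ?thesis .
  qed
  then show "\<exists>x\<in>carrier (mult_grp D). \<forall>y\<in>carrier A. chi x y = f y" using bD by auto
qed (use sign mult_left mult_right square_iff in auto)

text \<open>The support gives a bijection from cosets to subsets of \<open>B\<close>: the signs on
  \<open>B\<close> determine the coset, and \<open>dual\<close> realises every subset.\<close>

lemma card_rcosets_ker: "card (rcosets ker) = 2 ^ card B"
proof -
  have eq: "ker #> \<alpha> = ker #> \<beta> \<longleftrightarrow> supp \<alpha> = supp \<beta>"
    if \<alpha>\<beta>: "\<alpha> \<in> carrier A" "\<beta> \<in> carrier A" for \<alpha> \<beta>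
  proof -
    have "(chi b \<alpha> = -1 \<longleftrightarrow> chi b \<beta> = -1) \<longleftrightarrow> chi b \<alpha> = chi b \<beta>" if "b \<in> B" for b
      using sign [OF \<alpha>\<beta>(1), of b] sign [OF \<alpha>\<beta>(2), of b] that B by auto
    then have "supp \<alpha> = supp \<beta> \<longleftrightarrow> (\<forall>b\<in>B. chi b \<alpha> = chi b \<beta>)"
      by (auto simp: supp_def set_eq_iff)
    also have "\<dots> \<longleftrightarrow> (\<forall>b\<in>D. chi b \<alpha> = chi b \<beta>)"
    proof
      assume "\<forall>b\<in>B. chi b \<alpha> = chi b \<beta>"
      then show "\<forall>b\<in>D. chi b \<alpha> = chi b \<beta>"
        using sign_hom_agree [OF sign [OF \<alpha>\<beta>(2)] mult_right [OF \<alpha>\<beta>(2)] \<alpha>\<beta>(1)] by blast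
    qed (use B in blast)
    finally show ?thesis using left.coset_eq_iff \<alpha>\<beta> by simp
  qed
  have "supp ` carrier A = Pow B"
  proof (intro equalityI subsetI)
    fix S assume "S \<in> Pow B"
    then show "S \<in> supp ` carrier A" using supp_surj [of S] by blast
  qed (auto simp: supp_def)
  moreover define g where "g C = supp (SOME \<alpha>. \<alpha> \<in> carrier A \<and> C = ker #> \<alpha>)" for C
  have g: "g (ker #> \<alpha>) = supp \<alpha>" if "\<alpha> \<in> carrier A" for \<alpha>
  proof -
    define \<beta> where "\<beta> = (SOME \<beta>. \<beta> \<in> carrier A \<and> ker #> \<alpha> = ker #> \<beta>)"
    have "\<beta> \<in> carrier A \<and> ker #> \<alpha> = ker #> \<beta>"
      unfolding \<beta>_def by (rule someI [of _ \<alpha>]) (use that in simp)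
    then have "supp \<alpha> = supp \<beta>" using eq [OF that, of \<beta>] by blast
    then show ?thesis by (simp add: g_def \<beta>_def)
  qed
  have rc: "rcosets ker = (\<lambda>\<alpha>. ker #> \<alpha>) ` carrier A" by (auto simp: RCOSETS_def)
  have "inj_on g (rcosets ker)" unfolding rc
  proof (rule inj_onI)
    fix C C' assume "C \<in> (\<lambda>\<alpha>. ker #> \<alpha>) ` carrier A" "C' \<in> (\<lambda>\<alpha>. ker #> \<alpha>) ` carrier A"
    then obtain \<alpha> \<beta> where \<alpha>\<beta>: "\<alpha> \<in> carrier A" "C = ker #> \<alpha>" "\<beta> \<in> carrier A" "C' = ker #> \<beta>"
      by auto
    assume "g C = g C'"
    then show "C = C'" using g eq \<alpha>\<beta> by simp
  qed
  moreover have "g ` (rcosets ker) = supp ` carrier A"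
    unfolding rc image_image by (intro image_cong) (auto simp: g)
  ultimately show ?thesis using card_image [of g "rcosets ker"] B by (simp add: card_Pow)
qed

text \<open>\<open>p\<close> is computed from chosen representatives; \<open>coset_eq_iff\<close> on
  each side makes the choice immaterial.\<close>

lemma perfect:
  "\<exists>p. (\<forall>\<alpha>\<in>carrier A. \<forall>b\<in>D. p (ker #> \<alpha>) (squares D #>\<^bsub>mult_grp D\<^esub> b) = chi b \<alpha>) \<and>
    perfect_pairing (A Mod ker) (mult_grp D Mod squares D) mu_2 p"
proof -
  define p where "p u v = chi (SOME b. b \<in> D \<and> v = squares D #>\<^bsub>mult_grp D\<^esub> b)
    (SOME \<alpha>. \<alpha> \<in> carrier A \<and> u = ker #> \<alpha>)" for u v
  have p: "p (ker #> \<alpha>) (squares D #>\<^bsub>mult_grp D\<^esub> b) = chi b \<alpha>"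
    if \<alpha>: "\<alpha> \<in> carrier A" and b: "b \<in> D" for \<alpha> b
  proof -
    define \<alpha>' where "\<alpha>' = (SOME \<beta>. \<beta> \<in> carrier A \<and> ker #> \<alpha> = ker #> \<beta>)"
    define b' where "b' = (SOME a. a \<in> D \<and> squares D #>\<^bsub>mult_grp D\<^esub> b = squares D #>\<^bsub>mult_grp D\<^esub> a)"
    have \<alpha>': "\<alpha>' \<in> carrier A" "ker #> \<alpha> = ker #> \<alpha>'"
      using someI [of "\<lambda>\<beta>. \<beta> \<in> carrier A \<and> ker #> \<alpha> = ker #> \<beta>" \<alpha>] \<alpha> unfolding \<alpha>'_def by auto
    have b': "b' \<in> D" "squares D #>\<^bsub>mult_grp D\<^esub> b = squares D #>\<^bsub>mult_grp D\<^esub> b'"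
      using someI [of "\<lambda>a. a \<in> D \<and> squares D #>\<^bsub>mult_grp D\<^esub> b = squares D #>\<^bsub>mult_grp D\<^esub> a" b] b
      unfolding b'_def by auto
    have "chi b' \<alpha>' = chi b' \<alpha>" using left.coset_eq_iff [OF \<alpha> \<alpha>'(1)] \<alpha>'(2) b' by simp
    also have "\<dots> = chi b \<alpha>" using right.coset_eq_iff [of b b'] b b' \<alpha> by simp
    finally show ?thesis by (simp add: p_def \<alpha>'_def b'_def)
  qed
  then show ?thesis unfolding perfect_pairing_def
    using left.duality_iso [of p] right.duality_iso [of "\<lambda>v u. p u v"]
    by (intro exI [of _ p]) simp
qed

end

section \<open>The kernel of the pairing and dual automorphisms\<close>

context rational_group
begin

interpretation L: csubfield "Q_adjoin H"
  by (rule csubfield_Q_adjoin)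

lemma carrier_Gal_Gamma: "s \<in> carrier (Gal_Gamma \<Gamma>) \<longleftrightarrow>
    s \<in> extensional (Q_adjoin H) \<and> bij_betw s (Q_adjoin H) (Q_adjoin H) \<and> field_hom_on (Q_adjoin H) s"
  by (simp add: Gal_Gamma_def L.carrier_Gal_Q)

text \<open>If \<open>x ^ n\<close> lies in \<Gamma>, then \<open>s x\<close> has the same n-th
  power, so \<open>s\<close> maps \<open>H\<close> into itself; the same computation places
  preimages of elements of \<open>H\<close> in \<open>H\<close>.\<close>

lemma restrict_Gal:
  assumes s: "s \<in> carrier (Gal_Gamma \<Gamma>)"
  shows "restrict s H \<in> carrier A"
proof -
  let ?L = "Q_adjoin H"
  have bij: "bij_betw s ?L ?L" and hom: "field_hom_on ?L s" using s by (auto simp: carrier_Gal_Gamma)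
  have HL: "x \<in> ?L" if "x \<in> H" for x using that Q_adjoin_incl by blast
  have \<Gamma>: "s x = x" if "x \<in> \<rat>" for x using L.hom_Rats [OF hom that] .
  have pow: "s x ^ n = x ^ n" if "x \<in> ?L" "x ^ n \<in> \<Gamma>" for x n
    using L.hom_props(4) [OF hom that(1), of n] \<Gamma> [of "x ^ n"] that(2) rat by auto
  have maps: "s x \<in> H" if x: "x \<in> H" for x
  proof -
    obtain n where "n \<ge> 1" "x ^ n \<in> \<Gamma>" using x by (auto simp: H_iff)
    then show ?thesis using pow [OF HL [OF x], of n] by (auto simp: H_iff)
  qed
  have "bij_betw s H H"
    unfolding bij_betw_def
  proof (intro conjI equalityI subsetI)
    show "inj_on s H" using bij HL by (auto simp: bij_betw_def inj_on_def)
  next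
    fix y assume y: "y \<in> H"
    then obtain n where n: "n \<ge> 1" "y ^ n \<in> \<Gamma>" by (auto simp: H_iff)
    obtain x where x: "x \<in> ?L" "y = s x" using bij HL [OF y] by (auto simp: bij_betw_def)
    have "s (x ^ n) = s (y ^ n)"
      using L.hom_props(4) [OF hom x(1), of n] \<Gamma> [of "y ^ n"] n rat x by auto
    then have "x ^ n = y ^ n"
      using bij L.power x HL [OF y] by (auto simp: bij_betw_def inj_on_def)
    then have "x \<in> H" using n by (auto simp: H_iff)
    then show "y \<in> s ` H" using x by blast
  qed (use maps in blast)
  then show ?thesis unfolding carrier_A
    using hom HL H.mult \<Gamma> Gamma_0_H
    by (auto simp: field_hom_on_def Gamma_0_def cong: bij_betw_cong)
qed

lemma chi_Gal:
  assumes s: "s \<in> carrier (Gal_Gamma \<Gamma>)" and b: "b \<in> D"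
  shows "chi b (restrict s H) = 1"
proof -
  define \<alpha> where "\<alpha> = restrict s H"
  have \<alpha>: "\<alpha> \<in> carrier A" unfolding \<alpha>_def by (rule restrict_Gal [OF s])
  have sub: "Q_unity \<subseteq> Q_adjoin H" using Q_adjoin_mono [OF mu_H] by (simp add: Q_adjoin_mu_inf)
  have hom: "field_hom_on Q_unity s" using s sub by (auto simp: carrier_Gal_Gamma field_hom_on_def)
  have mu: "mu_inf \<subseteq> Q_unity" using Q_adjoin_incl [of mu_inf] by (simp add: Q_adjoin_mu_inf)
  have "sigma_of \<alpha> x = s x" if "x \<in> mu_inf" for x
    using sigma_of(2) [OF \<alpha> that] that mu_H by (auto simp: \<alpha>_def)
  then have "sigma_of \<alpha> (pos_sqrt b) = s (pos_sqrt b)"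
    using QU.hom_agree [OF sigma_of_hom [OF \<alpha>] hom mu] sqrt_props(3) [OF b]
    by (simp add: Q_adjoin_mu_inf)
  also have "\<dots> = \<alpha> (pos_sqrt b)" using sqrt_props(4) [OF b] by (simp add: \<alpha>_def)
  finally have eq: "sigma_of \<alpha> (pos_sqrt b) = \<alpha> (pos_sqrt b)" .
  obtain e where "e \<in> {1, -1}" "\<alpha> (pos_sqrt b) = e * pos_sqrt b" using A_sqrt [OF \<alpha> b] .
  then show ?thesis using sqrt_props(2) [OF b] eq by (auto simp: chi_def \<alpha>_def)
qed

text \<open>With x = w \<surd>b, the two maps agree on the root of unity \<open>w\<close> by
  definition of \<open>sigma_of\<close>, and triviality of \<open>chi\<close> makes their signs on
  \<surd>b equal.\<close>

lemma chi_trivial_agree: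
  assumes \<alpha>: "\<alpha> \<in> carrier A" and triv: "\<And>b. b \<in> D \<Longrightarrow> chi b \<alpha> = 1"
    and x: "x \<in> H" "x \<in> Q_unity"
  shows "sigma_of \<alpha> x = \<alpha> x"
proof -
  obtain w b where w: "w \<in> mu_inf" and b: "b \<in> D" and xw: "x = w * pos_sqrt b"
    using radical_in_Q_unity [OF x] .
  let ?s = "pos_sqrt b"
  obtain e where e: "e \<in> {1, -1}" "\<alpha> ?s = e * ?s" using A_sqrt [OF \<alpha> b] .
  obtain f where f: "f \<in> {1, -1}" "sigma_of \<alpha> ?s = f * ?s" using sigma_sqrt [OF \<alpha> b] .
  have "e * f = 1" using triv [OF b] e f sqrt_props(2) [OF b] by (auto simp: chi_def)
  then have "e = f" using e f by auto
  moreover have "w \<in> Q_unity" using w Q_adjoin_incl [of mu_inf] by (auto simp: Q_adjoin_mu_inf)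
  ultimately show ?thesis
    using sigma_of_hom [OF \<alpha>] A_hom [OF \<alpha>, of w ?s] w mu_H sqrt_props(3,4) [OF b] e f
      sigma_of(2) [OF \<alpha> w] by (auto simp: xw field_hom_on_def)
qed

text \<open>The terms in the class of one element \<open>x0\<close> modulo the cyclotomic field sum
  to zero by \<open>radical_class_sum\<close>. Dividing by \<open>x0\<close> moves this partial
  relation into that field, where \<open>sigma_of \<alpha>\<close> agrees with \<alpha> on the
  radicals involved; multiplying by \<open>\<alpha> x0\<close> returns. Fewer terms remain.\<close>

lemma chi_trivial_relation:
  assumes \<alpha>: "\<alpha> \<in> carrier A" and triv: "\<And>b. b \<in> D \<Longrightarrow> chi b \<alpha> = 1"
    and "finite S" "S \<subseteq> H" and c: "\<And>x. c x \<in> \<rat>" and "(\<Sum>x\<in>S. c x * x) = 0"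
  shows "(\<Sum>x\<in>S. c x * \<alpha> x) = 0"
  using assms(3,4,6)
proof (induction "card S" arbitrary: S rule: less_induct)
  case less
  show ?case
  proof (cases "S = {}")
    case False
    then obtain x0 where x0: "x0 \<in> S" by blast
    have x0H: "x0 \<in> H" using x0 less.prems by blast
    then have x00: "x0 \<noteq> 0" by (rule H.nz)
    define T where "T = {x. x \<in> S \<and> x / x0 \<in> Q_unity}"
    have T: "T \<subseteq> S" "x0 \<in> T" "finite T" using x0 x00 less.prems by (auto simp: T_def)
    have rad: "x \<noteq> 0 \<and> (\<exists>n\<ge>1. x ^ n \<in> Q_unity)" if "x \<in> S" for x
    proof -
      have "x \<in> H" using that less.prems by blast
      then obtain n where "n \<ge> 1" "x ^ n \<in> \<Gamma>" by (auto simp: H_iff)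
      moreover have "\<Gamma> \<subseteq> Q_unity" using rat QU.rats by blast
      ultimately show ?thesis using H.nz [OF \<open>x \<in> H\<close>] by blast
    qed
    have cK: "c x \<in> Q_unity" for x using c QU.rats by blast
    have T0: "(\<Sum>x\<in>T. c x * x) = 0"
      unfolding T_def
      by (rule radical_class_sum [OF QU.csubfield_unity_axioms less.prems(1) rad cK less.prems(3) x0])
    have "(\<Sum>x\<in>S - T. c x * x) = 0"
      using sum.subset_diff [OF T(1) less.prems(1), of "\<lambda>x. c x * x"] T0 less.prems(3) by simp
    moreover have "card (S - T) < card S"
      using less.prems(1) T by (intro psubset_card_mono) auto
    ultimately have rest: "(\<Sum>x\<in>S - T. c x * \<alpha> x) = 0"
      using less.hyps [of "S - T"] less.prems by auto
    have Tq: "x / x0 \<in> H \<and> x / x0 \<in> Q_unity \<and> \<alpha> x = \<alpha> x0 * \<alpha> (x / x0)" if "x \<in> T" for x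
    proof -
      have xH: "x \<in> H" using that T less.prems by blast
      have q: "x / x0 \<in> H" using H.divide [OF xH x0H] .
      have "\<alpha> (x0 * (x / x0)) = \<alpha> x0 * \<alpha> (x / x0)" by (rule A_hom [OF \<alpha> x0H q])
      then show ?thesis using q that x00 by (simp add: T_def)
    qed
    have "(\<Sum>x\<in>T. c x * (x / x0)) = (\<Sum>x\<in>T. c x * x) / x0"
      by (simp add: sum_divide_distrib)
    then have "sigma_of \<alpha> (\<Sum>x\<in>T. c x * (x / x0)) = 0"
      using T0 QU.hom_props(1) [OF sigma_of_hom [OF \<alpha>]] by simp
    moreover have "sigma_of \<alpha> (\<Sum>x\<in>T. c x * (x / x0)) = (\<Sum>x\<in>T. sigma_of \<alpha> (c x * (x / x0)))"
      by (rule QU.hom_sum [OF sigma_of_hom [OF \<alpha>]]) (use cK Tq in blast)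
    moreover have "sigma_of \<alpha> (c x * (x / x0)) = c x * \<alpha> (x / x0)" if "x \<in> T" for x
    proof -
      have "sigma_of \<alpha> (c x * (x / x0)) = sigma_of \<alpha> (c x) * sigma_of \<alpha> (x / x0)"
        using sigma_of_hom [OF \<alpha>] cK Tq [OF that] unfolding field_hom_on_def by blast
      also have "sigma_of \<alpha> (c x) = c x" by (rule QU.hom_Rats [OF sigma_of_hom [OF \<alpha>] c])
      also have "sigma_of \<alpha> (x / x0) = \<alpha> (x / x0)"
        using chi_trivial_agree [OF \<alpha> triv] Tq [OF that] by blast
      finally show ?thesis .
    qed
    ultimately have "(\<Sum>x\<in>T. c x * \<alpha> (x / x0)) = 0" by simp
    then have "\<alpha> x0 * (\<Sum>x\<in>T. c x * \<alpha> (x / x0)) = 0" by simp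
    moreover have "\<alpha> x0 * (\<Sum>x\<in>T. c x * \<alpha> (x / x0)) = (\<Sum>x\<in>T. c x * \<alpha> x)"
      unfolding sum_distrib_left by (intro sum.cong refl) (use Tq in \<open>simp add: mult_ac\<close>)
    ultimately show ?thesis
      using sum.subset_diff [OF T(1) less.prems(1), of "\<lambda>x. c x * \<alpha> x"] rest by simp
  qed simp
qed

text \<open>The extension criterion asks for an equivalence of relations.
  \<open>chi_trivial_relation\<close> gives one direction; the other comes from applying it to the
  inverse of \<alpha>, also in the left kernel, with the relation transported to the image of
  \<open>S\<close>.\<close>

lemma kernel_Gal:
  assumes \<alpha>: "\<alpha> \<in> carrier A" and triv: "\<And>b. b \<in> D \<Longrightarrow> chi b \<alpha> = 1"
  shows "\<alpha> \<in> grp_G \<Gamma>"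
proof -
  define \<beta> where "\<beta> = inv\<^bsub>A\<^esub> \<alpha>"
  have \<beta>: "\<beta> \<in> carrier A" using \<alpha> by (simp add: \<beta>_def)
  have \<beta>\<alpha>: "\<beta> (\<alpha> x) = x" if "x \<in> H" for x
  proof -
    have "compose H \<beta> \<alpha> = (\<lambda>x\<in>H. x)"
      using A.l_inv [OF \<alpha>] A_mult [OF \<beta> \<alpha>] by (simp add: \<beta>_def A_one)
    from fun_cong [OF this, of x] show ?thesis using that by (simp add: compose_eq)
  qed
  have triv\<beta>: "chi b \<beta> = 1" if b: "b \<in> D" for b
  proof -
    have "chi b (\<beta> \<otimes>\<^bsub>A\<^esub> \<alpha>) = chi b \<beta>" using chi_mult_left [OF \<beta> \<alpha> b] triv [OF b] by simp
    moreover have "chi b (\<beta> \<otimes>\<^bsub>A\<^esub> \<alpha>) = chi b \<one>\<^bsub>A\<^esub>" using \<alpha> by (simp add: \<beta>_def)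
    moreover have "chi b \<one>\<^bsub>A\<^esub> * chi b \<one>\<^bsub>A\<^esub> = chi b \<one>\<^bsub>A\<^esub>"
      using chi_mult_left [OF A.one_closed A.one_closed b] by simp
    ultimately show ?thesis using chi_sign [OF \<beta> b] by auto
  qed
  have bij: "bij_betw \<alpha> H H" using \<alpha> by (simp add: carrier_A)
  have "\<exists>s\<in>carrier (Gal_Q (Q_adjoin H)). \<forall>x\<in>H. s x = \<alpha> x"
  proof (rule extend_to_field_automorphism)
    show "1 \<in> H" "0 \<notin> H" using H.nonzero by auto
    show "\<And>x y. x \<in> H \<Longrightarrow> y \<in> H \<Longrightarrow> x * y \<in> H \<and> \<alpha> (x * y) = \<alpha> x * \<alpha> y"
      using A_hom [OF \<alpha>] by auto
    show "\<alpha> ` H = H" using bij by (simp add: bij_betw_def)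
    fix S and c :: "complex \<Rightarrow> complex"
    assume S: "finite S" "S \<subseteq> H" and c: "\<And>x. c x \<in> \<rat>"
    show "(\<Sum>x\<in>S. c x * x) = 0 \<longleftrightarrow> (\<Sum>x\<in>S. c x * \<alpha> x) = 0"
    proof
      assume 0: "(\<Sum>x\<in>S. c x * x) = 0"
      show "(\<Sum>x\<in>S. c x * \<alpha> x) = 0" by (rule chi_trivial_relation [OF \<alpha> triv S c 0])
    next
      assume 0: "(\<Sum>x\<in>S. c x * \<alpha> x) = 0"
      have inj: "inj_on \<alpha> S" using A_inj [OF \<alpha>] S(2) by (auto simp: inj_on_def)
      have eq: "(\<Sum>y\<in>\<alpha> ` S. c (\<beta> y) * f y) = (\<Sum>x\<in>S. c x * f (\<alpha> x))" for f :: "complex \<Rightarrow> complex"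
        unfolding sum.reindex [OF inj] o_def
        by (intro sum.cong refl) (use \<beta>\<alpha> S(2) in auto)
      have 1: "(\<Sum>y\<in>\<alpha> ` S. c (\<beta> y) * y) = 0" unfolding eq by (rule 0)
      have "finite (\<alpha> ` S)" "\<alpha> ` S \<subseteq> H" using S A_closed [OF \<alpha>] by auto
      then have "(\<Sum>y\<in>\<alpha> ` S. c (\<beta> y) * \<beta> y) = 0"
        using chi_trivial_relation [OF \<beta> triv\<beta> _ _ c 1] by blast
      also have "(\<Sum>y\<in>\<alpha> ` S. c (\<beta> y) * \<beta> y) = (\<Sum>x\<in>S. c x * x)"
        unfolding eq by (intro sum.cong refl) (use \<beta>\<alpha> S(2) in auto)
      finally show "(\<Sum>x\<in>S. c x * x) = 0" .
    qed
  qed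
  then obtain s where s: "s \<in> carrier (Gal_Gamma \<Gamma>)" "\<forall>x\<in>H. s x = \<alpha> x"
    by (auto simp: Gal_Gamma_def)
  have "\<alpha> \<in> extensional H" using \<alpha> by (simp add: carrier_A)
  then have "\<alpha> = restrict s H" using s(2) by (auto simp: fun_eq_iff extensional_def)
  then show ?thesis using s(1) by (auto simp: grp_G_def)
qed

lemma grp_G_eq: "grp_G \<Gamma> = {\<alpha> \<in> carrier A. \<forall>b\<in>D. chi b \<alpha> = 1}"
  using kernel_Gal restrict_Gal chi_Gal by (auto simp: grp_G_def)

lemma restrict_Gal_mon: "(\<lambda>s. restrict s H) \<in> mon (Gal_Gamma \<Gamma>) A"
  unfolding mon_def
proof (intro CollectI conjI)
  show "(\<lambda>s. restrict s H) \<in> hom (Gal_Gamma \<Gamma>) A"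
  proof (rule homI)
    fix s t assume st: "s \<in> carrier (Gal_Gamma \<Gamma>)" "t \<in> carrier (Gal_Gamma \<Gamma>)"
    have mult: "s \<otimes>\<^bsub>Gal_Gamma \<Gamma>\<^esub> t = compose (Q_adjoin H) s t"
      using L.Gal_Q_mult st by (simp add: Gal_Gamma_def)
    have "restrict s H \<otimes>\<^bsub>A\<^esub> restrict t H = compose H (restrict s H) (restrict t H)"
      using A_mult restrict_Gal st by blast
    moreover have "t x \<in> H" if "x \<in> H" for x
      using A_closed [OF restrict_Gal [OF st(2)] that] that by simp
    ultimately show "restrict (s \<otimes>\<^bsub>Gal_Gamma \<Gamma>\<^esub> t) H = restrict s H \<otimes>\<^bsub>A\<^esub> restrict t H"
      using Q_adjoin_incl [of H] by (auto simp: mult compose_def fun_eq_iff)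
  qed (rule restrict_Gal)
  show "inj_on (\<lambda>s. restrict s H) (carrier (Gal_Gamma \<Gamma>))"
  proof (rule inj_onI)
    fix s t assume st: "s \<in> carrier (Gal_Gamma \<Gamma>)" "t \<in> carrier (Gal_Gamma \<Gamma>)"
      and eq: "restrict s H = restrict t H"
    show "s = t"
    proof (rule L.Gal_Q_eqI [of s H t])
      fix x assume "x \<in> H"
      then show "s x = t x" using fun_cong [OF eq, of x] by simp
    qed (use st in \<open>auto simp: Gal_Gamma_def\<close>)
  qed
qed

text \<open>The extension of \<open>v\<close> to all radicals. Passing to the modulus removes the
  torsion, and dividing by \<open>n\<close> accounts for the roots taken.\<close>

definition exponent :: "(complex \<Rightarrow> int) \<Rightarrow> complex \<Rightarrow> real"
  where "exponent v x = (let n = SOME n. n \<ge> 1 \<and> complex_of_real (cmod x) ^ n \<in> D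
    in real_of_int (v (complex_of_real (cmod x) ^ n)) / real n)"

text \<open>The automorphism \<open>\<alpha>\<close> below is the identity on roots of unity, so \<open>\<sigma>\<^sub>\<alpha>\<close> is trivial and
  \<open>\<chi>\<^bsub>[b]\<^esub>(\<alpha>)\<close> is read off from \<open>\<alpha>(\<surd>b)\<close> alone.\<close>

lemma dual_automorphism:
  assumes "int_hom D v"
  shows "\<exists>\<alpha>\<in>carrier A. \<forall>b\<in>D. chi b \<alpha> = (if even (v b) then 1 else -1)"
proof -
  interpret int_hom D v by fact
  define \<Lambda> where "\<Lambda> = exponent v"
  \<comment> \<open>Two admissible exponents m and n are compared through the power m n of the
    modulus, so the one picked by \<open>SOME\<close> can be replaced by any other.\<close>
  have \<Lambda>: "\<Lambda> x = real_of_int (v (complex_of_real (cmod x) ^ n)) / real n"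
    if n: "n \<ge> 1" "complex_of_real (cmod x) ^ n \<in> D" for x n
  proof -
    let ?y = "complex_of_real (cmod x)"
    define m where "m = (SOME n. n \<ge> 1 \<and> ?y ^ n \<in> D)"
    have m: "m \<ge> 1" "?y ^ m \<in> D"
      using someI [of "\<lambda>n. n \<ge> 1 \<and> ?y ^ n \<in> D" n] n unfolding m_def by auto
    have "(?y ^ m) ^ n = (?y ^ n) ^ m" by (simp add: mult.commute flip: power_mult)
    then have "int n * v (?y ^ m) = int m * v (?y ^ n)"
      using v_power [OF m(2), of n] v_power [OF n(2), of m] by simp
    then have "real n * real_of_int (v (?y ^ m)) = real m * real_of_int (v (?y ^ n))"
      by (metis of_int_mult of_int_of_nat_eq)
    then have "real_of_int (v (?y ^ m)) / real m = real_of_int (v (?y ^ n)) / real n"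
      using m n by (simp add: field_simps)
    then show ?thesis by (simp add: \<Lambda>_def exponent_def Let_def m_def)
  qed
  have \<Lambda>_mult: "\<Lambda> (x * y) = \<Lambda> x + \<Lambda> y" if xy: "x \<in> H" "y \<in> H" for x y
  proof -
    obtain m where m: "m \<ge> 1" "complex_of_real (cmod x) ^ m \<in> D" using modulus_power [OF xy(1)] by blast
    obtain n where n: "n \<ge> 1" "complex_of_real (cmod y) ^ n \<in> D" using modulus_power [OF xy(2)] by blast
    have mn: "m * n \<ge> 1" using m n by simp
    have x: "complex_of_real (cmod x) ^ (m * n) \<in> D" unfolding power_mult by (rule D.power [OF m(2)])
    have y: "complex_of_real (cmod y) ^ (m * n) \<in> D"
      unfolding mult.commute [of m] power_mult by (rule D.power [OF n(2)])
    have "complex_of_real (cmod (x * y)) ^ (m * n) =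
        complex_of_real (cmod x) ^ (m * n) * complex_of_real (cmod y) ^ (m * n)"
      by (simp add: norm_mult power_mult_distrib)
    then show ?thesis
      using \<Lambda> [OF mn x] \<Lambda> [OF mn y] \<Lambda> [OF mn, of "x * y"] D.mult [OF x y] add [OF x y]
      by (simp add: add_divide_distrib)
  qed
  have \<Lambda>_mu: "\<Lambda> w = 0" if w: "w \<in> mu_inf" for w
  proof -
    obtain n :: nat where n: "n \<ge> 1" "w ^ n = 1" using w by (rule mu_infE)
    have "cmod w ^ n = 1 ^ n" using n(2) by (simp flip: norm_power)
    then have "cmod w = 1" by (rule power_eq_imp_eq_base) (use n in auto)
    then show ?thesis using \<Lambda> [of 1 w] v_one by simp
  qed
  \<comment> \<open>\<Lambda> is integral on rational radicals, so the twist is trivial there, while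
    the half-integers occurring on square roots become signs.\<close>
  define \<theta> where "\<theta> x = cis (2 * pi * \<Lambda> x)" for x
  have \<theta>_mult: "\<theta> (x * y) = \<theta> x * \<theta> y" if "x \<in> H" "y \<in> H" for x y
    using \<Lambda>_mult [OF that] by (simp add: \<theta>_def cis_mult distrib_left)
  have \<theta>_mu_inf: "\<theta> x \<in> mu_inf" if x: "x \<in> H" for x
  proof -
    obtain n where n: "n \<ge> 1" "complex_of_real (cmod x) ^ n \<in> D" using modulus_power [OF x] by blast
    define k where "k = v (complex_of_real (cmod x) ^ n)"
    have "\<theta> x ^ n = cis (2 * pi * real_of_int k)"
      using n by (simp add: \<theta>_def Complex.DeMoivre \<Lambda> [OF n] k_def)
    also have "\<dots> = 1" by (rule cis_multiple_2pi) simp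
    finally show ?thesis using n mu_infI by blast
  qed
  have \<theta>_nz: "\<theta> x \<noteq> 0" for x by (simp add: \<theta>_def)
  have \<theta>_mu: "\<theta> w = 1" if "w \<in> mu_inf" for w using \<Lambda>_mu [OF that] by (simp add: \<theta>_def)
  have \<theta>_0: "\<theta> x = 1" if x: "x \<in> Gamma_0 \<Gamma>" for x
  proof -
    have xQ: "x \<in> \<rat>" "x \<noteq> 0" and xH: "x \<in> H" using x by (auto simp: Gamma_0_def)
    have "complex_of_real (cmod x) \<in> D"
    proof (rule D_posI)
      show "complex_of_real (cmod x) \<in> \<rat>"
        using Rats_of_real_cmod_sq [OF xQ(1)] xQ(1) unfolding power2_eq_iff
        by (elim disjE) (simp_all only: Rats_minus_iff)
      obtain n where "n \<ge> 1" "complex_of_real (cmod x) ^ n \<in> D" using modulus_power [OF xH] by blast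
      then show "complex_of_real (cmod x) \<in> H" using H_root D_H by blast
    qed (use xQ in auto)
    then have "\<Lambda> x = real_of_int (v (complex_of_real (cmod x)))" using \<Lambda> [of 1 x] by simp
    then show ?thesis unfolding \<theta>_def by (simp add: cis_multiple_2pi)
  qed
  define \<alpha> where "\<alpha> = (\<lambda>x\<in>H. x * \<theta> x)"
  \<comment> \<open>\<alpha> changes its argument only by a root of unity, a factor that \<theta>
    ignores; hence dividing by \<theta> inverts \<alpha>.\<close>
  have \<theta>_inv: "\<theta> (x * w) = \<theta> x" if "x \<in> H" "w \<in> mu_inf" for x w
    using \<theta>_mult [of x w] \<theta>_mu [OF that(2)] that mu_H by auto
  interpret M: csubgroup mu_inf by (rule csubgroup_mu_inf)
  have "bij_betw \<alpha> H H"
    unfolding bij_betw_def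
  proof (intro conjI equalityI subsetI)
    show "inj_on \<alpha> H"
    proof (rule inj_onI)
      fix x y assume xy: "x \<in> H" "y \<in> H" "\<alpha> x = \<alpha> y"
      then have "x = y * (\<theta> y / \<theta> x)" using \<theta>_nz [of x] by (simp add: \<alpha>_def field_simps)
      moreover have "\<theta> y / \<theta> x \<in> mu_inf" using \<theta>_mu_inf xy by (intro M.divide)
      ultimately have "\<theta> x = \<theta> y" using \<theta>_inv [OF xy(2)] by metis
      then show "x = y" using xy \<theta>_nz [of x] by (simp add: \<alpha>_def)
    qed
  next
    fix y assume "y \<in> \<alpha> ` H"
    then show "y \<in> H" using \<theta>_mu_inf mu_H H.mult by (auto simp: \<alpha>_def)
  next
    fix y assume y: "y \<in> H"
    have w: "inverse (\<theta> y) \<in> mu_inf" using \<theta>_mu_inf [OF y] by (rule M.inverse)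
    then have "y * inverse (\<theta> y) \<in> H" using y mu_H H.mult by blast
    moreover have "\<alpha> (y * inverse (\<theta> y)) = y"
      using calculation \<theta>_inv [OF y w] \<theta>_nz [of y] by (simp add: \<alpha>_def)
    ultimately show "y \<in> \<alpha> ` H" by (metis imageI)
  qed
  then have \<alpha>A: "\<alpha> \<in> carrier A" unfolding carrier_A
    using H.mult \<theta>_mult \<theta>_0 Gamma_0_H by (auto simp: \<alpha>_def)
  have "sigma_of \<alpha> = (\<lambda>x\<in>Q_unity. x)"
  proof (rule sigma_of_unique)
    show "(\<lambda>x\<in>Q_unity. x) \<in> carrier (Gal_Q (Q_adjoin mu_inf))"
      unfolding Q_adjoin_mu_inf QU.carrier_Gal_Q using QU.add QU.mult
      by (auto simp: bij_betw_def inj_on_def field_hom_on_def)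
    fix x assume x: "x \<in> mu_inf"
    then have "x \<in> Q_unity" using Q_adjoin_incl [of mu_inf] by (auto simp: Q_adjoin_mu_inf)
    then show "(\<lambda>x\<in>Q_unity. x) x = \<alpha> x" using x mu_H \<theta>_mu by (auto simp: \<alpha>_def)
  qed
  moreover have "\<theta> (pos_sqrt b) = (if even (v b) then 1 else -1)" if b: "b \<in> D" for b
  proof -
    obtain t where t: "t > 0" "pos_sqrt b = complex_of_real t" using sqrt_props(5) [OF b] by blast
    have "complex_of_real (cmod (pos_sqrt b)) ^ 2 = b" using t sqrt_props(1) [OF b] by simp
    \<comment> \<open>The square root carries half the exponent of \<open>b\<close>, which turns the
      twist there into a half turn for each unit of \<open>v b\<close>.\<close>
    then have L: "\<Lambda> (pos_sqrt b) = real_of_int (v b) / 2" using \<Lambda> [of 2 "pos_sqrt b"] b by simp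
    have th: "\<theta> (pos_sqrt b) = cis (pi * real_of_int (v b))" unfolding \<theta>_def L by simp
    show ?thesis
    proof (cases "even (v b)")
      case True
      then obtain k where "v b = 2 * k" by (elim evenE)
      then have "\<theta> (pos_sqrt b) = cis (2 * pi * real_of_int k)" unfolding th by (simp add: mult_ac)
      then show ?thesis using True by (simp add: cis_multiple_2pi)
    next
      case False
      then obtain k where "v b = 2 * k + 1" by (elim oddE)
      then have eq: "pi * real_of_int (v b) = 2 * pi * real_of_int k + pi" by (simp add: algebra_simps)
      show ?thesis using False unfolding th eq cis_mult [symmetric] by (simp add: cis_multiple_2pi)
    qed
  qed
  ultimately have "\<forall>b\<in>D. chi b \<alpha> = (if even (v b) then 1 else -1)"
    using sqrt_props(2,3,4) by (auto simp: chi_def \<alpha>_def)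
  then show ?thesis using \<alpha>A by blast
qed

end

theorem theorem2p5:
  fixes \<Gamma> :: "complex set" and r :: nat
  assumes "subgroup \<Gamma> C_units" and "\<Gamma> \<subseteq> \<rat> - {0}"
    and "fin_gen_subgroup \<Gamma>" and "has_rank \<Gamma> r"
  shows
   "(\<lambda>\<sigma>. restrict \<sigma> (Gamma_inf \<Gamma>)) \<in> mon (Gal_Gamma \<Gamma>) (grp_A \<Gamma>) \<and>
    grp_G \<Gamma> \<lhd> grp_A \<Gamma> \<and>
    card (rcosets\<^bsub>grp_A \<Gamma>\<^esub> grp_G \<Gamma>) = 2 ^ r \<and>
    elementary_abelian_2 (grp_A \<Gamma> Mod grp_G \<Gamma>) \<and>
    elementary_abelian_2 (mult_grp (Gamma_0_pos \<Gamma>) Mod squares (Gamma_0_pos \<Gamma>)) \<and>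
    (\<exists>p. (\<forall>\<alpha>\<in>carrier (grp_A \<Gamma>). \<forall>b\<in>Gamma_0_pos \<Gamma>.
               p (grp_G \<Gamma> #>\<^bsub>grp_A \<Gamma>\<^esub> \<alpha>)
                 (squares (Gamma_0_pos \<Gamma>) #>\<^bsub>mult_grp (Gamma_0_pos \<Gamma>)\<^esub> b) = chi b \<alpha>) \<and>
             perfect_pairing (grp_A \<Gamma> Mod grp_G \<Gamma>)
               (mult_grp (Gamma_0_pos \<Gamma>) Mod squares (Gamma_0_pos \<Gamma>)) mu_2 p)"
proof -
  interpret R: rational_group \<Gamma>
    by (rule rational_group.intro) (rule assms)+
  obtain B where B: "B \<subseteq> R.D" "finite B" "mult_independent B"
    and gen: "\<And>x. x \<in> R.D \<Longrightarrow> \<exists>k :: complex \<Rightarrow> int. x = (\<Prod>b\<in>B. b powi k b)"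
    using R.basis_exists by blast
  interpret P: sign_pairing "grp_A \<Gamma>" "Gamma_0_pos \<Gamma>" chi B
  proof
    fix S assume S: "S \<subseteq> B"
    obtain v where v: "int_hom R.D v" "\<forall>b\<in>B. v b = (if b \<in> S then 1 else 0)"
      using R.dual_hom [OF B gen S] by blast
    obtain \<alpha> where "\<alpha> \<in> carrier R.A" "\<forall>b\<in>R.D. chi b \<alpha> = (if even (v b) then 1 else -1)"
      using R.dual_automorphism [OF v(1)] by blast
    \<comment> \<open>On \<open>B\<close> the homomorphism \<open>v\<close> takes only the values 0
      and 1, so odd parity marks exactly \<open>S\<close>.\<close>
    then show "\<exists>\<alpha>\<in>carrier R.A. \<forall>b\<in>B. chi b \<alpha> = (if b \<in> S then - 1 else 1)"
      using v(2) B(1) by (intro bexI [of _ \<alpha>]) auto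
  next
    fix x assume "x \<in> R.D"
    then show "\<exists>S\<subseteq>B. \<exists>y\<in>R.D. x = (\<Prod>b\<in>S. b) * y ^ 2"
      using R.basis_mod_squares [OF B(1,2) gen] by blast
  qed (use R.chi_sign R.chi_mult_left R.chi_mult_right B in auto)
  \<comment> \<open>This identification turns the abstract kernel statements, normality and index
    included, into statements about the Galois group.\<close>
  have ker: "grp_G \<Gamma> = P.ker" by (simp add: R.grp_G_eq P.ker_def)
  show ?thesis unfolding ker
    using R.restrict_Gal_mon P.normal_ker P.card_rcosets_ker R.card_basis [OF B gen assms(4)]
      P.left.elementary_quotient P.right.elementary_quotient P.perfect
    by simp
qed

end
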